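(* Let $k$ and $d$ be positive integers with $d>3k$, let $\mu=\left\lceil\dfrac{\lceil d/3\rceil-k}{2}\right\rceil$ and \[ \mathcal{E}=\max\left\{2(d-1)(d-2),\ \frac{(d-1)(d-2)(d-3)}{2\mu}\right\}. \] There exists a positive constant $C$ depending only on $d$ such that the following holds. For every algebraic integer $\alpha$ of degree $d$ that is not a root of unity and for every $(c_1,\dots,c_k)\in E_{k,d}$, we have \[ |\alpha_0||\alpha_1|^{c_1}\cdots|\alpha_k|^{c_k}>1+C\,H^{-\mathcal{E}+1/(k(d-1))}, \] where $H$ is the height of the minimal polynomial of $\alpha$.
   Context: For an algebraic number $\alpha$ of degree $d\ge 2$ (over $\mathbb{Q}$), label its Galois conjugates (the complex roots of its minimal polynomial over $\mathbb{Q}$) as $\alpha_0,\dots,\alpha_{d-1}$ so that $|\alpha_0|\ge|\alpha_1|\ge\cdots\ge|\alpha_{d-1}|$ (the choice among conjugates of equal modulus is irrelevant). For positive integers $d>k$, $E_{k,d}$ is the set of all tuples $(c_1,\dots,c_k)\in(\mathbb{R}_{\ge 0})^k$ such that for every algebraic integer $\alpha$ of degree $d$ we have $|\alpha_0||\alpha_1|^{c_1}\cdots|\alpha_k|^{c_k}\ge 1$. The height of a polynomial with integer coefficients is the maximum of the absolute values of its coefficients. *)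

theory Defs
  imports
    "HOL-Library.FuncSet"
    "HOL-Computational_Algebra.Computational_Algebra"
    "HOL-Computational_Algebra.Field_as_Ring"
begin

text \<open>The minimal polynomial over the rationals; it is meaningful for algebraic numbers only.
  For algebraic integers, lemma \<open>rat_min_poly\<close> below shows that it is well defined.\<close>

definition rat_min_poly :: "complex \<Rightarrow> rat poly" where
  "rat_min_poly \<alpha> =
     (THE p. lead_coeff p = 1 \<and> irreducible p \<and> poly (map_poly of_rat p) \<alpha> = 0)"

definition alg_degree :: "complex \<Rightarrow> nat" where
  "alg_degree \<alpha> = degree (rat_min_poly \<alpha>)"

definition conjugates :: "complex \<Rightarrow> complex set" where
  "conjugates \<alpha> = {z. poly (map_poly of_rat (rat_min_poly \<alpha>)) z = 0}"

text \<open>\<open>a\<close> lists the conjugates of \<open>\<alpha>\<close> as \<open>a 0, \<dots>, a (d - 1)\<close>, where \<open>d\<close> is the degree of \<open>\<alpha>\<close>,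
  in order of non-increasing modulus. Such a labelling exists (lemma \<open>conj_labelling_exists\<close>)
  but need not be unique; everything below quantifies over all of them and depends only on
  the moduli.\<close>

definition conj_labelling :: "complex \<Rightarrow> (nat \<Rightarrow> complex) \<Rightarrow> bool" where
  "conj_labelling \<alpha> a \<longleftrightarrow>
     bij_betw a {..<alg_degree \<alpha>} (conjugates \<alpha>) \<and>
     (\<forall>i j. i \<le> j \<and> j < alg_degree \<alpha> \<longrightarrow> cmod (a j) \<le> cmod (a i))"

text \<open>A tuple \<open>(c\<^sub>1, \<dots>, c\<^sub>k)\<close> is an extensional function on \<open>{1..k}\<close>. In degree at least 2 the
  conjugates are nonzero, so the convention \<open>0 powr 0 = 0\<close> plays no role.\<close>

definition E_set :: "nat \<Rightarrow> nat \<Rightarrow> (nat \<Rightarrow> real) set" where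
  "E_set k d =
     {c \<in> {1..k} \<rightarrow>\<^sub>E {0..}.
        \<forall>\<alpha> a. algebraic_int \<alpha> \<and> alg_degree \<alpha> = d \<and> conj_labelling \<alpha> a \<longrightarrow>
          cmod (a 0) * (\<Prod>i=1..k. cmod (a i) powr c i) \<ge> 1}"

text \<open>The coefficient type is kept general because \<open>rat_min_poly\<close> is formally a rational
  polynomial, although for an algebraic integer its coefficients are integers.\<close>

definition poly_height :: "'a::linordered_idom poly \<Rightarrow> 'a" where
  "poly_height p = Max ((\<lambda>i. \<bar>coeff p i\<bar>) ` {..degree p})"

definition mu :: "nat \<Rightarrow> nat \<Rightarrow> int" where
  "mu k d = \<lceil>of_int (\<lceil>real d / 3\<rceil> - int k) / (2::real)\<rceil>"

definition calE :: "nat \<Rightarrow> nat \<Rightarrow> real" where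
  "calE k d =
     max (2 * (real d - 1) * (real d - 2))
         ((real d - 1) * (real d - 2) * (real d - 3) / (2 * of_int (mu k d)))"

lemma poly_of_rat_mult:
  "poly (map_poly of_rat (p * q)) (x::complex) =
     poly (map_poly of_rat p) x * poly (map_poly of_rat q) x"
proof -
  have "map_poly of_rat (p * q) = map_poly of_rat p * (map_poly of_rat q :: complex poly)"
    by (rule poly_eqI) (simp add: coeff_map_poly coeff_mult of_rat_sum of_rat_mult)
  then show ?thesis by simp
qed

lemma poly_of_rat_add:
  "poly (map_poly of_rat (p + q)) (x::complex) =
     poly (map_poly of_rat p) x + poly (map_poly of_rat q) x"
proof -
  have "map_poly of_rat (p + q) = map_poly of_rat p + (map_poly of_rat q :: complex poly)"
    by (rule poly_eqI) (simp add: coeff_map_poly of_rat_add)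
  then show ?thesis by simp
qed

lemma no_common_root:
  fixes p q :: "rat poly" and x :: complex
  assumes "coprime p q" "poly (map_poly of_rat p) x = 0" "poly (map_poly of_rat q) x = 0"
  shows False
proof -
  obtain r s where "r * p + s * q = 1"
    using bezout_coefficients_fst_snd[of p q] assms(1) by (metis coprime_iff_gcd_eq_1)
  then have "poly (map_poly of_rat (r * p + s * q)) x = 1"
    by (simp add: map_poly_1)
  then show False
    using assms by (simp add: poly_of_rat_add poly_of_rat_mult)
qed

lemma rat_min_poly_ex1:
  fixes \<alpha> :: complex
  assumes "algebraic_int \<alpha>"
  shows "\<exists>!p. lead_coeff p = 1 \<and> irreducible p \<and> poly (map_poly of_rat p) \<alpha> = 0"
proof -
  define root where "root = (\<lambda>p::rat poly. p \<noteq> 0 \<and> poly (map_poly of_rat p) \<alpha> = 0)"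
  obtain P where P: "poly (map_poly of_int P) \<alpha> = 0" "lead_coeff P = 1"
    using assms by (auto simp: algebraic_int_altdef_ipoly)
  have "map_poly of_rat (map_poly of_int P) = (map_poly of_int P :: complex poly)"
    by (rule poly_eqI) (simp add: coeff_map_poly)
  moreover have "coeff (map_poly of_int P :: rat poly) (degree P) = 1"
    using P(2) by (simp add: coeff_map_poly)
  ultimately have "root (map_poly of_int P)"
    using P(1) by (auto simp: root_def)
  then obtain q where q: "root q" and least: "\<And>r. root r \<Longrightarrow> degree q \<le> degree r"
    using exists_least_iff[of "\<lambda>n. \<exists>p. root p \<and> degree p = n"] by (metis linorder_not_less)
  have split: "b dvd 1" if "q = b * c" "root c" for b c
  proof -
    have "b \<noteq> 0" "c \<noteq> 0" using q that by (auto simp: root_def)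
    then have "degree b = 0"
      using least[OF that(2)] that(1) by (simp add: degree_mult_eq)
    then show ?thesis
      using \<open>b \<noteq> 0\<close> by (simp add: is_unit_iff_degree)
  qed
  have "irreducible q"
  proof (rule irreducibleI)
    show "q \<noteq> 0" using q by (simp add: root_def)
    show "\<not> q dvd 1"
    proof
      assume "q dvd 1"
      then have "coprime q q" by simp
      then show False using no_common_root[of q q \<alpha>] q by (simp add: root_def)
    qed
  next
    fix a b assume ab: "q = a * b"
    then have "root a \<or> root b"
      using q by (auto simp: root_def poly_of_rat_mult)
    then show "a dvd 1 \<or> b dvd 1"
      using split[of a b] split[of b a] ab by (auto simp: mult.commute)
  qed
  define m where "m = smult (inverse (lead_coeff q)) q"
  have lq: "lead_coeff q \<noteq> 0" using q by (simp add: root_def)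
  have "irreducible m"
  proof -
    have "is_unit [:inverse (lead_coeff q):]"
      using lq by (simp add: is_unit_iff_degree)
    then have "irreducible ([:inverse (lead_coeff q):] * q)"
      using \<open>irreducible q\<close> by (subst irreducible_mult_unit_left) auto
    then show ?thesis by (simp add: m_def)
  qed
  moreover have "lead_coeff m = 1" using lq by (simp add: m_def)
  moreover have "poly (map_poly of_rat ([:inverse (lead_coeff q):] * q)) \<alpha> = 0"
    unfolding poly_of_rat_mult using q by (simp add: root_def)
  then have "poly (map_poly of_rat m) \<alpha> = 0" by (simp add: m_def)
  moreover have "p = p'"
    if p: "lead_coeff p = 1" "irreducible p" "poly (map_poly of_rat p) \<alpha> = 0"
      and p': "lead_coeff p' = 1" "irreducible p'" "poly (map_poly of_rat p') \<alpha> = 0"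
    for p p' :: "rat poly"
  proof -
    have "\<not> coprime p p'" "\<not> coprime p' p"
      using no_common_root p(3) p'(3) by blast+
    then have "p dvd p'" "p' dvd p"
      using p(2) p'(2) irreducible_imp_prime_elem prime_elem_imp_coprime by blast+
    then obtain k where k: "p' = p * k" by (elim dvdE)
    have nz: "p \<noteq> 0" "p' \<noteq> 0" using p(1) p'(1) by auto
    then have "degree p' \<le> degree p" using \<open>p' dvd p\<close> dvd_imp_degree_le by blast
    then have "degree k = 0" using k nz by (auto simp: degree_mult_eq)
    then obtain u where "k = [:u:]" by (rule degree_eq_zeroE)
    moreover have "lead_coeff k = 1" using k p(1) p'(1) by (simp add: lead_coeff_mult)
    ultimately show ?thesis using k by simp
  qed
  ultimately show ?thesis by blast
qed

lemma rat_min_poly: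
  fixes \<alpha> :: complex
  assumes "algebraic_int \<alpha>"
  shows "lead_coeff (rat_min_poly \<alpha>) = 1"
    and "irreducible (rat_min_poly \<alpha>)"
    and "poly (map_poly of_rat (rat_min_poly \<alpha>)) \<alpha> = 0"
  using theI'[OF rat_min_poly_ex1[OF assms]] by (auto simp: rat_min_poly_def)

lemma card_conjugates:
  fixes \<alpha> :: complex
  assumes "algebraic_int \<alpha>"
  shows "finite (conjugates \<alpha>)" "card (conjugates \<alpha>) = alg_degree \<alpha>"
proof -
  let ?m = "rat_min_poly \<alpha>"
  let ?M = "map_poly of_rat ?m :: complex poly"
  have irr: "irreducible ?m" and "?m \<noteq> 0"
    using rat_min_poly[OF assms] by auto
  have M0: "?M \<noteq> 0" and deg: "degree ?M = degree ?m"
    using \<open>?m \<noteq> 0\<close> by (auto simp: map_poly_eq_0_iff degree_map_poly)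
  then show "finite (conjugates \<alpha>)"
    by (simp add: conjugates_def poly_roots_finite)
  have "degree ?m \<noteq> 0"
    using irr \<open>?m \<noteq> 0\<close> by (metis irreducible_def is_unit_iff_degree)
  then have "pderiv ?m \<noteq> 0" "\<not> ?m dvd pderiv ?m"
    by (auto simp: pderiv_eq_0_iff degree_pderiv dest!: dvd_imp_degree_le)
  then have cop: "coprime ?m (pderiv ?m)"
    using irr irreducible_imp_prime_elem prime_elem_imp_coprime by blast
  have "pderiv ?M = map_poly of_rat (pderiv ?m)"
    by (rule poly_eqI) (simp add: coeff_map_poly coeff_pderiv of_rat_mult of_rat_add)
  then have "rsquarefree ?M"
    unfolding rsquarefree_roots using no_common_root[OF cop] by auto
  then have "degree ?M = degree (smult (lead_coeff ?M) (\<Prod>z\<in>conjugates \<alpha>. [:- z, 1:]))"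
    unfolding conjugates_def by (subst complex_poly_decompose_rsquarefree) auto
  also have "\<dots> = card (conjugates \<alpha>)"
    using M0 by (simp add: degree_prod_sum_eq)
  finally show "card (conjugates \<alpha>) = alg_degree \<alpha>"
    using deg by (simp add: alg_degree_def)
qed

lemma conj_labelling_exists:
  fixes \<alpha> :: complex
  assumes "algebraic_int \<alpha>"
  shows "\<exists>a. conj_labelling \<alpha> a"
proof -
  obtain xs where xs: "set xs = conjugates \<alpha>" "distinct xs"
    using card_conjugates(1)[OF assms] finite_distinct_list by blast
  define ys where "ys = sort_key (\<lambda>z. - cmod z) xs"
  have ys: "set ys = conjugates \<alpha>" "distinct ys" "length ys = alg_degree \<alpha>"
    using xs card_conjugates(2)[OF assms] distinct_card[OF xs(2)] by (auto simp: ys_def)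
  have "sorted (map (\<lambda>z. - cmod z) ys)" by (simp add: ys_def)
  then have "cmod (ys ! j) \<le> cmod (ys ! i)" if "i \<le> j" "j < length ys" for i j
    using that sorted_nth_mono[of "map (\<lambda>z. - cmod z) ys" i j] by simp
  then have "conj_labelling \<alpha> ((!) ys)"
    using bij_betw_nth[OF ys(2), of "{..<length ys}" "set ys"] ys
    by (simp add: conj_labelling_def)
  then show ?thesis by blast
qed

end

theory Submission
  imports Defs "Jordan_Normal_Form.Char_Poly"
begin

text \<open>Put \<open>x\<^sub>i = ln (cmod \<alpha>\<^sub>i)\<close>. As \<open>exp L \<ge> 1 + L\<close>, it is enough to bound \<open>L = x\<^sub>0 + c\<^sub>1 x\<^sub>1 + \<dots> +
  c\<^sub>k x\<^sub>k\<close> from below.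

  For \<open>1 \<le> m \<le> k\<close> and large \<open>N\<close> the polynomial \<open>X ^ d + 2 N X ^ (d - m) + 2\<close> is irreducible, with
  \<open>m\<close> roots of modulus about \<open>N powr (1 / m)\<close> and \<open>d - m\<close> roots of modulus about \<open>N powr (- 1 / (d
  - m))\<close>. As its roots satisfy the inequality that defines \<open>E_set k d\<close>, the exponents \<open>c\<close> obey one
  linear inequality for every \<open>m\<close> (\<open>E_set_partial_sums\<close>). By partial summation these give \<open>d L \<ge>
  ln n + (x\<^sub>k - x\<^sub>d\<^sub>-\<^sub>1)\<close>, where \<open>n\<close> is the absolute value of the norm of \<open>\<alpha>\<close>
  (\<open>weighted_log_sum_lower_bound\<close>). So the problem is to bound the gap \<open>\<delta> = x\<^sub>k - x\<^sub>d\<^sub>-\<^sub>1\<close> for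
  units, when it is small and thus \<open>d - k > 2 d / 3\<close> conjugates lie in a thin annulus
  (\<open>unit_gap\<close>).

  For conjugates \<open>x\<close> and \<open>y\<close> in the annulus, of different moduli, \<open>x * cnj x - y * cnj y\<close> is small
  but not 0. The product of all nonzero differences \<open>x\<^sub>1 * x\<^sub>2 - x\<^sub>3 * x\<^sub>4\<close>, over tuples of
  distinct conjugates, is an integer. As each conjugate occurs in \<open>4 (d - 1) (d - 2) (d - 3)\<close>
  tuples, the factors that are not small contribute at most the corresponding power of the Mahler
  measure \<open>M\<close>; so \<open>8 \<mu>\<close> small factors, each of size about \<open>\<delta>\<close>, force \<open>\<delta>\<close> to be at least about \<open>M
  powr (- (d - 1) (d - 2) (d - 3) / (2 \<mu>))\<close> (\<open>separation_of_monomials\<close>). A real conjugate in the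
  annulus leads to the shorter products of differences \<open>x\<^sub>1 ^ 2 - x\<^sub>2 * x\<^sub>3\<close> or \<open>x\<^sub>1 ^ 2 - x\<^sub>2 ^
  2\<close>, and to the exponent \<open>2 (d - 1) (d - 2)\<close>. Since the small factors are small relative to the
  square of the smallest modulus, which is at most \<open>M powr (- 2 / d)\<close>, the exponent improves by \<open>2
  / d \<ge> 1 / (k (d - 1))\<close>. By Landau's inequality, \<open>M\<close> is at most a constant times the height.

  There are enough small factors unless more than \<open>2 d / 3\<close> conjugates have exactly the same
  modulus \<open>r\<close>. In that case the product of the largest and the smallest modulus is \<open>r\<^sup>2\<close>
  (\<open>cmod_extremes_if_many_equal_moduli\<close>). Then all conjugates of the unit are close to the unit
  circle, against the quantitative form \<open>house_gap\<close> of Kronecker's theorem.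

  The Galois-theoretic part of these arguments is carried by power sums: a finite family of
  complex numbers is the family of roots of a rational polynomial if and only if its power sums
  are rational, and this is easy to see for families of monomials in the conjugates.\<close>

section \<open>Sums and products of algebraic integers\<close>

definition int_span :: "complex set \<Rightarrow> complex set" where
  "int_span G = {x. \<exists>c. x = (\<Sum>g\<in>G. of_int (c g) * g)}"

lemma int_span_base: "g \<in> G \<Longrightarrow> finite G \<Longrightarrow> g \<in> int_span G"
proof -
  assume "g \<in> G" "finite G"
  then have "g = (\<Sum>h\<in>G. of_int (if h = g then 1 else 0) * h)"
    by (simp add: sum.delta' if_distrib[of of_int] if_distrib[of "\<lambda>x. x * _"] cong: if_cong)
  then show ?thesis
    unfolding int_span_def by (intro CollectI exI[of _ "\<lambda>h. if h = g then 1 else 0"]) 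
qed

lemma int_span_add: "x \<in> int_span G \<Longrightarrow> y \<in> int_span G \<Longrightarrow> x + y \<in> int_span G"
proof -
  assume "x \<in> int_span G" "y \<in> int_span G"
  then obtain c e where "x = (\<Sum>g\<in>G. of_int (c g) * g)" "y = (\<Sum>g\<in>G. of_int (e g) * g)"
    by (auto simp: int_span_def)
  then have "x + y = (\<Sum>g\<in>G. of_int (c g + e g) * g)"
    by (simp add: sum.distrib distrib_right)
  then show ?thesis unfolding int_span_def by (intro CollectI exI[of _ "\<lambda>g. c g + e g"])
qed

lemma int_span_scale: "x \<in> int_span G \<Longrightarrow> of_int n * x \<in> int_span G"
proof -
  assume "x \<in> int_span G"
  then obtain c where "x = (\<Sum>g\<in>G. of_int (c g) * g)" by (auto simp: int_span_def)
  then have "of_int n * x = (\<Sum>g\<in>G. of_int (n * c g) * g)"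
    by (simp add: sum_distrib_left mult.assoc)
  then show ?thesis unfolding int_span_def by (intro CollectI exI[of _ "\<lambda>g. n * c g"])
qed

lemma int_span_sum: "(\<And>i. i \<in> I \<Longrightarrow> f i \<in> int_span G) \<Longrightarrow> (\<Sum>i\<in>I. f i) \<in> int_span G"
proof (induction I rule: infinite_finite_induct)
  case (insert x F)
  then show ?case by (simp add: int_span_add)
qed (auto simp: int_span_def intro!: exI[of _ "\<lambda>_. 0"])

lemma int_span_mult:
  assumes "\<And>g. g \<in> G \<Longrightarrow> x * g \<in> int_span G" "y \<in> int_span G"
  shows "x * y \<in> int_span G"
proof -
  obtain c where c: "y = (\<Sum>g\<in>G. of_int (c g) * g)" using assms(2) by (auto simp: int_span_def)
  have "x * y = (\<Sum>g\<in>G. of_int (c g) * (x * g))"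
    by (simp add: c sum_distrib_left mult_ac)
  then show ?thesis using assms(1) by (auto intro!: int_span_sum int_span_scale)
qed

text \<open>Multiplication by \<open>x\<close> acts on the generators through an integer matrix, and the vector of
  generators is an eigenvector of that matrix for the eigenvalue \<open>x\<close>. So \<open>x\<close> is a root of a monic
  integer characteristic polynomial.\<close>

lemma algebraic_int_if_stable_span:
  fixes G :: "complex set"
  assumes "finite G" "g0 \<in> G" "g0 \<noteq> 0" and st: "\<And>g. g \<in> G \<Longrightarrow> x * g \<in> int_span G"
  shows "algebraic_int x"
proof -
  obtain gs where gs: "set gs = G" "distinct gs" using finite_distinct_list[OF assms(1)] by auto
  define n where "n = length gs"
  have "\<forall>g\<in>G. \<exists>c. x * g = (\<Sum>h\<in>G. of_int (c h) * h)" using st by (auto simp: int_span_def)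
  then obtain c where c: "\<And>g. g \<in> G \<Longrightarrow> x * g = (\<Sum>h\<in>G. of_int (c g h) * h)" by metis
  define A :: "int mat" where "A = mat n n (\<lambda>(i,j). c (gs ! i) (gs ! j))"
  have A: "A \<in> carrier_mat n n" by (simp add: A_def)
  define B :: "complex mat" where "B = map_mat of_int A"
  have B: "B \<in> carrier_mat n n" using A by (simp add: B_def)
  define v where "v = vec n ((!) gs)"
  have "B *\<^sub>v v = x \<cdot>\<^sub>v v"
  proof (rule eq_vecI)
    show "dim_vec (B *\<^sub>v v) = dim_vec (x \<cdot>\<^sub>v v)" using B by (simp add: v_def)
    fix i assume "i < dim_vec (x \<cdot>\<^sub>v v)"
    then have i: "i < n" by (simp add: v_def)
    then have "gs ! i \<in> G" using gs by (auto simp: n_def)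
    have "(B *\<^sub>v v) $ i = (\<Sum>j<n. of_int (c (gs ! i) (gs ! j)) * gs ! j)"
      using i by (simp add: B_def A_def v_def scalar_prod_def atLeast0LessThan)
    also have "\<dots> = (\<Sum>h\<in>G. of_int (c (gs ! i) h) * h)"
      by (rule sum.reindex_bij_betw[OF bij_betw_nth[OF gs(2)], of "{..<n}" G
            "\<lambda>h. of_int (c (gs ! i) h) * h"]) (auto simp: n_def gs)
    also have "\<dots> = x * gs ! i" using c[OF \<open>gs ! i \<in> G\<close>] by simp
    finally show "(B *\<^sub>v v) $ i = (x \<cdot>\<^sub>v v) $ i" using i by (simp add: v_def)
  qed
  moreover have "v \<noteq> 0\<^sub>v n"
  proof
    assume "v = 0\<^sub>v n"
    obtain i where "i < n" "gs ! i = g0" using assms(2) gs unfolding n_def by (metis in_set_conv_nth)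
    have "v $ i = 0" using \<open>i < n\<close> by (simp add: \<open>v = 0\<^sub>v n\<close>)
    moreover have "v $ i = g0" using \<open>i < n\<close> \<open>gs ! i = g0\<close> by (simp add: v_def)
    ultimately show False using assms(3) by simp
  qed
  ultimately have "eigenvalue B x"
    using B by (auto simp: eigenvalue_def eigenvector_def v_def intro!: exI[of _ v])
  then have "poly (char_poly B) x = 0" using eigenvalue_root_char_poly[OF B] by simp
  moreover have "char_poly B = map_poly of_int (char_poly A)"
    unfolding B_def by (rule of_int_hom.char_poly_hom[OF A])
  moreover have "lead_coeff (char_poly A) = 1" using degree_monic_char_poly[OF A] by simp
  ultimately show ?thesis by (auto simp: algebraic_int_altdef_ipoly)
qed

lemma algebraic_int_power_relation:
  assumes "algebraic_int (x::complex)"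
  obtains m c where "m > 0" "x ^ m = (\<Sum>i<m. of_int (c i) * x ^ i)"
proof -
  obtain p where p: "poly (map_poly of_int p) x = 0" "lead_coeff p = (1::int)"
    using assms by (auto simp: algebraic_int_altdef_ipoly)
  have "degree p > 0"
  proof (rule ccontr)
    assume "\<not> degree p > 0"
    then obtain u where "p = [:u:]" using degree_eq_zeroE by blast
    with p show False by simp
  qed
  have "0 = (\<Sum>i\<le>degree p. of_int (coeff p i) * x ^ i)"
    using p(1) by (simp add: poly_altdef coeff_map_poly degree_map_poly)
  also have "\<dots> = (\<Sum>i<degree p. of_int (coeff p i) * x ^ i) + x ^ degree p"
    using p(2) by (simp only: lessThan_Suc_atMost[symmetric] sum.lessThan_Suc) simp
  finally have "- (\<Sum>i<degree p. of_int (coeff p i) * x ^ i) = x ^ degree p"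
    using minus_unique by metis
  then have "x ^ degree p = (\<Sum>i<degree p. of_int (- coeff p i) * x ^ i)"
    by (simp only: of_int_minus mult_minus_left sum_negf)
  then show ?thesis by (rule that[OF \<open>degree p > 0\<close>, of "\<lambda>i. - coeff p i"])
qed

text \<open>If \<open>x\<close> and \<open>y\<close> satisfy monic equations of degrees \<open>m\<close> and \<open>n\<close>, then the products \<open>x ^ i * y ^ j\<close>
  with \<open>i < m\<close> and \<open>j < n\<close> span a module that is stable under both, hence under \<open>x + y\<close> and \<open>x *
  y\<close>.\<close>

lemma algebraic_int_add_mult:
  fixes x y :: complex
  assumes "algebraic_int x" "algebraic_int y"
  shows "algebraic_int (x + y)" "algebraic_int (x * y)"
proof -
  obtain m a where m: "m > 0" "x ^ m = (\<Sum>i<m. of_int (a i) * x ^ i)"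
    using algebraic_int_power_relation[OF assms(1)] .
  obtain n b where n: "n > 0" "y ^ n = (\<Sum>i<n. of_int (b i) * y ^ i)"
    using algebraic_int_power_relation[OF assms(2)] .
  define G where "G = (\<lambda>(i,j). x ^ i * y ^ j) ` ({..<m} \<times> {..<n})"
  have fin: "finite G" unfolding G_def by (rule finite_imageI) (rule finite_cartesian_product; rule finite_lessThan)
  have one: "1 \<in> G" unfolding G_def by (rule image_eqI[of _ _ "(0,0)"]) (simp_all add: m(1) n(1))
  have G: "x ^ i * y ^ j \<in> int_span G" if "i < m" "j < n" for i j
    unfolding G_def by (rule int_span_base, rule image_eqI[of _ _ "(i, j)"]) (simp_all add: that)
  have stx: "x * g \<in> int_span G" if "g \<in> G" for g
  proof -
    obtain i j where ij: "g = x ^ i * y ^ j" "i < m" "j < n" using \<open>g \<in> G\<close> by (auto simp: G_def)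
    show ?thesis
    proof (cases "Suc i < m")
      case True
      then show ?thesis using G[of "Suc i" j] ij by (simp add: mult.assoc)
    next
      case False
      then have "m = Suc i" using ij by simp
      then have "x * g = x ^ m * y ^ j" by (simp add: ij(1) mult.assoc)
      also have "\<dots> = (\<Sum>i<m. of_int (a i) * (x ^ i * y ^ j))"
        by (simp add: m(2) sum_distrib_right mult.assoc)
      also have "\<dots> \<in> int_span G" using ij by (intro int_span_sum int_span_scale G) auto
      finally show ?thesis .
    qed
  qed
  have sty: "y * g \<in> int_span G" if "g \<in> G" for g
  proof -
    obtain i j where ij: "g = x ^ i * y ^ j" "i < m" "j < n" using \<open>g \<in> G\<close> by (auto simp: G_def)
    show ?thesis
    proof (cases "Suc j < n")
      case True
      then show ?thesis using G[of i "Suc j"] ij by (simp add: mult_ac)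
    next
      case False
      then have "n = Suc j" using ij by simp
      then have "y * g = x ^ i * y ^ n" by (simp add: ij(1) mult_ac)
      also have "\<dots> = (\<Sum>j<n. of_int (b j) * (x ^ i * y ^ j))"
        by (simp add: n(2) sum_distrib_left mult_ac)
      also have "\<dots> \<in> int_span G" using ij by (intro int_span_sum int_span_scale G) auto
      finally show ?thesis .
    qed
  qed
  have add: "(x + y) * g \<in> int_span G" if "g \<in> G" for g
    unfolding distrib_right by (intro int_span_add stx sty that)
  have mult: "(x * y) * g \<in> int_span G" if "g \<in> G" for g
    unfolding mult.assoc by (rule int_span_mult[OF stx sty[OF that]])
  show "algebraic_int (x + y)"
    by (rule algebraic_int_if_stable_span[OF fin one]) (simp, rule add)
  show "algebraic_int (x * y)"
    by (rule algebraic_int_if_stable_span[OF fin one]) (simp, rule mult)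
qed

lemma algebraic_int_prod [intro]:
  "(\<And>i. i \<in> I \<Longrightarrow> algebraic_int (f i)) \<Longrightarrow> algebraic_int (\<Prod>i\<in>I. f i :: complex)"
  by (induction I rule: infinite_finite_induct) (auto intro: algebraic_int_add_mult)

lemma algebraic_int_power [intro]: "algebraic_int x \<Longrightarrow> algebraic_int (x ^ n :: complex)"
  by (induction n) (auto intro: algebraic_int_add_mult)

lemma algebraic_int_diff: "algebraic_int x \<Longrightarrow> algebraic_int y \<Longrightarrow> algebraic_int (x - y :: complex)"
  using algebraic_int_add_mult(1)[of x "-y"] by simp

lemma algebraic_int_coeff_prod:
  assumes "\<And>i. i \<in> I \<Longrightarrow> algebraic_int (z i)"
  shows "algebraic_int (coeff (\<Prod>i\<in>I. [:- z i, 1:]) n :: complex)"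
  using assms
proof (induction I arbitrary: n rule: infinite_finite_induct)
  case (insert i I)
  let ?P = "\<Prod>i\<in>I. [:- z i, 1:]"
  have IH: "algebraic_int (coeff ?P m)" for m
    using insert.IH insert.prems by blast
  have zi: "algebraic_int (- z i * coeff ?P n)"
    using insert.prems[of i] by (intro algebraic_int_add_mult(2) IH) simp
  have "coeff ([:- z i, 1:] * ?P) n = - z i * coeff ?P n + (case n of 0 \<Rightarrow> 0 | Suc m \<Rightarrow> coeff ?P m)"
    by (cases n) simp_all
  moreover have "algebraic_int (case n of 0 \<Rightarrow> 0 | Suc m \<Rightarrow> coeff ?P m)"
    using IH by (simp split: nat.split)
  ultimately show ?case
    using algebraic_int_add_mult(1)[OF zi] by (simp only: prod.insert[OF insert.hyps])
next
  case empty
  show ?case by (cases n) simp_all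
next
  case (infinite I)
  then show ?case by (cases n) simp_all
qed

section \<open>Newton's identities and rational power sums\<close>

text \<open>The logarithmic derivative of \<open>\<Prod>i\<in>I. 1 - z i * X\<close> is minus the generating function of the power
  sums. Comparing coefficients gives Newton's identities, for the reversed polynomial, so that no
  index has to be subtracted from the size of the family.\<close>

lemma newton_fps:
  fixes z :: "'i \<Rightarrow> complex"
  assumes "finite I"
  shows "fps_deriv (\<Prod>i\<in>I. 1 - fps_const (z i) * fps_X) =
    - (\<Prod>i\<in>I. 1 - fps_const (z i) * fps_X) * Abs_fps (\<lambda>n. \<Sum>i\<in>I. z i ^ Suc n)"
  using assms
proof (induction I)
  case (insert j I)
  let ?R = "\<Prod>i\<in>I. 1 - fps_const (z i) * fps_X"
  let ?S = "Abs_fps (\<lambda>n. \<Sum>i\<in>I. z i ^ Suc n)" and ?T = "Abs_fps (\<lambda>n. z j ^ Suc n)"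
  let ?l = "1 - fps_const (z j) * fps_X"
  have T: "?l * ?T = fps_const (z j)"
  proof (rule fps_ext)
    fix n show "(?l * ?T) $ n = fps_const (z j) $ n"
      by (cases n) (simp_all add: left_diff_distrib mult.assoc)
  qed
  have S: "Abs_fps (\<lambda>n. \<Sum>i\<in>insert j I. z i ^ Suc n) = ?S + ?T"
    using insert.hyps by (intro fps_ext) (simp add: add.commute)
  have "fps_deriv (?l * ?R) = ?l * fps_deriv ?R - fps_const (z j) * ?R"
    by (simp flip: fps_const_neg)
  also have "\<dots> = ?l * (- ?R * ?S) - ?l * ?T * ?R" by (simp only: insert.IH T)
  also have "\<dots> = - (?l * ?R) * (?S + ?T)"
  proof -
    have "l * (- r * s) - l * t * r = - (l * r) * (s + t)" for l r s t :: "complex fps"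
      by (simp add: algebra_simps)
    then show ?thesis .
  qed
  finally show ?case by (simp only: S prod.insert[OF insert.hyps])
next
  case empty
  show ?case by (simp add: fps_eq_iff)
qed

lemma newton_identity:
  fixes z :: "'i \<Rightarrow> complex"
  assumes "finite I"
  defines "E \<equiv> coeff (\<Prod>i\<in>I. [:1, - z i:])"
  shows "of_nat (Suc n) * E (Suc n) = - (\<Sum>k\<le>n. E k * (\<Sum>i\<in>I. z i ^ Suc (n - k)))"
proof -
  let ?R = "\<Prod>i\<in>I. 1 - fps_const (z i) * fps_X"
  have "fps_of_poly (\<Prod>i\<in>I. [:1, - z i:]) = ?R"
    by (simp add: fps_of_poly_prod fps_of_poly_pCons mult.commute flip: fps_const_neg)
  then have E: "E k = ?R $ k" for k unfolding E_def fps_of_poly_nth[symmetric] by simp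
  have "of_nat (Suc n) * ?R $ Suc n = fps_deriv ?R $ n" by (simp only: fps_deriv_nth Suc_eq_plus1)
  also have "\<dots> = - (\<Sum>k=0..n. ?R $ k * (\<Sum>i\<in>I. z i ^ Suc (n - k)))"
    by (simp only: newton_fps[OF assms(1)] minus_mult_left[symmetric] fps_neg_nth fps_mult_nth
        fps_nth_Abs_fps)
  finally show ?thesis by (simp only: E atLeast0AtMost)
qed

lemma coeff_prod_reversed:
  fixes z :: "'i \<Rightarrow> complex"
  shows "coeff (\<Prod>i\<in>I. [:- z i, 1:]) k =
    (if k \<le> card I then coeff (\<Prod>i\<in>I. [:1, - z i:]) (card I - k) else 0)"
proof -
  let ?P = "\<Prod>i\<in>I. [:- z i, 1:]"
  have deg: "degree ?P = card I"
    by (cases "finite I") (simp_all add: degree_prod_sum_eq)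
  have "reflect_poly [:- z i, 1:] = [:1, - z i:]" for i
    by (cases "z i = 0") (simp_all add: reflect_poly_def)
  then have "reflect_poly ?P = (\<Prod>i\<in>I. [:1, - z i:])"
    by (simp add: reflect_poly_prod)
  then have "coeff (\<Prod>i\<in>I. [:1, - z i:]) (card I - k) = coeff ?P (card I - (card I - k))"
    by (metis coeff_reflect_poly deg diff_le_self not_le)
  moreover have "coeff ?P k = 0" if "k > card I" using that deg by (simp add: coeff_eq_0)
  ultimately show ?thesis by simp
qed

text \<open>Newton's identities can be solved for the coefficients, in characteristic 0, and (below) for the
  power sums. Together the two directions say that a finite family is the family of roots of a
  rational polynomial if and only if its power sums are rational. For families that are built from
  full sets of conjugates the power sums are easy to compute, which is how rationality is proved
  throughout.\<close>

lemma rat_coeffs_if_rat_power_sums: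
  fixes z :: "'i \<Rightarrow> complex"
  assumes "finite I" and ps: "\<And>n. n > 0 \<Longrightarrow> (\<Sum>i\<in>I. z i ^ n) \<in> \<rat>"
  shows "coeff (\<Prod>i\<in>I. [:- z i, 1:]) k \<in> \<rat>"
proof -
  let ?E = "coeff (\<Prod>i\<in>I. [:1, - z i:])"
  have "?E n \<in> \<rat>" for n
  proof (induction n rule: less_induct)
    case (less n)
    show ?case
    proof (cases n)
      case 0
      have "?E 0 = poly (\<Prod>i\<in>I. [:1, - z i:]) 0" by (simp add: poly_0_coeff_0)
      then show ?thesis using 0 by (simp add: poly_prod)
    next
      case (Suc m)
      have "of_nat (Suc m) * ?E (Suc m) \<in> \<rat>"
        unfolding newton_identity[OF assms(1)]
        by (intro Rats_minus_iff[THEN iffD2] Rats_sum Rats_mult less ps) (auto simp: Suc)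
      moreover have "?E (Suc m) = of_nat (Suc m) * ?E (Suc m) / of_nat (Suc m)"
        by (rule nonzero_mult_div_cancel_left[OF of_nat_neq_0, symmetric])
      ultimately show ?thesis unfolding Suc by (metis (lifting) Rats_divide Rats_of_nat)
    qed
  qed
  then show ?thesis by (simp add: coeff_prod_reversed)
qed

lemma rat_power_sums_if_rat_coeffs:
  fixes z :: "'i \<Rightarrow> complex"
  assumes "finite I" and co: "\<And>k. coeff (\<Prod>i\<in>I. [:- z i, 1:]) k \<in> \<rat>"
  shows "(\<Sum>i\<in>I. z i ^ n) \<in> \<rat>"
proof -
  let ?E = "coeff (\<Prod>i\<in>I. [:1, - z i:])"
  have E: "?E n \<in> \<rat>" for n
  proof (cases "n \<le> card I")
    case True
    then show ?thesis using co[of "card I - n"] unfolding coeff_prod_reversed by simp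
  next
    case False
    have "degree (\<Prod>i\<in>I. [:1, - z i:]) \<le> (\<Sum>i\<in>I. 1)"
      by (rule order_trans[OF degree_prod_sum_le[OF assms(1)]]) (intro sum_mono, simp)
    then show ?thesis using False by (simp add: coeff_eq_0)
  qed
  have E0: "?E 0 = 1"
    using poly_0_coeff_0[of "\<Prod>i\<in>I. [:1, - z i:]"] by (simp add: poly_prod)
  show ?thesis
  proof (induction n rule: less_induct)
    case (less n)
    show ?case
    proof (cases n)
      case 0
      then show ?thesis by simp
    next
      case (Suc m)
      let ?p = "\<lambda>n. \<Sum>i\<in>I. z i ^ n"
      have "- (of_nat (Suc m) * ?E (Suc m)) = (\<Sum>k\<le>m. ?E k * ?p (Suc (m - k)))"
        unfolding newton_identity[OF assms(1)] by simp
      also have "\<dots> = ?E 0 * ?p (Suc m) + (\<Sum>k\<in>{..m}-{0}. ?E k * ?p (Suc (m - k)))"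
        by (subst sum.remove[of _ 0]) auto
      finally have eq: "?p (Suc m) = - (of_nat (Suc m) * ?E (Suc m)) -
          (\<Sum>k\<in>{..m}-{0}. ?E k * ?p (Suc (m - k)))"
        by (simp add: E0 algebra_simps)
      have "(\<Sum>k\<in>{..m}-{0}. ?E k * ?p (Suc (m - k))) \<in> \<rat>"
        by (intro Rats_sum Rats_mult E less) (auto simp: Suc)
      moreover have "of_nat (Suc m) * ?E (Suc m) \<in> \<rat>"
        by (intro Rats_mult E Rats_of_nat)
      ultimately show ?thesis unfolding Suc eq by (simp add: Rats_diff)
    qed
  qed
qed

section \<open>Conjugates and families with rational power sums\<close>

lemma map_poly_of_rat_mult:
  "map_poly of_rat (p * q) = map_poly of_rat p * (map_poly of_rat q :: complex poly)"
  by (rule poly_eqI) (simp add: coeff_map_poly coeff_mult of_rat_sum of_rat_mult)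

lemma map_poly_of_rat_power:
  "map_poly of_rat (p ^ n) = (map_poly of_rat p :: complex poly) ^ n"
  by (induction n) (simp_all add: map_poly_of_rat_mult)

lemma map_poly_of_rat_pCons:
  "map_poly of_rat (pCons c p) = pCons (of_rat c) (map_poly of_rat p :: complex poly)"
  by (rule poly_eqI) (simp add: coeff_map_poly coeff_pCons split: nat.split)

lemma irreducible_dvd_if_common_root:
  fixes p q :: "rat poly" and x :: complex
  assumes "irreducible p" "poly (map_poly of_rat p) x = 0" "poly (map_poly of_rat q) x = 0"
  shows "p dvd q"
  using no_common_root[OF _ assms(2,3)] assms(1) irreducible_imp_prime_elem prime_elem_imp_coprime
  by blast

lemma irreducible_imp_rsquarefree_of_rat:
  fixes p :: "rat poly"
  assumes "irreducible p"
  shows "rsquarefree (map_poly of_rat p :: complex poly)"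
proof -
  have "p \<noteq> 0" using assms by auto
  have "degree p \<noteq> 0"
    using assms \<open>p \<noteq> 0\<close> by (metis irreducible_def is_unit_iff_degree)
  then have "pderiv p \<noteq> 0" "\<not> p dvd pderiv p"
    by (auto simp: pderiv_eq_0_iff degree_pderiv dest!: dvd_imp_degree_le)
  then have cop: "coprime p (pderiv p)"
    using assms irreducible_imp_prime_elem prime_elem_imp_coprime by blast
  have "pderiv (map_poly of_rat p :: complex poly) = map_poly of_rat (pderiv p)"
    by (rule poly_eqI) (simp add: coeff_map_poly coeff_pderiv of_rat_mult of_rat_add)
  then show ?thesis
    unfolding rsquarefree_roots using no_common_root[OF cop] by auto
qed

lemma order_prod_linear:
  fixes z :: "'i \<Rightarrow> complex"
  assumes "finite I"
  shows "order u (\<Prod>i\<in>I. [:- z i, 1:]) = card {i\<in>I. z i = u}"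
proof -
  have nz: "(\<Prod>i\<in>I. [:- z i, 1:]) \<noteq> 0" using assms by simp
  have "order u (\<Prod>i\<in>I. [:- z i, 1:]) = count (proots (\<Prod>i\<in>I. [:- z i, 1:])) u"
    using nz by simp
  also have "\<dots> = (\<Sum>i\<in>I. count {#z i#} u)"
    by (subst proots_prod) (simp_all add: count_sum)
  also have "\<dots> = (\<Sum>i\<in>I. if z i = u then 1 else 0)" by (intro sum.cong) auto
  also have "\<dots> = card {i\<in>I. z i = u}"
    using assms by (simp add: sum.If_cases Int_def)
  finally show ?thesis .
qed

text \<open>The rational polynomial with roots \<open>z i\<close> is \<open>p ^ m * r\<close> with \<open>r\<close> prime to \<open>p\<close>, and an
  irreducible \<open>p\<close> has only simple roots; so every root of \<open>p\<close> has multiplicity \<open>m\<close>. This replaces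
  the argument that the Galois group permutes the family and acts transitively on the roots of
  \<open>p\<close>.\<close>

lemma card_fibre_conjugate_eq:
  fixes z :: "'i \<Rightarrow> complex" and p :: "rat poly"
  assumes "finite I" and "\<And>n. n > 0 \<Longrightarrow> (\<Sum>i\<in>I. z i ^ n) \<in> \<rat>"
    and irr: "irreducible p"
    and uv: "poly (map_poly of_rat p) u = 0" "poly (map_poly of_rat p) v = 0"
  shows "card {i\<in>I. z i = u} = card {i\<in>I. z i = v}"
proof -
  let ?F = "\<Prod>i\<in>I. [:- z i, 1:]"
  obtain q where q: "?F = map_poly of_rat q"
    using rat_coeffs_if_rat_power_sums[OF assms(1,2)] ratpolyE[of ?F] by blast
  have F0: "?F \<noteq> 0" using assms(1) by simp
  then have q0: "q \<noteq> 0" using q by auto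
  have "\<not> is_unit p" using irr by auto
  then obtain r where r: "q = p ^ multiplicity p q * r" "\<not> p dvd r"
    using multiplicity_decompose'[OF q0] by blast
  define m where "m = multiplicity p q"
  have F: "?F = map_poly of_rat p ^ m * map_poly of_rat r"
    using q r(1) unfolding m_def by (simp flip: map_poly_of_rat_mult map_poly_of_rat_power)
  have "order w ?F = m" if w: "poly (map_poly of_rat p) w = 0" for w
  proof -
    have "map_poly of_rat p \<noteq> (0 :: complex poly)" using irr by (auto simp: map_poly_eq_0_iff)
    with w have "order w (map_poly of_rat p) \<noteq> 0" by (simp add: order_root)
    then have o1: "order w (map_poly of_rat p) = 1"
      using irreducible_imp_rsquarefree_of_rat[OF irr] unfolding rsquarefree_def by metis
    have "poly (map_poly of_rat r) w \<noteq> 0"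
      using irreducible_dvd_if_common_root[OF irr w] r(2) by blast
    then have o0: "order w (map_poly of_rat r) = 0" by (rule order_0I)
    have "order w ?F = count (proots (map_poly of_rat p ^ m * map_poly of_rat r)) w"
      using F F0 by simp
    also have "\<dots> = m * order w (map_poly of_rat p) + order w (map_poly of_rat r)"
      using F F0 by (subst proots_mult) (auto simp: proots_power)
    finally show ?thesis using o0 o1 by simp
  qed
  then show ?thesis using uv by (simp flip: order_prod_linear[OF assms(1)])
qed

lemma Ints_nonzero_cmod_ge_1:
  assumes "x \<in> \<int>" "x \<noteq> (0::complex)"
  shows "cmod x \<ge> 1"
proof -
  obtain k where k: "x = of_int k" using assms(1) by (auto elim: Ints_cases)
  then have "cmod x = of_int \<bar>k\<bar>" "k \<noteq> 0" using assms by (auto simp: norm_of_int)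
  then show ?thesis by linarith
qed

text \<open>Dropping the zeros changes no power sum of positive order. So the nonzero members are themselves
  the roots of a rational polynomial, and their product is, up to sign, its constant term: a
  rational algebraic integer different from 0.\<close>

lemma prod_nonzero_family_ge_1:
  fixes z :: "'i \<Rightarrow> complex"
  assumes "finite I" and ps: "\<And>n. n > 0 \<Longrightarrow> (\<Sum>i\<in>I. z i ^ n) \<in> \<rat>"
    and ai: "\<And>i. i \<in> I \<Longrightarrow> algebraic_int (z i)"
  shows "(\<Prod>i\<in>{i\<in>I. z i \<noteq> 0}. cmod (z i)) \<ge> 1"
proof -
  let ?J = "{i\<in>I. z i \<noteq> 0}"
  have fin: "finite ?J" using assms(1) by simp
  have "(\<Sum>i\<in>?J. z i ^ n) \<in> \<rat>" if "n > 0" for n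
  proof -
    have "(\<Sum>i\<in>?J. z i ^ n) = (\<Sum>i\<in>I. z i ^ n)"
      using assms(1) that by (intro sum.mono_neutral_left) auto
    then show ?thesis using ps[OF that] by simp
  qed
  then have "coeff (\<Prod>i\<in>?J. [:- z i, 1:]) 0 \<in> \<rat>"
    by (rule rat_coeffs_if_rat_power_sums[OF fin])
  then have "coeff (\<Prod>i\<in>?J. [:- z i, 1:]) 0 \<in> \<int>"
    using ai by (intro rational_algebraic_int_is_int algebraic_int_coeff_prod) auto
  moreover have "coeff (\<Prod>i\<in>?J. [:- z i, 1:]) 0 = (\<Prod>i\<in>?J. - z i)"
    by (simp add: poly_prod flip: poly_0_coeff_0)
  moreover have "(\<Prod>i\<in>?J. - z i) \<noteq> 0" using fin by simp
  ultimately have "cmod (\<Prod>i\<in>?J. - z i) \<ge> 1" using Ints_nonzero_cmod_ge_1 by simp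
  then show ?thesis by (simp add: prod_norm[symmetric])
qed

lemma min_poly_factorization:
  assumes "algebraic_int \<alpha>"
  shows "map_poly of_rat (rat_min_poly \<alpha>) = (\<Prod>x\<in>conjugates \<alpha>. [:- x, 1:])"
proof -
  have "lead_coeff (map_poly of_rat (rat_min_poly \<alpha>) :: complex poly) = 1"
    using rat_min_poly(1)[OF assms] by (simp add: coeff_map_poly degree_map_poly)
  then show ?thesis
    using complex_poly_decompose_rsquarefree[OF
      irreducible_imp_rsquarefree_of_rat[OF rat_min_poly(2)[OF assms]]]
    unfolding conjugates_def by simp
qed

lemma self_in_conjugates: "algebraic_int \<alpha> \<Longrightarrow> \<alpha> \<in> conjugates \<alpha>"
  unfolding conjugates_def using rat_min_poly(3) by simp

lemma algebraic_int_conjugate: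
  assumes "algebraic_int \<alpha>" "x \<in> conjugates \<alpha>"
  shows "algebraic_int x"
proof -
  obtain P where P: "poly (map_poly of_int P) \<alpha> = 0" "lead_coeff P = 1"
    using assms by (auto simp: algebraic_int_altdef_ipoly)
  have eq: "map_poly of_rat (map_poly of_int P) = (map_poly of_int P :: complex poly)"
    by (rule poly_eqI) (simp add: coeff_map_poly)
  then have "rat_min_poly \<alpha> dvd map_poly of_int P"
    using P(1) by (intro irreducible_dvd_if_common_root[OF rat_min_poly(2,3)[OF assms(1)]]) simp
  then obtain k where "map_poly of_int P = rat_min_poly \<alpha> * k" by (elim dvdE)
  then have "map_poly of_int P = map_poly of_rat (rat_min_poly \<alpha>) * (map_poly of_rat k :: complex poly)"
    by (simp only: eq[symmetric] map_poly_of_rat_mult)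
  then have "poly (map_poly of_int P) x = 0"
    using assms(2) unfolding conjugates_def by simp
  then show ?thesis using P(2) by (auto simp: algebraic_int_altdef_ipoly)
qed

lemma rat_power_sum_conjugates:
  assumes "algebraic_int \<alpha>"
  shows "(\<Sum>x\<in>conjugates \<alpha>. x ^ n) \<in> \<rat>"
proof (rule rat_power_sums_if_rat_coeffs[OF card_conjugates(1)[OF assms]])
  fix k show "coeff (\<Prod>x\<in>conjugates \<alpha>. [:- x, 1:]) k \<in> \<rat>"
    by (simp add: coeff_map_poly flip: min_poly_factorization[OF assms])
qed

lemma coeff_min_poly_in_Ints:
  assumes "algebraic_int \<alpha>"
  shows "(of_rat (coeff (rat_min_poly \<alpha>) k) :: complex) \<in> \<int>"
proof -
  have "of_rat (coeff (rat_min_poly \<alpha>) k) = coeff (\<Prod>x\<in>conjugates \<alpha>. [:- x, 1:]) k"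
    by (simp add: coeff_map_poly flip: min_poly_factorization[OF assms])
  moreover have "algebraic_int (coeff (\<Prod>x\<in>conjugates \<alpha>. [:- x, 1:]) k)"
    by (intro algebraic_int_coeff_prod algebraic_int_conjugate[OF assms])
  ultimately have "algebraic_int (of_rat (coeff (rat_min_poly \<alpha>) k) :: complex)" by simp
  then show ?thesis by (intro rational_algebraic_int_is_int) simp_all
qed

lemma cnj_conjugate:
  assumes "x \<in> conjugates \<alpha>"
  shows "cnj x \<in> conjugates \<alpha>"
proof -
  have "cnj (of_rat q) = of_rat q" for q
    by (cases q) (simp add: of_rat_rat)
  then have "poly (map_poly of_rat (rat_min_poly \<alpha>)) (cnj x) =
      cnj (poly (map_poly of_rat (rat_min_poly \<alpha>)) x)"
    by (simp add: poly_altdef coeff_map_poly)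
  then show ?thesis using assms by (simp add: conjugates_def)
qed

lemma zero_notin_conjugates:
  assumes "algebraic_int \<alpha>" "alg_degree \<alpha> \<ge> 2"
  shows "0 \<notin> conjugates \<alpha>"
proof
  assume "0 \<in> conjugates \<alpha>"
  then have "poly (map_poly of_rat (rat_min_poly \<alpha>)) (0::complex) = 0" by (simp add: conjugates_def)
  moreover have "poly (map_poly of_rat [:0, 1:]) (0::complex) = 0" by (simp add: map_poly_pCons)
  ultimately have "rat_min_poly \<alpha> dvd [:0, 1:]"
    using irreducible_dvd_if_common_root rat_min_poly(2)[OF assms(1)] by blast
  then have "degree (rat_min_poly \<alpha>) \<le> degree [:0, 1 :: rat:]" by (rule dvd_imp_degree_le) simp
  then show False using assms(2) by (simp add: alg_degree_def)
qed

lemma min_poly_coeff_0: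
  assumes "algebraic_int \<alpha>"
  shows "of_rat (coeff (rat_min_poly \<alpha>) 0) = (-1) ^ card (conjugates \<alpha>) * (\<Prod>x\<in>conjugates \<alpha>. x)"
proof -
  have "of_rat (coeff (rat_min_poly \<alpha>) 0) = coeff (\<Prod>x\<in>conjugates \<alpha>. [:- x, 1:]) 0"
    by (simp add: coeff_map_poly flip: min_poly_factorization[OF assms])
  also have "\<dots> = (\<Prod>x\<in>conjugates \<alpha>. - x)"
    by (simp add: poly_prod flip: poly_0_coeff_0)
  finally show ?thesis by (simp add: prod_uminus)
qed

lemma cmod_prod_conjugates:
  assumes "algebraic_int \<alpha>" "alg_degree \<alpha> \<ge> 2"
  obtains n :: nat where "n \<ge> 1" "(\<Prod>x\<in>conjugates \<alpha>. cmod x) = real n"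
proof -
  obtain k where k: "of_rat (coeff (rat_min_poly \<alpha>) 0) = (of_int k :: complex)"
    using coeff_min_poly_in_Ints[OF assms(1), of 0] by (auto elim: Ints_cases)
  have "cmod (of_int k) = cmod ((-1) ^ card (conjugates \<alpha>) * (\<Prod>x\<in>conjugates \<alpha>. x))"
    by (simp only: k[symmetric] min_poly_coeff_0[OF assms(1)])
  also have "\<dots> = (\<Prod>x\<in>conjugates \<alpha>. cmod x)"
    by (simp add: norm_mult norm_power prod_norm)
  finally have eq: "(\<Prod>x\<in>conjugates \<alpha>. cmod x) = cmod (of_int k)" by simp
  moreover have "(\<Prod>x\<in>conjugates \<alpha>. cmod x) \<noteq> 0"
    using zero_notin_conjugates[OF assms] card_conjugates(1)[OF assms(1)] by auto
  then have "k \<noteq> 0" unfolding eq by simp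
  ultimately show thesis by (intro that[of "nat \<bar>k\<bar>"]) (auto simp: norm_of_int)
qed

lemma rat_poly_sum_conjugates:
  assumes "algebraic_int \<alpha>"
  shows "(\<Sum>x\<in>conjugates \<alpha>. poly (map_poly of_rat h) x) \<in> \<rat>"
proof -
  have "(\<Sum>x\<in>conjugates \<alpha>. poly (map_poly of_rat h) x) =
      (\<Sum>x\<in>conjugates \<alpha>. \<Sum>i\<le>degree h. of_rat (coeff h i) * x ^ i)"
    by (simp add: poly_altdef coeff_map_poly degree_map_poly)
  also have "\<dots> = (\<Sum>i\<le>degree h. of_rat (coeff h i) * (\<Sum>x\<in>conjugates \<alpha>. x ^ i))"
    by (subst sum.swap) (simp add: sum_distrib_left)
  also have "\<dots> \<in> \<rat>"
    by (intro Rats_sum Rats_mult Rats_of_rat rat_power_sum_conjugates[OF assms])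
  finally show ?thesis .
qed

text \<open>On the roots of the minimal polynomial \<open>c + X * f\<close>, inversion agrees with the polynomial \<open>- f /
  c\<close>.\<close>

lemma rat_power_sum_inverse_conjugates:
  assumes "algebraic_int \<alpha>" "alg_degree \<alpha> \<ge> 2"
  shows "(\<Sum>x\<in>conjugates \<alpha>. (1 / x) ^ n) \<in> \<rat>"
proof -
  obtain c f where f: "rat_min_poly \<alpha> = pCons c f" by (cases "rat_min_poly \<alpha>")
  have root: "of_rat c + x * poly (map_poly of_rat f) x = 0" if "x \<in> conjugates \<alpha>" for x
    using that unfolding conjugates_def f by (simp add: map_poly_of_rat_pCons)
  have c0: "c \<noteq> 0"
  proof
    assume "c = 0"
    then have "0 \<in> conjugates \<alpha>" unfolding conjugates_def f by (simp add: map_poly_of_rat_pCons)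
    with zero_notin_conjugates[OF assms] show False by simp
  qed
  define g where "g = [:- 1 / c:] * f"
  have "1 / x = poly (map_poly of_rat g) x" if x: "x \<in> conjugates \<alpha>" for x
  proof -
    have "x \<noteq> 0" using x zero_notin_conjugates[OF assms] by auto
    have "poly (map_poly of_rat g) x = - poly (map_poly of_rat f) x / of_rat c"
      by (simp add: g_def poly_of_rat_mult map_poly_of_rat_pCons of_rat_divide of_rat_minus del: mult_pCons_left)
    also have "\<dots> = 1 / x"
    proof -
      have "- poly (map_poly of_rat f) x * x = 1 * of_rat c"
        using iffD2[OF eq_neg_iff_add_eq_0 root[OF x]] by (simp add: mult.commute)
      moreover have "(of_rat c :: complex) \<noteq> 0" using c0 by simp
      ultimately show ?thesis using \<open>x \<noteq> 0\<close> by (subst frac_eq_eq)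
    qed
    finally show ?thesis by simp
  qed
  then have "(\<Sum>x\<in>conjugates \<alpha>. (1 / x) ^ n) =
      (\<Sum>x\<in>conjugates \<alpha>. poly (map_poly of_rat (g ^ n)) x)"
    by (intro sum.cong) (simp_all add: map_poly_of_rat_power)
  then show ?thesis using rat_poly_sum_conjugates[OF assms(1)] by simp
qed

section \<open>Many conjugates on one circle\<close>

lemma large_subsets_meet:
  assumes "finite V" "X \<subseteq> V" "Y \<subseteq> V" "3 * card X > 2 * card V" "3 * card Y > 2 * card V"
  shows "X \<inter> Y \<noteq> {}"
proof
  assume "X \<inter> Y = {}"
  then have "card X + card Y = card (X \<union> Y)"
    using assms finite_subset by (metis card_Un_disjoint)
  also have "\<dots> \<le> card V" using assms by (intro card_mono) auto
  finally show False using assms by linarith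
qed

text \<open>Turns a count of pairs, as in \<open>card_fibre_conjugate_eq\<close>, into a count of first components.\<close>

lemma card_fst_fibre:
  assumes "\<And>x y y'. x \<in> A \<Longrightarrow> y \<in> B \<Longrightarrow> y' \<in> B \<Longrightarrow> P x y \<Longrightarrow> P x y' \<Longrightarrow> y = y'"
  shows "card {p \<in> A \<times> B. P (fst p) (snd p)} = card {x\<in>A. \<exists>y\<in>B. P x y}"
proof -
  have "bij_betw fst {p \<in> A \<times> B. P (fst p) (snd p)} {x\<in>A. \<exists>y\<in>B. P x y}"
    unfolding bij_betw_def
  proof
    show "inj_on fst {p \<in> A \<times> B. P (fst p) (snd p)}"
      using assms by (intro inj_onI) (auto simp: prod_eq_iff)
    show "fst ` {p \<in> A \<times> B. P (fst p) (snd p)} = {x\<in>A. \<exists>y\<in>B. P x y}"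
      by (auto simp: image_iff) (metis fst_conv mem_Sigma_iff snd_conv)
  qed
  then show ?thesis by (rule bij_betw_same_card)
qed

text \<open>If \<open>x\<close> is on the circle then \<open>x * cnj x = r\<^sup>2\<close>, so the number \<open>v0 = r\<^sup>2\<close> is a product of two
  conjugates in at least as many ways as there are conjugates on the circle. Every conjugate \<open>v\<close>
  of \<open>v0\<close> then has equally many such representations. As they involve more than two thirds of all
  conjugates, some representation of \<open>v\<close> has both factors on the circle, which gives \<open>cmod v =
  r\<^sup>2\<close>. On the other hand, by a double count, every conjugate \<open>x\<close> of \<open>\<alpha>\<close> is a factor of more than
  two thirds of the \<open>v\<close>. So the largest conjugate \<open>u\<close> and the smallest one \<open>w\<close> are factors of a
  common \<open>v\<close>, say \<open>v = u * y = w * y'\<close>, and \<open>cmod y \<ge> cmod w\<close>, \<open>cmod y' \<le> cmod u\<close> squeeze \<open>cmod v\<close>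
  to \<open>cmod u * cmod w\<close>.

  The extreme case is a Salem number, where all but two conjugates are on the unit circle.\<close>

lemma cmod_extremes_if_many_equal_moduli:
  fixes \<alpha> :: complex and r :: real
  defines "A \<equiv> conjugates \<alpha>"
  assumes ai: "algebraic_int \<alpha>" and d2: "alg_degree \<alpha> \<ge> 2"
    and many: "3 * card {x\<in>A. cmod x = r} > 2 * alg_degree \<alpha>"
    and u: "u \<in> A" "\<And>x. x \<in> A \<Longrightarrow> cmod x \<le> cmod u"
    and w: "w \<in> A" "\<And>x. x \<in> A \<Longrightarrow> cmod w \<le> cmod x"
  shows "cmod u * cmod w = r\<^sup>2"
proof -
  define d where "d = alg_degree \<alpha>"
  define T where "T = {x\<in>A. cmod x = r}"
  have finA: "finite A" and cardA: "card A = d"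
    using card_conjugates[OF ai] by (simp_all add: A_def d_def)
  have A0: "x \<noteq> 0" if "x \<in> A" for x using zero_notin_conjugates[OF ai d2] that by (auto simp: A_def)
  have "card T \<noteq> 0" using many d2 unfolding T_def by linarith
  then obtain x0 where x0: "x0 \<in> T" by (metis all_not_in_conv card.empty)
  define v0 where "v0 = x0 * cnj x0"
  have v0_eq: "x * cnj x = v0" if "x \<in> T" for x
    using that x0 by (simp add: T_def v0_def complex_norm_square[symmetric])
  have cnjA: "cnj x \<in> A" if "x \<in> A" for x using that cnj_conjugate by (simp add: A_def)
  have aiA: "algebraic_int x" if "x \<in> A" for x
    using algebraic_int_conjugate[OF ai] that by (simp add: A_def)
  have ai0: "algebraic_int v0"
    unfolding v0_def using x0 by (intro algebraic_int_add_mult(2) aiA cnjA) (auto simp: T_def)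
  define V where "V = conjugates v0"
  have finV: "finite V" using card_conjugates[OF ai0] by (simp add: V_def)
  have v0V: "v0 \<in> V" using self_in_conjugates[OF ai0] by (simp add: V_def)
  define N where "N = card V"
  have "N > 0" using finV v0V by (auto simp: N_def card_gt_0_iff)
  define F where "F v = {x\<in>A. \<exists>y\<in>A. x * y = v}" for v
  define C where "C x = {v\<in>V. \<exists>y\<in>A. x * y = v}" for x
  define t where "t = card (F v0)"
  have cF: "card {p\<in>A\<times>A. fst p * snd p = v} = card (F v)" for v
    unfolding F_def by (rule card_fst_fibre) (use A0 in auto)
  have F: "card (F v) = t" if "v \<in> V" for v
  proof -
    have "card {p\<in>A\<times>A. fst p * snd p = v} = card {p\<in>A\<times>A. fst p * snd p = v0}"
    proof (rule card_fibre_conjugate_eq)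
      show "finite (A \<times> A)" using finA by simp
      show "irreducible (rat_min_poly v0)" by (rule rat_min_poly(2)[OF ai0])
      show "poly (map_poly of_rat (rat_min_poly v0)) v = 0"
        "poly (map_poly of_rat (rat_min_poly v0)) v0 = 0"
        using that v0V by (simp_all add: V_def conjugates_def)
      show "(\<Sum>p\<in>A \<times> A. (fst p * snd p) ^ n) \<in> \<rat>" for n
      proof -
        have "(\<Sum>p\<in>A \<times> A. (fst p * snd p) ^ n) = (\<Sum>x\<in>A. x ^ n) * (\<Sum>y\<in>A. y ^ n)"
          by (simp add: sum_product sum.cartesian_product power_mult_distrib case_prod_beta)
        then show ?thesis using rat_power_sum_conjugates[OF ai] by (simp add: A_def)
      qed
    qed
    then show ?thesis by (simp add: cF t_def)
  qed
  have TF: "T \<subseteq> F v0" using v0_eq cnjA by (auto simp: F_def T_def)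
  have FA: "F v \<subseteq> A" for v by (auto simp: F_def)
  have "card T \<le> t" unfolding t_def using TF finite_subset[OF FA finA] by (intro card_mono)
  then have t: "3 * t > 2 * d" using many by (simp add: T_def d_def)
  have T: "3 * card T > 2 * d" "T \<subseteq> A" using many by (auto simp: T_def d_def)
  have modV: "cmod v = r\<^sup>2" if "v \<in> V" for v
  proof -
    let ?X = "F v \<inter> T"
    have "card (F v) + card T = card (F v \<union> T) + card ?X"
      by (rule card_Un_Int[OF finite_subset[OF FA finA] finite_subset[OF T(2) finA]])
    moreover have "card (F v \<union> T) \<le> d"
      unfolding cardA[symmetric] using FA T(2) by (intro card_mono[OF finA]) simp
    ultimately have "card ?X + d \<ge> t + card T" using F[OF that] by linarith
    then have big: "card ?X > card (A - T)"
      using t T cardA finA by (simp add: card_Diff_subset finite_subset)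
    \<comment> \<open>\<open>x \<mapsto> v / x\<close> is injective on \<open>?X\<close>, which is too large to be mapped off the circle\<close>
    have "\<exists>x\<in>?X. v / x \<in> T"
    proof (rule ccontr)
      assume no: "\<not> ?thesis"
      have "(\<lambda>x. v / x) ` ?X \<subseteq> A - T"
      proof
        fix y assume "y \<in> (\<lambda>x. v / x) ` ?X"
        then obtain x where x: "x \<in> ?X" "y = v / x" by auto
        then obtain y' where y': "y' \<in> A" "v = x * y'" by (auto simp: F_def)
        moreover have "x \<noteq> 0" using x A0 by (auto simp: F_def)
        ultimately have "y \<in> A" using x(2) by simp
        then show "y \<in> A - T" using no x by auto
      qed
      moreover have "inj_on (\<lambda>x. v / x) ?X"
      proof (rule inj_onI)
        fix x y assume xy: "x \<in> ?X" "y \<in> ?X" "v / x = v / y"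
        have "x \<noteq> 0" "y \<noteq> 0" using xy A0 by (auto simp: F_def)
        moreover have "v \<noteq> 0" using xy A0 by (auto simp: F_def)
        ultimately show "x = y" using xy by (simp add: field_simps)
      qed
      ultimately have "card ?X \<le> card (A - T)"
        using finA by (intro card_inj_on_le) auto
      then show False using big by simp
    qed
    then obtain x where x: "x \<in> T" "v / x \<in> T" by auto
    then have "x \<noteq> 0" using A0 T by auto
    then have "cmod v = cmod x * cmod (v / x)" by (simp add: norm_divide)
    then show ?thesis using x by (simp add: T_def power2_eq_square)
  qed
  have cC: "card {p\<in>V\<times>A. fst p / snd p = x} = card (C x)" if "x \<in> A" for x
  proof -
    have "{p\<in>V\<times>A. fst p / snd p = x} = {p\<in>V\<times>A. x * snd p = fst p}"
      using A0 by (auto simp: field_simps)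
    moreover have "card {p\<in>V\<times>A. x * snd p = fst p} = card (C x)"
      unfolding C_def by (rule card_fst_fibre) (use A0[OF that] in auto)
    ultimately show ?thesis by simp
  qed
  define c where "c = card (C u)"
  have C: "card (C x) = c" if "x \<in> A" for x
  proof -
    have "card {p\<in>V\<times>A. fst p / snd p = x} = card {p\<in>V\<times>A. fst p / snd p = u}"
    proof (rule card_fibre_conjugate_eq)
      show "finite (V \<times> A)" using finA finV by simp
      show "irreducible (rat_min_poly \<alpha>)" by (rule rat_min_poly(2)[OF ai])
      show "poly (map_poly of_rat (rat_min_poly \<alpha>)) x = 0"
        "poly (map_poly of_rat (rat_min_poly \<alpha>)) u = 0"
        using that u by (simp_all add: A_def conjugates_def)
      show "(\<Sum>p\<in>V \<times> A. (fst p / snd p) ^ n) \<in> \<rat>" for n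
      proof -
        have "(\<Sum>p\<in>V \<times> A. (fst p / snd p) ^ n) = (\<Sum>v\<in>V. v ^ n) * (\<Sum>y\<in>A. (1 / y) ^ n)"
          by (simp add: sum_product sum.cartesian_product power_divide case_prod_beta)
        then show ?thesis
          using rat_power_sum_conjugates[OF ai0] rat_power_sum_inverse_conjugates[OF ai d2]
          by (simp only: A_def V_def Rats_mult)
      qed
    qed
    then show ?thesis using that u by (simp add: cC c_def)
  qed
  \<comment> \<open>double count of the pairs of a conjugate \<open>x\<close> and a \<open>v\<close> with factor \<open>x\<close>\<close>
  have "d * c = (\<Sum>x\<in>A. card (C x))" by (simp add: C cardA)
  also have "\<dots> = (\<Sum>x\<in>A. \<Sum>v\<in>V. if \<exists>y\<in>A. x * y = v then 1 else 0)"
    unfolding C_def using finV by (simp add: sum.If_cases Int_def)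
  also have "\<dots> = (\<Sum>v\<in>V. \<Sum>x\<in>A. if \<exists>y\<in>A. x * y = v then 1 else 0)"
    by (rule sum.swap)
  also have "\<dots> = (\<Sum>v\<in>V. card (F v))"
    unfolding F_def using finA by (simp add: sum.If_cases Int_def)
  also have "\<dots> = N * t" by (simp add: F N_def)
  finally have dc: "d * c = N * t" .
  have "2 * d * N < 3 * t * N" using t \<open>N > 0\<close> by simp
  also have "\<dots> = d * (3 * c)" using dc by (simp add: mult_ac)
  finally have "d * (2 * N) < d * (3 * c)" by (simp add: mult_ac)
  then have c: "2 * N < 3 * c" by simp
  have "C u \<inter> C w \<noteq> {}"
    using c C[OF u(1)] C[OF w(1)]
    by (intro large_subsets_meet[OF finV]) (auto simp: C_def N_def)
  then obtain v y y' where v: "v \<in> V" "y \<in> A" "y' \<in> A" "u * y = v" "w * y' = v"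
    by (auto simp: C_def)
  have "cmod u * cmod w \<le> cmod u * cmod y" using w(2)[OF v(2)] by (intro mult_left_mono) auto
  also have "\<dots> = cmod v" by (simp add: v(4)[symmetric] norm_mult)
  finally have le: "cmod u * cmod w \<le> cmod v" .
  have "cmod v = cmod w * cmod y'" by (simp add: v(5)[symmetric] norm_mult)
  also have "\<dots> \<le> cmod w * cmod u" using u(2)[OF v(3)] by (intro mult_left_mono) auto
  finally show ?thesis using le modV[OF v(1)] by (simp add: mult.commute)
qed

section \<open>Kronecker's theorem and the size of the largest conjugate\<close>

lemma cmod_coeff_prod_le:
  fixes z :: "'i \<Rightarrow> complex"
  assumes "finite I" "B \<ge> 0" "\<And>i. i \<in> I \<Longrightarrow> cmod (z i) \<le> B"
  shows "cmod (coeff (\<Prod>i\<in>I. [:- z i, 1:]) n) \<le> (1 + B) ^ card I"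
  using assms(1,3)
proof (induction I arbitrary: n)
  case empty
  show ?case by (cases n) simp_all
next
  case (insert i I)
  let ?P = "\<Prod>i\<in>I. [:- z i, 1:]"
  have IH: "cmod (coeff ?P m) \<le> (1 + B) ^ card I" for m
    using insert.IH insert.prems by blast
  have "coeff ([:- z i, 1:] * ?P) n = - z i * coeff ?P n + (case n of 0 \<Rightarrow> 0 | Suc m \<Rightarrow> coeff ?P m)"
    by (cases n) simp_all
  also have "cmod \<dots> \<le> cmod (- z i * coeff ?P n) + cmod (case n of 0 \<Rightarrow> 0 | Suc m \<Rightarrow> coeff ?P m)"
    by (rule norm_triangle_ineq)
  also have "cmod (- z i * coeff ?P n) \<le> B * (1 + B) ^ card I"
    unfolding norm_mult norm_minus_cancel using assms(2) insert.prems by (intro mult_mono IH) auto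
  also have "cmod (case n of 0 \<Rightarrow> 0 | Suc m \<Rightarrow> coeff ?P m) \<le> (1 + B) ^ card I"
    using IH assms(2) by (auto split: nat.split)
  finally show ?case
    by (simp only: prod.insert[OF insert.hyps] card_insert_disjoint[OF insert.hyps] power_Suc)
       (simp add: algebra_simps)
qed

text \<open>Such a polynomial is determined by its list of coefficients, which is a list of bounded length
  over a finite set.\<close>

lemma finite_bounded_int_polys:
  "finite {P :: complex poly. degree P \<le> n \<and> (\<forall>k. coeff P k \<in> \<int> \<and> cmod (coeff P k) \<le> B)}"
proof -
  let ?S = "{z \<in> \<int>. cmod z \<le> B}"
  have "?S \<subseteq> of_int ` {-\<lceil>B\<rceil>..\<lceil>B\<rceil>}"
  proof
    fix z assume z: "z \<in> ?S"
    then obtain k where k: "z = of_int k" by (auto elim: Ints_cases)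
    then have "of_int \<bar>k\<bar> \<le> B" using z by (simp add: norm_of_int)
    then have "k \<in> {-\<lceil>B\<rceil>..\<lceil>B\<rceil>}" unfolding atLeastAtMost_iff by linarith
    then show "z \<in> of_int ` {-\<lceil>B\<rceil>..\<lceil>B\<rceil>}" by (simp add: k)
  qed
  then have fin: "finite ?S" by (rule finite_subset) simp
  have "{P. degree P \<le> n \<and> (\<forall>k. coeff P k \<in> \<int> \<and> cmod (coeff P k) \<le> B)}
      \<subseteq> Poly ` {xs. set xs \<subseteq> ?S \<and> length xs \<le> Suc n}"
  proof
    fix P assume "P \<in> {P. degree P \<le> n \<and> (\<forall>k. coeff P k \<in> \<int> \<and> cmod (coeff P k) \<le> B)}"
    then have P: "degree P \<le> n" "\<And>k. coeff P k \<in> ?S" by auto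
    have "set (coeffs P) \<subseteq> range (coeff P)" unfolding range_coeff by (rule subset_insertI)
    then have "set (coeffs P) \<subseteq> ?S" using P(2) by blast
    moreover have "length (coeffs P) \<le> Suc n"
      using P(1) by (cases "P = 0") (simp_all add: length_coeffs_degree)
    moreover have "P = Poly (coeffs P)" by simp
    ultimately show "P \<in> Poly ` {xs. set xs \<subseteq> ?S \<and> length xs \<le> Suc n}" by blast
  qed
  then show ?thesis using finite_lists_length_le[OF fin] by (rule finite_subset[OF _ finite_imageI])
qed

definition roots_of_bounded_int_polys :: "nat \<Rightarrow> real \<Rightarrow> complex set" where
  "roots_of_bounded_int_polys n B = (\<Union>P\<in>{P :: complex poly. degree P \<le> n \<and>
      (\<forall>k. coeff P k \<in> \<int> \<and> cmod (coeff P k) \<le> B)} - {0}. {x. poly P x = 0})"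

lemma finite_roots_of_bounded_int_polys: "finite (roots_of_bounded_int_polys n B)"
  unfolding roots_of_bounded_int_polys_def using finite_bounded_int_polys[of n B]
  by (intro finite_UN_I) (auto simp: poly_roots_finite)

lemma in_roots_of_bounded_int_polys:
  fixes z :: "'i \<Rightarrow> complex"
  assumes "finite I" "B \<ge> 0" and bd: "\<And>i. i \<in> I \<Longrightarrow> cmod (z i) \<le> B"
    and ai: "\<And>i. i \<in> I \<Longrightarrow> algebraic_int (z i)"
    and ps: "\<And>n. (\<Sum>i\<in>I. z i ^ n) \<in> \<rat>" and j: "j \<in> I"
  shows "z j \<in> roots_of_bounded_int_polys (card I) ((1 + B) ^ card I)"
proof -
  let ?P = "\<Prod>i\<in>I. [:- z i, 1:]"
  have "coeff ?P k \<in> \<int>" for k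
    by (intro rational_algebraic_int_is_int rat_coeffs_if_rat_power_sums assms algebraic_int_coeff_prod)
  moreover have "cmod (coeff ?P k) \<le> (1 + B) ^ card I" for k
    by (intro cmod_coeff_prod_le assms)
  moreover have "degree ?P \<le> card I" by (simp add: degree_prod_sum_eq)
  moreover have "?P \<noteq> 0" using assms(1) by simp
  moreover have "poly ?P (z j) = 0" using assms(1) j by (auto simp: poly_prod)
  ultimately show ?thesis unfolding roots_of_bounded_int_polys_def by blast
qed

text \<open>All powers of \<open>\<alpha>\<close> are roots of polynomials from one finite set, because the polynomial with
  roots \<open>x ^ n\<close>, for \<open>x\<close> among the conjugates, has integer coefficients bounded independently of
  \<open>n\<close>. So two powers of \<open>\<alpha>\<close> coincide.\<close>

lemma kronecker:
  assumes ai: "algebraic_int \<alpha>" and "\<alpha> \<noteq> 0" and le1: "\<And>x. x \<in> conjugates \<alpha> \<Longrightarrow> cmod x \<le> 1"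
  shows "\<exists>n>0. \<alpha> ^ n = 1"
proof -
  let ?A = "conjugates \<alpha>"
  have pow: "\<alpha> ^ n \<in> roots_of_bounded_int_polys (card ?A) ((1 + 1) ^ card ?A)" for n
  proof (rule in_roots_of_bounded_int_polys[where z = "\<lambda>x. x ^ n" and I = ?A])
    show "(\<Sum>x\<in>?A. (x ^ n) ^ m) \<in> \<rat>" for m
      using rat_power_sum_conjugates[OF ai, of "n * m"] by (simp add: power_mult)
    show "algebraic_int (x ^ n)" if "x \<in> ?A" for x
      using algebraic_int_conjugate[OF ai that] by (rule algebraic_int_power)
    show "cmod (x ^ n) \<le> 1" if "x \<in> ?A" for x
      using le1[OF that] by (simp add: norm_power power_le_one)
  qed (use card_conjugates[OF ai] self_in_conjugates[OF ai] in auto)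
  then have "range (\<lambda>n. \<alpha> ^ n) \<subseteq> roots_of_bounded_int_polys (card ?A) ((1 + 1) ^ card ?A)"
    by (intro image_subsetI)
  then have "finite (range (\<lambda>n. \<alpha> ^ n))" using finite_roots_of_bounded_int_polys by (rule finite_subset)
  then have "\<not> inj (\<lambda>n. \<alpha> ^ n)" using finite_imageD infinite_UNIV_nat by blast
  then obtain k l where kl: "k \<noteq> l" "\<alpha> ^ k = \<alpha> ^ l" unfolding inj_def by blast
  define m n where "m = min k l" and "n = max k l"
  have "m < n" "\<alpha> ^ m = \<alpha> ^ n" using kl by (auto simp: m_def n_def min_def max_def)
  moreover have "\<alpha> ^ n = \<alpha> ^ m * \<alpha> ^ (n - m)" using \<open>m < n\<close> by (simp flip: power_add)
  ultimately have "\<alpha> ^ (n - m) = 1" using \<open>\<alpha> \<noteq> 0\<close> by simp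
  then show ?thesis using \<open>m < n\<close> by (intro exI[of _ "n - m"]) simp
qed

text \<open>Only finitely many algebraic integers of degree \<open>d\<close> have all conjugates of modulus at most 2. By
  Kronecker's theorem the largest conjugate of each of them exceeds 1 in modulus, unless it is a
  root of unity; so there is a common excess \<open>\<theta>\<close>.\<close>

lemma house_gap:
  fixes d :: nat
  assumes "d \<ge> 2"
  obtains \<theta> :: real where "\<theta> > 0"
    "\<And>\<alpha>. algebraic_int \<alpha> \<Longrightarrow> alg_degree \<alpha> = d \<Longrightarrow> \<not> (\<exists>n>0. \<alpha> ^ n = 1) \<Longrightarrow>
       \<exists>x\<in>conjugates \<alpha>. cmod x \<ge> 1 + \<theta>"
proof -
  define h where "h \<alpha> = Max (cmod ` conjugates \<alpha>)" for \<alpha>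
  define F where "F = {\<alpha>. algebraic_int \<alpha> \<and> alg_degree \<alpha> = d \<and> \<not> (\<exists>n>0. \<alpha> ^ n = 1) \<and>
      (\<forall>x\<in>conjugates \<alpha>. cmod x \<le> 2)}"
  have "F \<subseteq> roots_of_bounded_int_polys d ((1 + 2) ^ d)"
  proof
    fix \<alpha> assume "\<alpha> \<in> F"
    then have a: "algebraic_int \<alpha>" "card (conjugates \<alpha>) = d" "\<And>x. x\<in>conjugates \<alpha> \<Longrightarrow> cmod x \<le> 2"
      using card_conjugates(2) by (auto simp: F_def)
    have "\<alpha> \<in> roots_of_bounded_int_polys (card (conjugates \<alpha>)) ((1 + 2) ^ card (conjugates \<alpha>))"
      by (rule in_roots_of_bounded_int_polys[where z = "\<lambda>x. x" and I = "conjugates \<alpha>"])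
         (use a algebraic_int_conjugate[OF a(1)] card_conjugates(1)[OF a(1)]
            rat_power_sum_conjugates[OF a(1)] self_in_conjugates[OF a(1)] in auto)
    then show "\<alpha> \<in> roots_of_bounded_int_polys d ((1 + 2) ^ d)" using a by simp
  qed
  then have finF: "finite F" using finite_roots_of_bounded_int_polys finite_subset by blast
  have h: "\<exists>x\<in>conjugates \<alpha>. cmod x = h \<alpha>" "\<And>x. x \<in> conjugates \<alpha> \<Longrightarrow> cmod x \<le> h \<alpha>"
    if "algebraic_int \<alpha>" for \<alpha>
  proof -
    have fin: "finite (cmod ` conjugates \<alpha>)" and "cmod ` conjugates \<alpha> \<noteq> {}"
      using card_conjugates(1)[OF that] self_in_conjugates[OF that] by auto
    then have "h \<alpha> \<in> cmod ` conjugates \<alpha>" unfolding h_def by (rule Max_in)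
    then show "\<exists>x\<in>conjugates \<alpha>. cmod x = h \<alpha>" by force
    show "cmod x \<le> h \<alpha>" if "x \<in> conjugates \<alpha>" for x
      unfolding h_def using fin that by (intro Max_ge) auto
  qed
  have h1: "h \<alpha> > 1" if "\<alpha> \<in> F" for \<alpha>
  proof (rule ccontr)
    assume "\<not> h \<alpha> > 1"
    then have "cmod x \<le> 1" if "x \<in> conjugates \<alpha>" for x
      using h(2)[of \<alpha> x] \<open>\<alpha> \<in> F\<close> that by (fastforce simp: F_def)
    moreover have "\<alpha> \<noteq> 0"
      using zero_notin_conjugates[of \<alpha>] self_in_conjugates[of \<alpha>] \<open>\<alpha> \<in> F\<close> assms by (auto simp: F_def)
    moreover have "algebraic_int \<alpha>" using \<open>\<alpha> \<in> F\<close> by (simp add: F_def)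
    ultimately have "\<exists>n>0. \<alpha> ^ n = 1" by (intro kronecker)
    then show False using \<open>\<alpha> \<in> F\<close> unfolding F_def by blast
  qed
  \<comment> \<open>the entry 1 serves the numbers that have a conjugate of modulus greater than 2\<close>
  define \<theta> where "\<theta> = Min (insert 1 ((\<lambda>\<alpha>. h \<alpha> - 1) ` F))"
  have "\<theta> > 0" unfolding \<theta>_def using finF h1 by (subst Min_gr_iff) auto
  moreover have "\<exists>x\<in>conjugates \<alpha>. cmod x \<ge> 1 + \<theta>"
    if a: "algebraic_int \<alpha>" "alg_degree \<alpha> = d" "\<not> (\<exists>n>0. \<alpha> ^ n = 1)" for \<alpha>
  proof (cases "\<alpha> \<in> F")
    case True
    then have "\<theta> \<le> h \<alpha> - 1" unfolding \<theta>_def using finF by (intro Min_le) auto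
    then show ?thesis using h(1)[OF a(1)] by force
  next
    case False
    then obtain x where "x \<in> conjugates \<alpha>" "cmod x > 2" using a by (auto simp: F_def)
    moreover have "\<theta> \<le> 1" unfolding \<theta>_def using finF by (intro Min_le) auto
    ultimately show ?thesis by (intro bexI[of _ x]) auto
  qed
  ultimately show thesis by (rule that)
qed

section \<open>Separation of monomials in the conjugates\<close>

definition distinct_tuples :: "'a set \<Rightarrow> nat \<Rightarrow> 'a list set" where
  "distinct_tuples A t = {xs. length xs = t \<and> distinct xs \<and> set xs \<subseteq> A}"

text \<open>The monomial with exponents \<open>es\<close>, evaluated at the point \<open>xs\<close>. The second clause matters for
  empty lists only, as both lists always have the same length.\<close>

fun monomial_at :: "nat list \<Rightarrow> 'a :: comm_monoid_mult list \<Rightarrow> 'a" where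
  "monomial_at (e # es) (x # xs) = x ^ e * monomial_at es xs"
| "monomial_at _ _ = 1"

lemma finite_distinct_tuples [simp]: "finite A \<Longrightarrow> finite (distinct_tuples A t)"
  unfolding distinct_tuples_def by (rule finite_subset[OF _ finite_lists_length_eq[of A t]]) auto

lemma distinct_tuples_0 [simp]: "distinct_tuples A 0 = {[]}"
  by (auto simp: distinct_tuples_def)

lemma sum_distinct_tuples_Suc:
  assumes "finite A"
  shows "(\<Sum>xs\<in>distinct_tuples A (Suc t). f xs) = (\<Sum>xs\<in>distinct_tuples A t. \<Sum>x\<in>A - set xs. f (x # xs))"
proof -
  have "bij_betw (\<lambda>p. snd p # fst p) (SIGMA xs:distinct_tuples A t. A - set xs) (distinct_tuples A (Suc t))"
    unfolding bij_betw_def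
  proof
    show "inj_on (\<lambda>p. snd p # fst p) (SIGMA xs:distinct_tuples A t. A - set xs)"
      by (intro inj_onI) (auto simp: prod_eq_iff)
    show "(\<lambda>p. snd p # fst p) ` (SIGMA xs:distinct_tuples A t. A - set xs) = distinct_tuples A (Suc t)"
    proof (intro equalityI subsetI)
      fix ys assume "ys \<in> distinct_tuples A (Suc t)"
      then obtain x xs where "ys = x # xs" "xs \<in> distinct_tuples A t" "x \<in> A - set xs"
        by (cases ys) (auto simp: distinct_tuples_def)
      then show "ys \<in> (\<lambda>p. snd p # fst p) ` (SIGMA xs:distinct_tuples A t. A - set xs)"
        by (intro image_eqI[of _ _ "(xs, x)"]) auto
    qed (auto simp: distinct_tuples_def)
  qed
  then have "(\<Sum>xs\<in>distinct_tuples A (Suc t). f xs) =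
      (\<Sum>p\<in>(SIGMA xs:distinct_tuples A t. A - set xs). f (snd p # fst p))"
    by (rule sum.reindex_bij_betw[symmetric])
  also have "\<dots> = (\<Sum>xs\<in>distinct_tuples A t. \<Sum>x\<in>A - set xs. f (x # xs))"
    using assms by (subst sum.Sigma) (auto simp: case_prod_beta)
  finally show ?thesis .
qed

lemma monomial_at_update:
  "s < length es \<Longrightarrow> length xs = length es \<Longrightarrow> monomial_at (es[s := es ! s + e]) xs = (xs ! s) ^ e * monomial_at es xs"
  by (induction es xs arbitrary: s rule: monomial_at.induct) (auto simp: power_add mult_ac nth_Cons split: nat.split)

lemma monomial_at_mult: "length es = length fs \<Longrightarrow> monomial_at es xs * monomial_at fs xs = monomial_at (map2 (+) es fs) xs"
proof (induction es fs arbitrary: xs rule: list_induct2)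
  case (Cons e es f fs)
  then show ?case by (cases xs) (auto simp: power_add mult_ac Cons.IH[symmetric])
qed simp

lemma monomial_at_power: "monomial_at es xs ^ n = monomial_at (map ((*) n) es) xs"
  by (induction es xs rule: monomial_at.induct)
     (auto simp: power_mult_distrib mult.commute simp flip: power_mult)

text \<open>The sum over the first entry \<open>x\<close>, which must avoid the other entries, is the sum over all \<open>x\<close>
  minus the sum over \<open>x\<close> equal to one of the other entries. The former splits off a power sum of
  \<open>A\<close>, the latter merges two exponents; both leave a shorter tuple.\<close>

lemma rat_sum_monomial:
  fixes A :: "complex set"
  assumes fin: "finite A" and ps: "\<And>n. (\<Sum>x\<in>A. x ^ n) \<in> \<rat>"
  shows "(\<Sum>xs\<in>distinct_tuples A (length es). monomial_at es xs) \<in> \<rat>"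
proof (induction "length es" arbitrary: es)
  case 0
  then show ?case by simp
next
  case (Suc t)
  then obtain e fs where es: "es = e # fs" "length fs = t" by (cases es) auto
  have IH: "(\<Sum>xs\<in>distinct_tuples A t. monomial_at gs xs) \<in> \<rat>" if "length gs = t" for gs
    using Suc.hyps(1) that by blast
  have "(\<Sum>xs\<in>distinct_tuples A (Suc t). monomial_at es xs) =
      (\<Sum>xs\<in>distinct_tuples A t. \<Sum>x\<in>A - set xs. x ^ e * monomial_at fs xs)"
    by (simp add: sum_distinct_tuples_Suc[OF fin] es)
  also have "\<dots> = (\<Sum>xs\<in>distinct_tuples A t. (\<Sum>x\<in>A. x ^ e) * monomial_at fs xs - (\<Sum>s<t. monomial_at (fs[s := fs ! s + e]) xs))"
  proof (rule sum.cong[OF refl])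
    fix xs assume "xs \<in> distinct_tuples A t"
    then have xs: "length xs = t" "distinct xs" "set xs \<subseteq> A" by (auto simp: distinct_tuples_def)
    have "(\<Sum>x\<in>A - set xs. x ^ e) = (\<Sum>x\<in>A. x ^ e) - (\<Sum>x\<in>set xs. x ^ e)"
      using fin xs by (intro sum_diff) auto
    also have "(\<Sum>x\<in>set xs. x ^ e) = (\<Sum>s<t. (xs ! s) ^ e)"
      using sum.reindex_bij_betw[OF bij_betw_nth[OF xs(2), of "{..<t}" "set xs"], of "\<lambda>x. x ^ e"] xs
      by simp
    finally have "(\<Sum>x\<in>A - set xs. x ^ e * monomial_at fs xs) =
        (\<Sum>x\<in>A. x ^ e) * monomial_at fs xs - (\<Sum>s<t. (xs ! s) ^ e * monomial_at fs xs)"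
      by (simp add: left_diff_distrib sum_distrib_right[symmetric])
    then show "(\<Sum>x\<in>A - set xs. x ^ e * monomial_at fs xs) =
        (\<Sum>x\<in>A. x ^ e) * monomial_at fs xs - (\<Sum>s<t. monomial_at (fs[s := fs ! s + e]) xs)"
      using es xs by (simp add: monomial_at_update)
  qed
  also have "\<dots> = (\<Sum>x\<in>A. x ^ e) * (\<Sum>xs\<in>distinct_tuples A t. monomial_at fs xs) -
      (\<Sum>s<t. \<Sum>xs\<in>distinct_tuples A t. monomial_at (fs[s := fs ! s + e]) xs)"
    by (simp only: sum_subtractf sum_distrib_left[symmetric] sum.swap[of _ "{..<t}" "distinct_tuples A t"])
  also have "\<dots> \<in> \<rat>"
    by (intro Rats_diff Rats_mult Rats_sum ps IH) (simp_all add: es)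
  finally show ?case using Suc.hyps(2) by simp
qed

lemma rat_power_sum_monomial_diff:
  fixes A :: "complex set"
  assumes fin: "finite A" and ps: "\<And>n. (\<Sum>x\<in>A. x ^ n) \<in> \<rat>" and len: "length fs = length es"
  shows "(\<Sum>xs\<in>distinct_tuples A (length es). (monomial_at es xs - monomial_at fs xs) ^ n) \<in> \<rat>"
proof -
  have exp: "(monomial_at es xs - monomial_at fs xs) ^ n = (\<Sum>k\<le>n. of_nat (n choose k) * (-1) ^ (n - k) *
      monomial_at (map2 (+) (map ((*) k) es) (map ((*) (n - k)) fs)) xs)" for xs :: "complex list"
  proof -
    have "(monomial_at es xs - monomial_at fs xs) ^ n = (monomial_at es xs + - monomial_at fs xs) ^ n" by simp
    also have "\<dots> = (\<Sum>k\<le>n. of_nat (n choose k) * monomial_at es xs ^ k * (- monomial_at fs xs) ^ (n - k))"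
      by (rule binomial_ring)
    also have "\<dots> = (\<Sum>k\<le>n. of_nat (n choose k) * (-1) ^ (n - k) * (monomial_at es xs ^ k * monomial_at fs xs ^ (n - k)))"
      by (intro sum.cong refl) (subst power_minus, simp add: mult_ac)
    finally show ?thesis using len by (simp add: monomial_at_power monomial_at_mult)
  qed
  have "(\<Sum>xs\<in>distinct_tuples A (length es). (monomial_at es xs - monomial_at fs xs) ^ n) =
      (\<Sum>k\<le>n. of_nat (n choose k) * (-1) ^ (n - k) *
        (\<Sum>xs\<in>distinct_tuples A (length es). monomial_at (map2 (+) (map ((*) k) es) (map ((*) (n - k)) fs)) xs))"
    unfolding exp by (subst sum.swap) (simp only: sum_distrib_left)
  also have "\<dots> \<in> \<rat>"
  proof (rule Rats_sum)
    fix k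
    let ?gs = "map2 (+) (map ((*) k) es) (map ((*) (n - k)) fs)"
    have "length ?gs = length es" using len by simp
    then have "(\<Sum>xs\<in>distinct_tuples A (length es). monomial_at ?gs xs) \<in> \<rat>"
      using rat_sum_monomial[OF fin ps, of ?gs] by simp
    moreover have "(of_nat (n choose k) * (-1) ^ (n - k) :: complex) \<in> \<rat>"
      by (intro Rats_mult Rats_of_nat Rats_power) simp
    ultimately show "of_nat (n choose k) * (-1) ^ (n - k) *
        (\<Sum>xs\<in>distinct_tuples A (length es). monomial_at ?gs xs) \<in> \<rat>"
      by (rule Rats_mult[rotated])
  qed
  finally show ?thesis .
qed

lemma algebraic_int_monomial:
  "(\<And>x. x \<in> set xs \<Longrightarrow> algebraic_int x) \<Longrightarrow> algebraic_int (monomial_at es xs :: complex)"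
  by (induction es xs rule: monomial_at.induct) (auto intro!: algebraic_int_add_mult(2) algebraic_int_power)

text \<open>The differences, over all tuples of distinct conjugates, form a family with rational power sums.
  Tuples with repeated entries are left out because they would spoil the count of factors on which
  the exponent depends.\<close>

lemma prod_monomial_diff_ge_1:
  assumes ai: "algebraic_int \<alpha>" and len: "length fs = length es"
  shows "(\<Prod>xs\<in>{xs \<in> distinct_tuples (conjugates \<alpha>) (length es). monomial_at es xs \<noteq> monomial_at fs xs}.
           cmod (monomial_at es xs - monomial_at fs xs)) \<ge> 1"
proof -
  have "(\<Prod>xs\<in>{xs \<in> distinct_tuples (conjugates \<alpha>) (length es). monomial_at es xs - monomial_at fs xs \<noteq> 0}.
           cmod (monomial_at es xs - monomial_at fs xs)) \<ge> 1"
  proof (rule prod_nonzero_family_ge_1)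
    show "finite (distinct_tuples (conjugates \<alpha>) (length es))" using card_conjugates(1)[OF ai] by simp
    show "(\<Sum>xs\<in>distinct_tuples (conjugates \<alpha>) (length es). (monomial_at es xs - monomial_at fs xs) ^ n) \<in> \<rat>" for n
      by (intro rat_power_sum_monomial_diff card_conjugates(1) rat_power_sum_conjugates ai len)
    show "algebraic_int (monomial_at es xs - monomial_at fs xs)" if "xs \<in> distinct_tuples (conjugates \<alpha>) (length es)" for xs
      using that algebraic_int_conjugate[OF ai]
      by (intro algebraic_int_diff algebraic_int_monomial) (auto simp: distinct_tuples_def)
  qed
  then show ?thesis by simp
qed

text \<open>The logarithm of a monomial with exponents \<open>ws\<close>, when \<open>\<phi>\<close> gives the logarithms of the variables.\<close>

fun weighted_sum :: "('a \<Rightarrow> real) \<Rightarrow> nat list \<Rightarrow> 'a list \<Rightarrow> real" where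
  "weighted_sum \<phi> (w # ws) (x # xs) = real w * \<phi> x + weighted_sum \<phi> ws xs"
| "weighted_sum _ _ _ = 0"

lemma card_diff_distinct_tuple:
  assumes "finite A" "xs \<in> distinct_tuples A t"
  shows "real (card (A - set xs)) = real (card A) - real t"
proof -
  have "card (set xs) = t" "set xs \<subseteq> A" using assms(2) by (auto simp: distinct_tuples_def distinct_card)
  moreover from this have "t \<le> card A" using card_mono[OF assms(1)] by fastforce
  ultimately show ?thesis by (simp add: card_Diff_subset finite_subset[OF _ assms(1)] of_nat_diff)
qed

lemma card_distinct_tuples_Suc:
  assumes "finite A"
  shows "real (card (distinct_tuples A (Suc t))) = (real (card A) - real t) * real (card (distinct_tuples A t))"
proof -
  have "real (card (distinct_tuples A (Suc t))) = (\<Sum>xs\<in>distinct_tuples A (Suc t). 1)" by simp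
  also have "\<dots> = (\<Sum>xs\<in>distinct_tuples A t. real (card (A - set xs)))"
    by (subst sum_distinct_tuples_Suc[OF assms]) simp
  also have "\<dots> = (\<Sum>xs\<in>distinct_tuples A t. real (card A) - real t)"
    by (intro sum.cong refl card_diff_distinct_tuple assms)
  finally show ?thesis by (simp add: mult.commute)
qed

text \<open>By symmetry, each element occurs equally often in each position of a tuple. The equation is
  multiplied by \<open>card A\<close> to keep the induction on the length free of divisions.\<close>

lemma sum_weighted_sum_distinct_tuples:
  assumes fin: "finite A"
  shows "real (card A) * (\<Sum>xs\<in>distinct_tuples A (length ws). weighted_sum \<phi> ws xs) =
    real (card (distinct_tuples A (length ws))) * real (sum_list ws) * (\<Sum>x\<in>A. \<phi> x)"
proof (induction "length ws" arbitrary: ws)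
  case 0
  then show ?case by simp
next
  case (Suc t)
  then obtain w vs where ws: "ws = w # vs" "length vs = t" by (cases ws) auto
  let ?d = "real (card A)" and ?N = "real (card (distinct_tuples A t))" and ?\<Phi> = "\<Sum>x\<in>A. \<phi> x"
  have IH: "?d * (\<Sum>xs\<in>distinct_tuples A t. weighted_sum \<phi> us xs) = ?N * real (sum_list us) * ?\<Phi>"
    if "length us = t" for us
    using Suc.hyps(1) that by blast
  have ones: "weighted_sum \<phi> (replicate (length xs) 1) xs = sum_list (map \<phi> xs)" for xs
    by (induction xs) auto
  have "(\<Sum>xs\<in>distinct_tuples A (Suc t). weighted_sum \<phi> ws xs) =
      (\<Sum>xs\<in>distinct_tuples A t. \<Sum>x\<in>A - set xs. real w * \<phi> x + weighted_sum \<phi> vs xs)"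
    by (simp add: sum_distinct_tuples_Suc[OF fin] ws)
  also have "\<dots> = (\<Sum>xs\<in>distinct_tuples A t. real w * ?\<Phi> - real w * weighted_sum \<phi> (replicate t 1) xs +
      (?d - real t) * weighted_sum \<phi> vs xs)"
  proof (rule sum.cong[OF refl])
    fix xs assume xs: "xs \<in> distinct_tuples A t"
    then have xs': "length xs = t" "distinct xs" "set xs \<subseteq> A" by (auto simp: distinct_tuples_def)
    have "(\<Sum>x\<in>A - set xs. \<phi> x) = ?\<Phi> - (\<Sum>x\<in>set xs. \<phi> x)"
      using fin xs' by (intro sum_diff) auto
    also have "(\<Sum>x\<in>set xs. \<phi> x) = weighted_sum \<phi> (replicate t 1) xs"
      using xs' ones[of xs] by (simp add: sum_list_distinct_conv_sum_set)
    finally have "(\<Sum>x\<in>A - set xs. real w * \<phi> x) = real w * (?\<Phi> - weighted_sum \<phi> (replicate t 1) xs)"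
      by (simp add: sum_distrib_left[symmetric])
    then show "(\<Sum>x\<in>A - set xs. real w * \<phi> x + weighted_sum \<phi> vs xs) =
        real w * ?\<Phi> - real w * weighted_sum \<phi> (replicate t 1) xs + (?d - real t) * weighted_sum \<phi> vs xs"
      using card_diff_distinct_tuple[OF fin xs] by (simp add: sum.distrib right_diff_distrib)
  qed
  also have "\<dots> = ?N * (real w * ?\<Phi>) - real w * (\<Sum>xs\<in>distinct_tuples A t. weighted_sum \<phi> (replicate t 1) xs) +
      (?d - real t) * (\<Sum>xs\<in>distinct_tuples A t. weighted_sum \<phi> vs xs)"
    by (simp add: sum.distrib sum_subtractf sum_distrib_left)
  finally have eq: "(\<Sum>xs\<in>distinct_tuples A (Suc t). weighted_sum \<phi> ws xs) =
      ?N * (real w * ?\<Phi>) - real w * (\<Sum>xs\<in>distinct_tuples A t. weighted_sum \<phi> (replicate t 1) xs) +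
      (?d - real t) * (\<Sum>xs\<in>distinct_tuples A t. weighted_sum \<phi> vs xs)" .
  have "D * (N * (W * P) - W * R + (D - T) * Q) = D * N * (W * P) - W * (D * R) + (D - T) * (D * Q)"
    for D N W P R T Q :: real by (simp add: algebra_simps)
  then have "?d * (\<Sum>xs\<in>distinct_tuples A (Suc t). weighted_sum \<phi> ws xs) =
      ?d * ?N * (real w * ?\<Phi>) - real w * (?d * (\<Sum>xs\<in>distinct_tuples A t. weighted_sum \<phi> (replicate t 1) xs)) +
      (?d - real t) * (?d * (\<Sum>xs\<in>distinct_tuples A t. weighted_sum \<phi> vs xs))"
    unfolding eq .
  also have "\<dots> = ?d * ?N * (real w * ?\<Phi>) - real w * (?N * real t * ?\<Phi>) +
      (?d - real t) * (?N * real (sum_list vs) * ?\<Phi>)"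
    using IH[of "replicate t 1"] IH[of vs] ws by (simp add: sum_list_replicate)
  also have "\<dots> = (?d - real t) * ?N * real (w + sum_list vs) * ?\<Phi>"
    by (simp add: algebra_simps)
  finally show ?case using ws by (simp add: card_distinct_tuples_Suc[OF fin])
qed

lemma cmod_monomial_le:
  assumes "length xs = length es"
  shows "cmod (monomial_at es xs) \<le> exp (weighted_sum (\<lambda>x. ln (max 1 (cmod x))) es xs)"
  using assms
proof (induction es xs rule: monomial_at.induct)
  case (1 e es x xs)
  have "cmod x ^ e \<le> max 1 (cmod x) ^ e" by (intro power_mono) auto
  also have "\<dots> = exp (real e * ln (max 1 (cmod x)))" by (simp add: exp_of_nat_mult)
  finally show ?case using 1 by (simp add: norm_mult norm_power exp_add mult_mono)
qed auto

lemma weighted_sum_nonneg: "(\<And>x. \<phi> x \<ge> 0) \<Longrightarrow> weighted_sum \<phi> ws xs \<ge> 0"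
  by (induction \<phi> ws xs rule: weighted_sum.induct) auto

lemma weighted_sum_add: "length es = length fs \<Longrightarrow> weighted_sum \<phi> (map2 (+) es fs) xs = weighted_sum \<phi> es xs + weighted_sum \<phi> fs xs"
proof (induction es fs arbitrary: xs rule: list_induct2)
  case (Cons e es f fs)
  then show ?case by (cases xs) (auto simp: algebra_simps)
qed simp

lemma sum_list_map2_add: "length es = length fs \<Longrightarrow> sum_list (map2 (+) es fs) = sum_list es + sum_list (fs :: nat list)"
  by (induction es fs rule: list_induct2) auto

text \<open>The product of all nonzero differences of the two monomials is at least 1. The factors from \<open>S\<close>
  contribute at most \<open>\<epsilon>\<close> each; every other factor is at most twice a monomial in the numbers \<open>max
  1 (cmod x)\<close>, and the product of these monomials over all tuples is a power of the Mahler measure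
  of \<open>\<alpha>\<close>. Hence \<open>\<epsilon>\<close> cannot be too small.\<close>

lemma separation_of_monomials:
  fixes es fs :: "nat list" and \<epsilon> :: real
  defines "t \<equiv> length es"
  assumes ai: "algebraic_int \<alpha>" and len: "length fs = length es"
    and S: "S \<subseteq> distinct_tuples (conjugates \<alpha>) t" "\<And>xs. xs \<in> S \<Longrightarrow> monomial_at es xs \<noteq> monomial_at fs xs"
      "\<And>xs. xs \<in> S \<Longrightarrow> cmod (monomial_at es xs - monomial_at fs xs) \<le> \<epsilon>"
  shows "1 \<le> \<epsilon> ^ card S * (2 ^ card (distinct_tuples (conjugates \<alpha>) t) *
      exp (real (card (distinct_tuples (conjugates \<alpha>) t)) / real (alg_degree \<alpha>) *
        real (sum_list es + sum_list fs) * (\<Sum>x\<in>conjugates \<alpha>. ln (max 1 (cmod x)))))"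
proof -
  let ?A = "conjugates \<alpha>"
  let ?D = "distinct_tuples ?A t" and ?\<phi> = "\<lambda>x. ln (max 1 (cmod x))"
  let ?ws = "map2 (+) es fs"
  let ?g = "\<lambda>xs. cmod (monomial_at es xs - monomial_at fs xs)"
  have finA: "finite ?A" and cardA: "card ?A = alg_degree \<alpha>" using card_conjugates[OF ai] by auto
  have finD: "finite ?D" using finA by simp
  let ?Z = "{xs \<in> ?D. monomial_at es xs \<noteq> monomial_at fs xs}"
  have SZ: "S \<subseteq> ?Z" using S by auto
  have bound: "?g xs \<le> 2 * exp (weighted_sum ?\<phi> ?ws xs)" if "xs \<in> ?D" for xs
  proof -
    have l: "length xs = length es" "length xs = length fs" using that len by (auto simp: distinct_tuples_def t_def)
    have nn: "weighted_sum ?\<phi> gs xs \<ge> 0" for gs by (rule weighted_sum_nonneg) simp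
    have "?g xs \<le> cmod (monomial_at es xs) + cmod (monomial_at fs xs)" by (rule norm_triangle_ineq4)
    also have "\<dots> \<le> exp (weighted_sum ?\<phi> es xs) + exp (weighted_sum ?\<phi> fs xs)"
      by (intro add_mono cmod_monomial_le l)
    also have "\<dots> \<le> exp (weighted_sum ?\<phi> ?ws xs) + exp (weighted_sum ?\<phi> ?ws xs)"
      using len nn by (intro add_mono) (simp_all add: weighted_sum_add)
    finally show ?thesis by simp
  qed
  have "1 \<le> (\<Prod>xs\<in>?Z. ?g xs)" using prod_monomial_diff_ge_1[OF ai len] by (simp add: t_def)
  also have "\<dots> = (\<Prod>xs\<in>?Z - S. ?g xs) * (\<Prod>xs\<in>S. ?g xs)"
    using finD SZ by (intro prod.subset_diff) auto
  also have "\<dots> \<le> (\<Prod>xs\<in>?Z - S. 2 * exp (weighted_sum ?\<phi> ?ws xs)) * (\<Prod>xs\<in>S. \<epsilon>)"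
    using S bound by (intro mult_mono prod_mono prod_nonneg) auto
  also have "\<dots> \<le> (\<Prod>xs\<in>?D. 2 * exp (weighted_sum ?\<phi> ?ws xs)) * (\<Prod>xs\<in>S. \<epsilon>)"
  proof (rule mult_right_mono)
    have ge1: "1 \<le> 2 * exp (weighted_sum ?\<phi> ?ws xs)" for xs
    proof -
      have "1 \<le> exp (weighted_sum ?\<phi> ?ws xs)" using weighted_sum_nonneg[of ?\<phi> ?ws xs] by simp
      then show ?thesis by linarith
    qed
    show "(\<Prod>xs\<in>?Z - S. 2 * exp (weighted_sum ?\<phi> ?ws xs)) \<le> (\<Prod>xs\<in>?D. 2 * exp (weighted_sum ?\<phi> ?ws xs))"
      using finD ge1 by (intro prod_mono2) auto
    show "0 \<le> (\<Prod>xs\<in>S. \<epsilon>)" using order_trans[OF norm_ge_zero S(3)] by (intro prod_nonneg)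
  qed
  also have "(\<Prod>xs\<in>?D. 2 * exp (weighted_sum ?\<phi> ?ws xs)) = 2 ^ card ?D * exp (\<Sum>xs\<in>?D. weighted_sum ?\<phi> ?ws xs)"
    using finD by (simp add: prod.distrib exp_sum)
  also have "(\<Sum>xs\<in>?D. weighted_sum ?\<phi> ?ws xs) =
      real (card ?D) / real (alg_degree \<alpha>) * real (sum_list es + sum_list fs) * (\<Sum>x\<in>?A. ?\<phi> x)"
  proof -
    have "real (alg_degree \<alpha>) * (\<Sum>xs\<in>?D. weighted_sum ?\<phi> ?ws xs) =
        real (card ?D) * real (sum_list es + sum_list fs) * (\<Sum>x\<in>?A. ?\<phi> x)"
      using sum_weighted_sum_distinct_tuples[OF finA, of ?\<phi> ?ws] len cardA by (simp add: t_def sum_list_map2_add)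
    moreover have "alg_degree \<alpha> \<noteq> 0"
      using finA self_in_conjugates[OF ai] unfolding cardA[symmetric] by auto
    ultimately show ?thesis by (simp add: field_simps)
  qed
  finally show ?thesis by (simp add: mult.commute)
qed

section \<open>Linear constraints on the exponent tuples\<close>

text \<open>An Eisenstein polynomial with \<open>m\<close> large roots, of modulus about \<open>N powr (1 / m)\<close>, and \<open>d - m\<close>
  small roots, of modulus about \<open>N powr (- 1 / (d - m))\<close>. Its constant term does not grow with
  \<open>N\<close>, so that for large \<open>N\<close> its roots behave like units.\<close>

definition eisenstein_poly :: "nat \<Rightarrow> nat \<Rightarrow> nat \<Rightarrow> 'a :: comm_ring_1 poly" where
  "eisenstein_poly d m N = monom 1 d + monom (2 * of_nat N) (d - m) + [:2:]"

lemma eisenstein_poly_basics: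
  assumes "0 < m" "m < d"
  shows "degree (eisenstein_poly d m N :: 'a :: {comm_ring_1, ring_char_0} poly) = d"
    and "coeff (eisenstein_poly d m N :: 'a poly) d = 1"
proof -
  have small: "degree (monom (2 * of_nat N) (d - m) + [:2:] :: 'a poly) < d"
    using assms by (intro degree_add_less) (auto intro: le_less_trans[OF degree_monom_le])
  have "degree (monom (1::'a) d + (monom (2 * of_nat N) (d - m) + [:2:])) = degree (monom (1::'a) d)"
    using small by (intro degree_add_eq_left) (simp add: degree_monom_eq)
  then show "degree (eisenstein_poly d m N :: 'a poly) = d" by (simp add: eisenstein_poly_def degree_monom_eq add.assoc)
  have "coeff (monom (2 * of_nat N) (d - m) + [:2:] :: 'a poly) d = 0"
    using small by (rule coeff_eq_0)
  then show "coeff (eisenstein_poly d m N :: 'a poly) d = 1" by (simp add: eisenstein_poly_def)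
qed

lemma poly_eisenstein: "poly (eisenstein_poly d m N) x = x ^ d + 2 * of_nat N * x ^ (d - m) + 2"
  by (simp add: eisenstein_poly_def poly_monom)

lemma map_poly_eisenstein_rat: "map_poly of_rat (eisenstein_poly d m N) = (eisenstein_poly d m N :: complex poly)"
  by (rule poly_eqI)
     (simp add: eisenstein_poly_def coeff_map_poly coeff_pCons of_rat_add of_rat_mult split: nat.split)

lemma map_poly_eisenstein_int: "map_poly of_int (eisenstein_poly d m N) = (eisenstein_poly d m N :: complex poly)"
  by (rule poly_eqI) (simp add: eisenstein_poly_def coeff_map_poly coeff_pCons split: nat.split)

lemma algebraic_int_eisenstein_root:
  assumes "0 < m" "m < d" "poly (eisenstein_poly d m N) (x::complex) = 0"
  shows "algebraic_int x"
  unfolding algebraic_int_altdef_ipoly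
  using assms eisenstein_poly_basics[OF assms(1,2), where 'a = int]
  by (intro exI[of _ "eisenstein_poly d m N"]) (simp add: map_poly_eisenstein_int)

lemma prod_poly_conjugates_in_Ints:
  assumes ai: "algebraic_int \<alpha>"
    and int: "\<And>x. x \<in> conjugates \<alpha> \<Longrightarrow> algebraic_int (poly (map_poly of_rat h) x)"
  shows "(\<Prod>x\<in>conjugates \<alpha>. poly (map_poly of_rat h) x) \<in> \<int>"
proof -
  let ?z = "\<lambda>x. poly (map_poly of_rat h) x"
  let ?P = "\<Prod>x\<in>conjugates \<alpha>. [:- ?z x, 1:]"
  have "(\<Sum>x\<in>conjugates \<alpha>. ?z x ^ n) \<in> \<rat>" for n
    using rat_poly_sum_conjugates[OF ai, of "h ^ n"] by (simp add: map_poly_of_rat_power)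
  then have "coeff ?P 0 \<in> \<rat>"
    by (intro rat_coeffs_if_rat_power_sums card_conjugates(1) ai)
  moreover have "coeff ?P 0 = (\<Prod>x\<in>conjugates \<alpha>. - ?z x)"
    by (simp add: poly_prod flip: poly_0_coeff_0)
  moreover have "(\<Prod>x\<in>conjugates \<alpha>. - ?z x) = (-1) ^ card (conjugates \<alpha>) * (\<Prod>x\<in>conjugates \<alpha>. ?z x)"
    by (rule prod_uminus)
  ultimately have "(-1) ^ card (conjugates \<alpha>) * (\<Prod>x\<in>conjugates \<alpha>. ?z x) \<in> \<rat>" by simp
  then have "(\<Prod>x\<in>conjugates \<alpha>. ?z x) \<in> \<rat>"
    by (cases "even (card (conjugates \<alpha>))") simp_all
  then show ?thesis using int by (intro rational_algebraic_int_is_int algebraic_int_prod)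
qed

lemma eisenstein_root_conjugate:
  assumes "0 < m" "m < d" and root: "poly (eisenstein_poly d m N) (z::complex) = 0" and x: "x \<in> conjugates z"
  shows "poly (eisenstein_poly d m N) x = 0"
proof -
  have ai: "algebraic_int z" by (rule algebraic_int_eisenstein_root[OF assms(1-3)])
  have "rat_min_poly z dvd eisenstein_poly d m N"
    using root by (intro irreducible_dvd_if_common_root[OF rat_min_poly(2,3)[OF ai]])
      (simp add: map_poly_eisenstein_rat)
  then obtain k where "eisenstein_poly d m N = rat_min_poly z * k" by (elim dvdE)
  then have "(eisenstein_poly d m N :: complex poly) = map_poly of_rat (rat_min_poly z) * map_poly of_rat k"
    by (simp only: map_poly_eisenstein_rat[symmetric] map_poly_of_rat_mult)
  then show ?thesis using x by (simp add: conjugates_def)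
qed

text \<open>Take norms in \<open>x ^ d = - 2 * (N * x ^ (d - m) + 1)\<close>: the \<open>d\<close>-th power of the norm of \<open>z\<close> is
  even.\<close>

lemma even_norm_eisenstein_root:
  assumes "0 < m" "m < d" and root: "poly (eisenstein_poly d m N) (z::complex) = 0"
  obtains j :: int where "of_rat (coeff (rat_min_poly z) 0) = (of_int (2 * j) :: complex)"
proof -
  let ?A = "conjugates z"
  have ai: "algebraic_int z" by (rule algebraic_int_eisenstein_root[OF assms])
  have aiA: "algebraic_int x" if "x \<in> ?A" for x using algebraic_int_conjugate[OF ai that] .
  define h :: "rat poly" where "h = monom (of_nat N) (d - m) + 1"
  have h: "poly (map_poly of_rat h) x = of_nat N * x ^ (d - m) + 1" for x :: complex
    unfolding h_def poly_of_rat_add by (simp add: map_poly_monom poly_monom map_poly_1)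
  have "algebraic_int (poly (map_poly of_rat h) x)" if "x \<in> ?A" for x
    unfolding h using aiA[OF that]
    by (intro algebraic_int_add_mult algebraic_int_power int_imp_algebraic_int[OF Ints_of_nat]
        int_imp_algebraic_int[OF Ints_1])
  then have "(\<Prod>x\<in>?A. poly (map_poly of_rat h) x) \<in> \<int>"
    by (rule prod_poly_conjugates_in_Ints[OF ai])
  then obtain s where s: "(\<Prod>x\<in>?A. of_nat N * x ^ (d - m) + 1) = of_int s"
    unfolding h by (auto elim: Ints_cases)
  have X: "poly (map_poly of_rat [:0, 1:]) x = x" for x :: complex
    by (simp add: map_poly_of_rat_pCons)
  have "(\<Prod>x\<in>?A. x) \<in> \<int>"
    using prod_poly_conjugates_in_Ints[OF ai, of "[:0, 1:]"] aiA unfolding X by blast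
  then obtain n where n: "(\<Prod>x\<in>?A. x) = of_int n" by (auto elim: Ints_cases)
  have "x ^ d = -2 * (of_nat N * x ^ (d - m) + 1)" if "x \<in> ?A" for x
  proof -
    have "x ^ d + 2 * of_nat N * x ^ (d - m) + 2 = 0"
      using eisenstein_root_conjugate[OF assms that] by (simp add: poly_eisenstein)
    then have "x ^ d + (2 * (of_nat N * x ^ (d - m) + 1)) = 0" by (simp add: algebra_simps)
    then show ?thesis using iffD2[OF eq_neg_iff_add_eq_0] by fastforce
  qed
  then have "(\<Prod>x\<in>?A. x ^ d) = (\<Prod>x\<in>?A. -2 * (of_nat N * x ^ (d - m) + 1))"
    by (intro prod.cong refl)
  then have "(\<Prod>x\<in>?A. x) ^ d = (-2) ^ card ?A * (\<Prod>x\<in>?A. of_nat N * x ^ (d - m) + 1)"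
    by (simp only: prod_power_distrib prod.distrib prod_constant)
  then have "(of_int (n ^ d) :: complex) = of_int ((-2) ^ card ?A * s)"
    by (simp add: n s)
  then have "n ^ d = (-2) ^ card ?A * s" by (simp only: of_int_eq_iff)
  moreover have "card ?A > 0"
    using card_conjugates(1)[OF ai] self_in_conjugates[OF ai] by (auto simp: card_gt_0_iff)
  ultimately have "even (n ^ d)" by simp
  then have "even n" by simp
  then obtain j where "n = 2 * j" by (elim evenE)
  then have "of_rat (coeff (rat_min_poly z) 0) = (of_int (2 * ((-1) ^ card ?A * j)) :: complex)"
    by (simp add: min_poly_coeff_0[OF ai] n)
  then show thesis by (rule that)
qed

lemma algebraic_int_prod_mset:
  "(\<And>x. x \<in># M \<Longrightarrow> algebraic_int (f x)) \<Longrightarrow> algebraic_int (\<Prod>x\<in>#M. f x :: complex)"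
  by (induction M) (simp_all add: algebraic_int_add_mult(2))

text \<open>Eisenstein's criterion at 2, in terms of norms: if the minimal polynomial of \<open>z\<close> were a proper
  factor, a root \<open>w\<close> of the cofactor would contribute a second factor with even constant term, and
  the constant term 2 would be divisible by 4.\<close>

lemma rat_min_poly_eisenstein_root:
  assumes md: "0 < m" "m < d" and root: "poly (eisenstein_poly d m N) (z::complex) = 0"
  shows "rat_min_poly z = eisenstein_poly d m N"
proof -
  have ai: "algebraic_int z" by (rule algebraic_int_eisenstein_root[OF assms])
  have "rat_min_poly z dvd eisenstein_poly d m N"
    using root by (intro irreducible_dvd_if_common_root[OF rat_min_poly(2,3)[OF ai]])
      (simp add: map_poly_eisenstein_rat)
  then obtain h where h: "eisenstein_poly d m N = rat_min_poly z * h" by (elim dvdE)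
  have lc: "lead_coeff (eisenstein_poly d m N :: rat poly) = 1" using eisenstein_poly_basics[OF md, where 'a = rat] by simp
  then have lh: "lead_coeff h = 1" using h rat_min_poly(1)[OF ai] by (simp add: lead_coeff_mult)
  have "degree h = 0"
  proof (rule ccontr)
    assume "degree h \<noteq> 0"
    then have "degree (map_poly of_rat h :: complex poly) \<noteq> 0" by (simp add: degree_map_poly)
    then obtain w where w: "poly (map_poly of_rat h) (w::complex) = 0"
      using fundamental_theorem_of_algebra constant_degree by metis
    have Eh: "(eisenstein_poly d m N :: complex poly) = map_poly of_rat (rat_min_poly z) * map_poly of_rat h"
      by (simp only: map_poly_eisenstein_rat[symmetric] h map_poly_of_rat_mult)
    then have rw: "poly (eisenstein_poly d m N) w = 0" using w by simp
    have aiw: "algebraic_int w" by (rule algebraic_int_eisenstein_root[OF md rw])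
    have "rat_min_poly w dvd h"
      using w by (intro irreducible_dvd_if_common_root[OF rat_min_poly(2,3)[OF aiw]])
    then obtain k where k: "h = rat_min_poly w * k" by (elim dvdE)
    have lk: "lead_coeff k = 1" using lh k rat_min_poly(1)[OF aiw] by (simp add: lead_coeff_mult)
    define K :: "complex poly" where "K = map_poly of_rat k"
    have lK: "lead_coeff K = 1" using lk by (simp add: K_def coeff_map_poly degree_map_poly)
    have "K \<noteq> 0" using lK by auto
    have EK: "(eisenstein_poly d m N :: complex poly) =
        map_poly of_rat (rat_min_poly z) * map_poly of_rat (rat_min_poly w) * K"
      by (simp only: Eh k map_poly_of_rat_mult K_def mult.assoc)
    have roots: "algebraic_int x" if "x \<in># proots K" for x
      using that \<open>K \<noteq> 0\<close> EK by (intro algebraic_int_eisenstein_root[OF md, where N = N]) simp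
    have "K = (\<Prod>x\<in>#proots K. [:- x, 1:])"
      using complex_poly_decompose_multiset[of K] lK by simp
    then have "coeff K 0 = poly (\<Prod>x\<in>#proots K. [:- x, 1:]) 0"
      by (simp add: poly_0_coeff_0)
    also have "\<dots> = (\<Prod>x\<in>#proots K. - x)"
      by (simp add: poly_prod_mset)
    finally have "algebraic_int (coeff K 0)"
      using roots algebraic_int_prod_mset[of "proots K" uminus] by simp
    moreover have "coeff K 0 \<in> \<rat>" by (simp add: K_def coeff_map_poly)
    ultimately have "coeff K 0 \<in> \<int>" by (intro rational_algebraic_int_is_int)
    then obtain s where s: "coeff K 0 = of_int s" by (auto elim: Ints_cases)
    obtain i where i: "of_rat (coeff (rat_min_poly z) 0) = (of_int (2 * i) :: complex)"
      using even_norm_eisenstein_root[OF md root] .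
    obtain j where j: "of_rat (coeff (rat_min_poly w) 0) = (of_int (2 * j) :: complex)"
      using even_norm_eisenstein_root[OF md rw] .
    have c0: "poly (map_poly of_rat p) (0::complex) = of_rat (coeff p 0)" for p :: "rat poly"
      by (simp only: poly_0_coeff_0 coeff_map_poly of_rat_0)
    have "(2::complex) = poly (eisenstein_poly d m N) 0" using md by (simp add: poly_eisenstein zero_power)
    also have "\<dots> = of_rat (coeff (rat_min_poly z) 0) * of_rat (coeff (rat_min_poly w) 0) * coeff K 0"
      unfolding EK poly_mult c0 by (simp only: poly_0_coeff_0)
    also have "\<dots> = of_int (2 * i * (2 * j) * s)" by (simp only: i j s of_int_mult)
    finally have "of_int 2 = (of_int (2 * i * (2 * j) * s) :: complex)" by simp
    then have "2 = 2 * i * (2 * j) * s" by (simp only: of_int_eq_iff)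
    then have "2 * (i * j * s) = 1" by simp
    then show False by presburger
  qed
  then obtain u where "h = [:u:]" by (rule degree_eq_zeroE)
  then have "h = 1" using lh by (simp add: one_pCons)
  then show ?thesis using h by simp
qed

lemma ex_eisenstein_root:
  fixes N d m :: nat
  assumes md: "0 < m" "m < d"
  obtains \<alpha> :: complex where "algebraic_int \<alpha>" "alg_degree \<alpha> = d"
    "\<And>x. x \<in> conjugates \<alpha> \<Longrightarrow> x ^ d + 2 * of_nat N * x ^ (d - m) + 2 = 0"
    "(\<Prod>x\<in>conjugates \<alpha>. cmod x) = 2"
proof -
  have "degree (eisenstein_poly d m N :: complex poly) \<noteq> 0" using eisenstein_poly_basics[OF md, where 'a = complex] md by simp
  then obtain \<alpha> where root: "poly (eisenstein_poly d m N) (\<alpha>::complex) = 0"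
    using fundamental_theorem_of_algebra constant_degree by metis
  have ai: "algebraic_int \<alpha>" by (rule algebraic_int_eisenstein_root[OF md root])
  have mp: "rat_min_poly \<alpha> = eisenstein_poly d m N" by (rule rat_min_poly_eisenstein_root[OF md root])
  show thesis
  proof (rule that[OF ai])
    show "alg_degree \<alpha> = d" by (simp add: alg_degree_def mp eisenstein_poly_basics(1)[OF md])
    show "x ^ d + 2 * of_nat N * x ^ (d - m) + 2 = 0" if "x \<in> conjugates \<alpha>" for x
      using eisenstein_root_conjugate[OF md root that] by (simp add: poly_eisenstein)
    have "(-1) ^ card (conjugates \<alpha>) * (\<Prod>x\<in>conjugates \<alpha>. x) = of_rat (coeff (eisenstein_poly d m N) 0)"
      by (simp add: min_poly_coeff_0[OF ai, symmetric] mp)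
    also have "\<dots> = poly (eisenstein_poly d m N) (0::complex)"
      by (simp add: poly_0_coeff_0 coeff_map_poly flip: map_poly_eisenstein_rat)
    also have "\<dots> = 2" using md by (simp add: poly_eisenstein zero_power)
    finally have "cmod ((-1) ^ card (conjugates \<alpha>) * (\<Prod>x\<in>conjugates \<alpha>. x)) = 2" by simp
    then show "(\<Prod>x\<in>conjugates \<alpha>. cmod x) = 2"
      by (simp add: norm_mult norm_power prod_norm)
  qed
qed

lemma downward_closed_nat_eq:
  assumes "B \<subseteq> {..<d}" "\<And>i j. j \<in> B \<Longrightarrow> i \<le> j \<Longrightarrow> i \<in> B"
  shows "B = {..<card B}"
proof -
  have fin: "finite B" using assms(1) finite_subset by blast
  have "i < card B" if "i \<in> B" for i
  proof -
    have "{..i} \<subseteq> B" using assms(2) that by auto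
    then have "card {..i} \<le> card B" using fin by (intro card_mono)
    then show ?thesis by simp
  qed
  then show ?thesis using fin by (intro card_subset_eq) auto
qed

text \<open>In \<open>x ^ (d - m) * (x ^ m + 2 * N) = - 2\<close>, either \<open>x\<close> is large and the second factor nearly
  vanishes, or \<open>x\<close> is small and the second factor is about \<open>2 * N\<close>. The error 2 in the logarithms
  absorbs all constants, since \<open>4 \<le> exp 2\<close>.\<close>

lemma eisenstein_root_size:
  assumes md: "0 < m" "m < d" and N: "N \<ge> 2"
    and eq: "x ^ d + 2 * of_nat N * x ^ (d - m) + 2 = (0::complex)"
  shows "x \<noteq> 0"
    and "cmod x \<ge> 1 \<Longrightarrow> \<bar>real m * ln (cmod x) - ln (real N)\<bar> \<le> 2"
    and "cmod x < 1 \<Longrightarrow> \<bar>real (d - m) * ln (cmod x) + ln (real N)\<bar> \<le> 2"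
proof -
  show x0: "x \<noteq> 0"
  proof
    assume "x = 0"
    with eq md show False by (simp add: zero_power)
  qed
  then have pos: "cmod x > 0" by simp
  have e2: "exp (2::real) \<ge> 4"
    using power_mono[OF exp_ge_add_one_self[of 1], of 2] by (simp flip: exp_of_nat_mult)
  have lnN: "exp (ln (real N)) = real N" using N by simp
  have split: "x ^ d = x ^ (d - m) * x ^ m" using md by (simp flip: power_add)
  have "x ^ (d - m) * (x ^ m + 2 * of_nat N) + 2 = 0"
    using eq unfolding split by (simp add: algebra_simps)
  then have "x ^ (d - m) * (x ^ m + 2 * of_nat N) = - 2" by (rule iffD2[OF eq_neg_iff_add_eq_0])
  then have "cmod (x ^ (d - m) * (x ^ m + 2 * of_nat N)) = 2" by simp
  then have P: "cmod x ^ (d - m) * cmod (x ^ m + 2 * of_nat N) = 2"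
    by (simp add: norm_mult norm_power)
  have u1: "cmod (x ^ m + 2 * of_nat N) \<le> cmod x ^ m + 2 * real N"
    using norm_triangle_ineq[of "x ^ m" "2 * of_nat N"] by (simp add: norm_power norm_mult)
  have u2: "2 * real N - cmod x ^ m \<le> cmod (x ^ m + 2 * of_nat N)"
    using norm_diff_ineq[of "2 * of_nat N" "x ^ m"] by (simp add: norm_power norm_mult add.commute)
  have u3: "cmod x ^ m - 2 * real N \<le> cmod (x ^ m + 2 * of_nat N)"
    using norm_diff_ineq[of "x ^ m" "2 * of_nat N"] by (simp add: norm_power norm_mult)
  have expm: "exp (real n * ln (cmod x)) = cmod x ^ n" for n
    using pos by (simp add: exp_of_nat_mult)
  { assume big: "cmod x \<ge> 1"
    have "1 * cmod (x ^ m + 2 * of_nat N) \<le> cmod x ^ (d - m) * cmod (x ^ m + 2 * of_nat N)"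
      using big by (intro mult_right_mono one_le_power) auto
    then have le2: "cmod (x ^ m + 2 * of_nat N) \<le> 2" using P by simp
    have "exp (ln (real N) - 2) \<le> exp (ln (real N))" by simp
    also have "\<dots> = real N" by (rule lnN)
    also have "\<dots> \<le> exp (real m * ln (cmod x))" using u2 le2 N unfolding expm by linarith
    finally have l: "ln (real N) - 2 \<le> real m * ln (cmod x)" by simp
    have "exp (real m * ln (cmod x)) \<le> 4 * real N" using u3 le2 N unfolding expm by linarith
    also have "\<dots> \<le> exp 2 * real N" using e2 by (intro mult_right_mono) auto
    also have "\<dots> = exp (2 + ln (real N))" by (simp add: exp_add lnN)
    finally have "real m * ln (cmod x) \<le> 2 + ln (real N)" by simp
    with l show "\<bar>real m * ln (cmod x) - ln (real N)\<bar> \<le> 2" by linarith }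
  { assume small: "cmod x < 1"
    have xm: "cmod x ^ m \<le> 1" using small pos by (intro power_le_one) auto
    have g: "cmod (x ^ m + 2 * of_nat N) \<ge> real N" using u2 xm N by linarith
    have g': "cmod (x ^ m + 2 * of_nat N) \<le> 4 * real N" using u1 xm N by linarith
    let ?y = "cmod x ^ (d - m)"
    have y0: "?y \<ge> 0" by simp
    have "?y * real N \<le> 2" using P mult_left_mono[OF g y0] by simp
    also have "\<dots> \<le> exp 2" using e2 by linarith
    finally have "exp (real (d - m) * ln (cmod x) + ln (real N)) \<le> exp 2"
      unfolding exp_add expm lnN .
    then have l: "real (d - m) * ln (cmod x) + ln (real N) \<le> 2" by simp
    have "2 \<le> ?y * (4 * real N)" using P mult_left_mono[OF g' y0] by simp
    then have "1 / 4 \<le> ?y * real N" by linarith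
    moreover have "exp (- 2 :: real) \<le> 1 / 4" using e2 by (simp add: exp_minus field_simps)
    ultimately have "exp (- 2) \<le> exp (real (d - m) * ln (cmod x) + ln (real N))"
      unfolding exp_add expm lnN by linarith
    then have "- 2 \<le> real (d - m) * ln (cmod x) + ln (real N)" by simp
    with l show "\<bar>real (d - m) * ln (cmod x) + ln (real N)\<bar> \<le> 2" by linarith }
qed

lemma abs_add_divide_le:
  fixes r x L B :: real
  assumes "r \<ge> 1" "\<bar>r * x + L\<bar> \<le> B"
  shows "\<bar>x + L / r\<bar> \<le> B"
proof -
  have "r * (x + L / r) = r * x + L" using assms(1) by (simp add: distrib_left)
  then have eq: "r * \<bar>x + L / r\<bar> = \<bar>r * x + L\<bar>" using assms(1) by (simp add: abs_mult flip: \<open>r * (x + L / r) = r * x + L\<close>)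
  have "1 * \<bar>x + L / r\<bar> \<le> r * \<bar>x + L / r\<bar>" using assms(1) by (intro mult_right_mono) auto
  also have "\<dots> \<le> B" using assms(2) by (simp only: eq)
  finally show ?thesis by simp
qed

text \<open>The number \<open>b\<close> of large roots has to be \<open>m\<close>: the logarithms of all roots sum to \<open>ln 2\<close>, whereas
  \<open>b\<close> large and \<open>d - b\<close> small roots contribute about \<open>ln N * d * (b - m) / (m * (d - m))\<close>, which
  is unbounded in \<open>N\<close> for \<open>b \<noteq> m\<close>.\<close>

lemma eisenstein_labelling_logs:
  assumes md: "0 < m" "m < d" and N: "N \<ge> 2" and big: "ln (real N) > real d * (2 * real d + 1)"
  obtains \<alpha> a where "algebraic_int \<alpha>" "alg_degree \<alpha> = d" "conj_labelling \<alpha> a"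
    "\<And>i. i < d \<Longrightarrow> a i \<noteq> 0"
    "\<And>i. i < m \<Longrightarrow> \<bar>ln (cmod (a i)) - ln (real N) / real m\<bar> \<le> 2"
    "\<And>i. m \<le> i \<Longrightarrow> i < d \<Longrightarrow> \<bar>ln (cmod (a i)) + ln (real N) / real (d - m)\<bar> \<le> 2"
proof -
  define \<Lambda> where "\<Lambda> = ln (real N)"
  obtain \<alpha> :: complex where \<alpha>: "algebraic_int \<alpha>" "alg_degree \<alpha> = d"
    and eq: "\<And>x. x \<in> conjugates \<alpha> \<Longrightarrow> x ^ d + 2 * of_nat N * x ^ (d - m) + 2 = 0"
    and pr: "(\<Prod>x\<in>conjugates \<alpha>. cmod x) = 2"
    by (rule ex_eisenstein_root[OF md, of N]) (rule that; assumption)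
  obtain a where a: "conj_labelling \<alpha> a" using conj_labelling_exists[OF \<alpha>(1)] by blast
  then have bij: "bij_betw a {..<d} (conjugates \<alpha>)"
    and mono: "\<And>i j. i \<le> j \<Longrightarrow> j < d \<Longrightarrow> cmod (a j) \<le> cmod (a i)"
    unfolding conj_labelling_def \<alpha>(2) by auto
  have ac: "a i \<in> conjugates \<alpha>" if "i < d" for i using bij that by (auto simp: bij_betw_def)
  note size = eisenstein_root_size[OF md N eq[OF ac]]
  define B where "B = {i. i < d \<and> cmod (a i) \<ge> 1}"
  define b where "b = card B"
  have B: "B = {..<b}" unfolding b_def
    by (rule downward_closed_nat_eq[of _ d]) (use mono in \<open>force simp: B_def\<close>)+
  have "B \<subseteq> {..<d}" by (auto simp: B_def)
  then have bd: "b \<le> d" unfolding b_def using card_mono[of "{..<d}" B] by simp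
  have large: "\<bar>ln (cmod (a i)) - \<Lambda> / real m\<bar> \<le> 2" if "i < b" for i
  proof -
    have i: "i < d" "cmod (a i) \<ge> 1" using that B by (auto simp: B_def)
    have "real m \<ge> 1" using md by simp
    from abs_add_divide_le[OF this, of "ln (cmod (a i))" "- \<Lambda>" 2] size(2)[OF i]
    show ?thesis by (simp add: \<Lambda>_def)
  qed
  have small: "\<bar>ln (cmod (a i)) + \<Lambda> / real (d - m)\<bar> \<le> 2" if "b \<le> i" "i < d" for i
  proof -
    have "i \<notin> B" using that B by auto
    then have i: "cmod (a i) < 1" using that by (auto simp: B_def)
    have "real (d - m) \<ge> 1" using md by linarith
    from abs_add_divide_le[OF this size(3)[OF that(2) i]] show ?thesis unfolding \<Lambda>_def .
  qed
  have "(\<Sum>i<d. ln (cmod (a i))) = ln (\<Prod>i<d. cmod (a i))"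
    using size(1) by (subst ln_prod) auto
  also have "(\<Prod>i<d. cmod (a i)) = 2"
    using prod.reindex_bij_betw[OF bij, of cmod] pr by simp
  finally have sum: "(\<Sum>i<d. ln (cmod (a i))) = ln 2" .
  have "\<Lambda> > 0" using big md unfolding \<Lambda>_def by (auto intro: le_less_trans[rotated])
  have "b = m"
  proof (rule ccontr)
    assume "b \<noteq> m"
    define S where "S = (\<Sum>i<d. if i < b then \<Lambda> / real m else - \<Lambda> / real (d - m))"
    have "\<bar>ln 2 - S\<bar> = \<bar>\<Sum>i<d. ln (cmod (a i)) - (if i < b then \<Lambda> / real m else - \<Lambda> / real (d - m))\<bar>"
      unfolding S_def sum[symmetric] by (simp add: sum_subtractf)
    also have "\<dots> \<le> (\<Sum>i<d. \<bar>ln (cmod (a i)) - (if i < b then \<Lambda> / real m else - \<Lambda> / real (d - m))\<bar>)"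
      by (rule sum_abs)
    also have "\<dots> \<le> (\<Sum>i<d. 2)"
      using large small by (intro sum_mono) auto
    finally have "\<bar>ln 2 - S\<bar> \<le> 2 * real d" by simp
    moreover have "ln 2 \<le> (1::real)" "ln 2 \<ge> (0::real)" using ln_2_less_1 by auto
    ultimately have S_le: "\<bar>S\<bar> \<le> 2 * real d + 1" by linarith
    have "S = (\<Sum>i<b. \<Lambda> / real m) + (\<Sum>i\<in>{b..<d}. - \<Lambda> / real (d - m))"
    proof -
      have "{..<d} = {..<b} \<union> {b..<d}" using bd by auto
      then have "S = (\<Sum>i\<in>{..<b} \<union> {b..<d}. if i < b then \<Lambda> / real m else - \<Lambda> / real (d - m))"
        by (simp add: S_def)
      also have "\<dots> = (\<Sum>i<b. if i < b then \<Lambda> / real m else - \<Lambda> / real (d - m)) +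
          (\<Sum>i\<in>{b..<d}. if i < b then \<Lambda> / real m else - \<Lambda> / real (d - m))"
        by (rule sum.union_disjoint) auto
      also have "\<dots> = (\<Sum>i<b. \<Lambda> / real m) + (\<Sum>i\<in>{b..<d}. - \<Lambda> / real (d - m))"
        by (intro arg_cong2[of _ _ _ _ "(+)"] sum.cong) auto
      finally show ?thesis .
    qed
    also have "\<dots> = real b * (\<Lambda> / real m) - (real d - real b) * (\<Lambda> / (real d - real m))"
      using bd md by (simp add: of_nat_diff)
    finally have S: "S * (real m * (real d - real m)) = \<Lambda> * (real d * (real b - real m))"
      using md by (simp add: field_simps)
    have "1 \<le> \<bar>real b - real m\<bar>" using \<open>b \<noteq> m\<close> by linarith
    then have "\<Lambda> * (real d * 1) \<le> \<Lambda> * (real d * \<bar>real b - real m\<bar>)"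
      using \<open>\<Lambda> > 0\<close> by (intro mult_left_mono) auto
    also have "\<dots> = \<bar>S * (real m * (real d - real m))\<bar>"
      unfolding S using \<open>\<Lambda> > 0\<close> by (simp add: abs_mult)
    also have "\<dots> = \<bar>S\<bar> * (real m * (real d - real m))" using md by (simp add: abs_mult)
    also have "\<dots> \<le> (2 * real d + 1) * (real d * real d)"
      using S_le md by (intro mult_mono) auto
    finally have "real d * \<Lambda> \<le> real d * (real d * (2 * real d + 1))" by (simp add: mult_ac)
    then have "\<Lambda> \<le> real d * (2 * real d + 1)" using md by (simp add: mult_le_cancel_left)
    then show False using big by (simp add: \<Lambda>_def)
  qed
  then show thesis
    using that[OF \<alpha> a size(1)] large small by (simp add: \<Lambda>_def)
qed

lemma prod_powr_eq_exp:
  fixes a :: "nat \<Rightarrow> complex" and c :: "nat \<Rightarrow> real"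
  assumes "\<And>i. i \<le> k \<Longrightarrow> a i \<noteq> 0"
  shows "cmod (a 0) * (\<Prod>i=1..k. cmod (a i) powr c i) =
    exp (\<Sum>i\<le>k. (if i = 0 then 1 else c i) * ln (cmod (a i)))"
proof -
  let ?f = "\<lambda>i. (if i = 0 then 1 else c i) * ln (cmod (a i))"
  have "{..k} = insert 0 {1..k}" by auto
  then have "(\<Sum>i\<le>k. ?f i) = ?f 0 + (\<Sum>i=1..k. ?f i)" by simp
  moreover have "(\<Sum>i=1..k. ?f i) = (\<Sum>i=1..k. c i * ln (cmod (a i)))" by (intro sum.cong) auto
  ultimately show ?thesis using assms by (simp add: exp_add exp_sum powr_def)
qed

text \<open>Test the defining inequality of \<open>E_set k d\<close> on the Eisenstein polynomials with \<open>m\<close> large roots.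
  Divided by \<open>ln N\<close>, in the limit it says that the exponents of the large roots, over \<open>m\<close>,
  outweigh those of the small ones, over \<open>d - m\<close>. Here and below \<open>w\<close> is the tuple \<open>c\<close> extended by
  the exponent 1 of \<open>\<alpha>\<^sub>0\<close>.\<close>

lemma E_set_partial_sums:
  fixes c :: "nat \<Rightarrow> real"
  assumes c: "c \<in> E_set k d" and m: "1 \<le> m" "m \<le> k" and kd: "k < d"
  defines "w \<equiv> \<lambda>i. if i = 0 then 1 else c i"
  shows "real m * (\<Sum>i\<le>k. w i) \<le> real d * (\<Sum>i<m. w i)"
proof (rule ccontr)
  assume neg: "\<not> ?thesis"
  have md: "0 < m" "m < d" using m kd by auto
  define C where "C = (\<Sum>i<m. w i)"
  define R where "R = (\<Sum>i\<in>{m..k}. w i)"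
  have wn: "w i \<ge> 0" if "i \<le> k" for i
    using c that by (auto simp: w_def E_set_def PiE_def Pi_def)
  have un: "{..k} = {..<m} \<union> {m..k}" using m by auto
  have CR: "(\<Sum>i\<le>k. w i) = C + R"
    unfolding un C_def R_def by (rule sum.union_disjoint) auto
  have CR0: "C + R \<ge> 0" unfolding CR[symmetric] by (intro sum_nonneg wn) auto
  define \<epsilon> where "\<epsilon> = R / real (d - m) - C / real m"
  have "\<epsilon> > 0"
  proof -
    have "real d * C < real m * (C + R)" using neg by (simp add: CR C_def)
    then have "(real d - real m) * C < real m * R" by (simp add: algebra_simps)
    then show ?thesis unfolding \<epsilon>_def using md by (simp add: of_nat_diff field_simps)
  qed
  \<comment> \<open>large enough that the negative main term beats the bounded errors\<close>
  define \<Lambda>0 where "\<Lambda>0 = real d * (2 * real d + 1) + 2 * (C + R) / \<epsilon> + 2"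
  have "2 * (C + R) / \<epsilon> \<ge> 0" using CR0 \<open>\<epsilon> > 0\<close> by simp
  then have \<Lambda>0: "\<Lambda>0 > real d * (2 * real d + 1)" "\<Lambda>0 > 2 * (C + R) / \<epsilon>"
    unfolding \<Lambda>0_def by (auto intro!: add_nonneg_pos)
  obtain N :: nat where N: "real N \<ge> exp \<Lambda>0 + 2" using real_arch_simple by blast
  have "N \<ge> 2"
  proof -
    have "real N \<ge> 2" using N exp_gt_zero[of \<Lambda>0] by linarith
    then show ?thesis by simp
  qed
  have "exp \<Lambda>0 \<le> real N" using N by linarith
  then have lnN: "ln (real N) \<ge> \<Lambda>0" using \<open>N \<ge> 2\<close> by (simp add: ln_ge_iff)
  let ?\<Lambda> = "ln (real N)"
  have "?\<Lambda> > real d * (2 * real d + 1)" using lnN \<Lambda>0 by linarith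
  then obtain \<alpha> a where
    \<alpha>: "algebraic_int \<alpha>" "alg_degree \<alpha> = d" "conj_labelling \<alpha> a"
    and a0: "\<And>i. i < d \<Longrightarrow> a i \<noteq> 0"
    and la: "\<And>i. i < m \<Longrightarrow> \<bar>ln (cmod (a i)) - ?\<Lambda> / real m\<bar> \<le> 2"
    and sm: "\<And>i. m \<le> i \<Longrightarrow> i < d \<Longrightarrow> \<bar>ln (cmod (a i)) + ?\<Lambda> / real (d - m)\<bar> \<le> 2"
    by (rule eisenstein_labelling_logs[OF md \<open>N \<ge> 2\<close>]) (rule that; assumption)
  have "1 \<le> cmod (a 0) * (\<Prod>i=1..k. cmod (a i) powr c i)"
    using c \<alpha> unfolding E_set_def by blast
  also have "\<dots> = exp (\<Sum>i\<le>k. w i * ln (cmod (a i)))"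
    unfolding w_def using kd by (intro prod_powr_eq_exp a0) auto
  finally have "0 \<le> (\<Sum>i\<le>k. w i * ln (cmod (a i)))" by simp
  also have "\<dots> = (\<Sum>i<m. w i * ln (cmod (a i))) + (\<Sum>i\<in>{m..k}. w i * ln (cmod (a i)))"
    unfolding un by (rule sum.union_disjoint) auto
  also have "\<dots> \<le> (\<Sum>i<m. w i * (?\<Lambda> / real m + 2)) + (\<Sum>i\<in>{m..k}. w i * (- ?\<Lambda> / real (d - m) + 2))"
  proof (intro add_mono sum_mono mult_left_mono)
    fix i assume "i \<in> {..<m}"
    then show "ln (cmod (a i)) \<le> ?\<Lambda> / real m + 2" using la[of i] by auto
    show "0 \<le> w i" using \<open>i \<in> {..<m}\<close> m by (intro wn) auto
  next
    fix i assume i: "i \<in> {m..k}"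
    then show "ln (cmod (a i)) \<le> - ?\<Lambda> / real (d - m) + 2" using sm[of i] kd by auto
    show "0 \<le> w i" using i by (intro wn) auto
  qed
  also have "\<dots> = C * (?\<Lambda> / real m + 2) + R * (- ?\<Lambda> / real (d - m) + 2)"
    by (simp only: C_def R_def sum_distrib_right)
  also have "\<dots> = 2 * (C + R) - ?\<Lambda> * \<epsilon>"
    unfolding \<epsilon>_def by (simp add: algebra_simps)
  finally have "?\<Lambda> * \<epsilon> \<le> 2 * (C + R)" by simp
  then have "?\<Lambda> \<le> 2 * (C + R) / \<epsilon>" using \<open>\<epsilon> > 0\<close> by (simp add: field_simps)
  then show False using lnN \<Lambda>0 by linarith
qed

section \<open>Landau's inequality\<close>

text \<open>The squared Euclidean norm of the coefficient vector, for polynomials of degree at most \<open>n\<close>. A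
  fixed \<open>n\<close> spares following the degree through products.\<close>

definition coeff_norm2 :: "complex poly \<Rightarrow> nat \<Rightarrow> real" where
  "coeff_norm2 p n = (\<Sum>i\<le>n. (cmod (coeff p i))\<^sup>2)"

lemma cmod_swap_identity:
  fixes a u v :: complex
  shows "(cmod (u - a * v))\<^sup>2 - (cmod (cnj a * u - v))\<^sup>2 =
    (1 - (cmod a)\<^sup>2) * ((cmod u)\<^sup>2 - (cmod v)\<^sup>2)"
  unfolding cmod_power2 by (simp add: power2_eq_square algebra_simps)

text \<open>Exchanging the factor \<open>X - a\<close> for \<open>cnj a * X - 1\<close> moves a root to its mirror image in the unit
  circle and preserves the norm, as the two factors have the same modulus on that circle. In terms
  of coefficients, the differences of squares telescope.\<close>

lemma coeff_norm2_swap: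
  assumes "degree g \<le> n"
  shows "coeff_norm2 ([:- a, 1:] * g) (Suc n) = coeff_norm2 ([:- 1, cnj a:] * g) (Suc n)"
proof -
  let ?G = "\<lambda>j. (cmod (coeff g j))\<^sup>2"
  have l: "coeff ([:- a, 1:] * g) 0 = - a * coeff g 0" "coeff ([:- 1, cnj a:] * g) 0 = - coeff g 0"
    "coeff ([:- a, 1:] * g) (Suc j) = coeff g j - a * coeff g (Suc j)"
    "coeff ([:- 1, cnj a:] * g) (Suc j) = cnj a * coeff g j - coeff g (Suc j)" for j
    by simp_all
  have "coeff_norm2 ([:- a, 1:] * g) (Suc n) - coeff_norm2 ([:- 1, cnj a:] * g) (Suc n) =
      ((cmod a)\<^sup>2 * ?G 0 - ?G 0) +
      (\<Sum>j\<le>n. (cmod (coeff g j - a * coeff g (Suc j)))\<^sup>2 - (cmod (cnj a * coeff g j - coeff g (Suc j)))\<^sup>2)"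
    unfolding coeff_norm2_def sum.atMost_Suc_shift l sum_subtractf
    by (simp add: norm_mult power_mult_distrib)
  also have "\<dots> = ((cmod a)\<^sup>2 - 1) * ?G 0 + (1 - (cmod a)\<^sup>2) * (\<Sum>j\<le>n. ?G j - ?G (Suc j))"
    unfolding cmod_swap_identity by (simp add: sum_distrib_left left_diff_distrib)
  also have "(\<Sum>j\<le>n. ?G j - ?G (Suc j)) = ?G 0 - ?G (Suc n)"
    by (rule sum_telescope)
  also have "?G (Suc n) = 0" using assms by (simp add: coeff_eq_0)
  finally show ?thesis by (simp add: algebra_simps)
qed

lemma coeff_norm2_prod_swap:
  assumes "finite B" "degree g \<le> n"
  shows "coeff_norm2 ((\<Prod>a\<in>B. [:- a, 1:]) * g) (n + card B) =
    coeff_norm2 ((\<Prod>a\<in>B. [:- 1, cnj a:]) * g) (n + card B)"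
  using assms
proof (induction B arbitrary: g n)
  case (insert a B)
  let ?P = "\<Prod>a\<in>B. [:- a, 1:]" and ?Q = "\<Prod>a\<in>B. [:- 1, cnj a:]"
  have lin: "degree ([:- a, 1:] * g) \<le> Suc n"
    using insert.prems degree_mult_le[of "[:- a, 1:]" g] by simp
  have "degree ?Q \<le> (\<Sum>b\<in>B. 1)"
    by (rule order_trans[OF degree_prod_sum_le[OF insert.hyps(1)]]) (intro sum_mono, simp)
  then have dQ: "degree (?Q * g) \<le> n + card B"
    using insert.prems degree_mult_le[of ?Q g] by simp
  have "coeff_norm2 ((\<Prod>a\<in>insert a B. [:- a, 1:]) * g) (n + card (insert a B)) =
      coeff_norm2 (?P * ([:- a, 1:] * g)) (Suc n + card B)"
    using insert.hyps by (simp add: mult_ac del: mult_pCons_left mult_pCons_right)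
  also have "\<dots> = coeff_norm2 (?Q * ([:- a, 1:] * g)) (Suc n + card B)"
    by (rule insert.IH[OF lin])
  also have "?Q * ([:- a, 1:] * g) = [:- a, 1:] * (?Q * g)" by (rule mult.left_commute)
  also have "coeff_norm2 ([:- a, 1:] * (?Q * g)) (Suc n + card B) =
      coeff_norm2 ([:- 1, cnj a:] * (?Q * g)) (Suc n + card B)"
    using coeff_norm2_swap[OF dQ] by simp
  also have "\<dots> = coeff_norm2 ((\<Prod>a\<in>insert a B. [:- 1, cnj a:]) * g) (n + card (insert a B))"
    using insert.hyps by (simp add: mult.assoc del: mult_pCons_left mult_pCons_right)
  finally show ?case .
qed simp

text \<open>After exchanging the factors of all roots outside the unit circle, the Mahler measure is the
  modulus of the leading coefficient, which is at most the norm.\<close>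

lemma landau_inequality:
  fixes A :: "complex set"
  assumes fin: "finite A"
  shows "(\<Prod>x\<in>A. max 1 (cmod x))\<^sup>2 \<le> coeff_norm2 (\<Prod>x\<in>A. [:- x, 1:]) (card A)"
proof -
  define B where "B = {x\<in>A. cmod x > 1}"
  define g where "g = (\<Prod>x\<in>A - B. [:- x, 1:])"
  define q where "q = (\<Prod>x\<in>B. [:- 1, cnj x:]) * g"
  have finB: "finite B" "B \<subseteq> A" using fin by (auto simp: B_def)
  have dg: "degree g = card (A - B)" unfolding g_def by (simp add: degree_prod_sum_eq)
  have cards: "card (A - B) + card B = card A"
    using finB fin by (simp add: card_Diff_subset card_mono)
  have B0: "x \<noteq> 0" if "x \<in> B" for x using that by (auto simp: B_def)
  have "lead_coeff (\<Prod>x\<in>B. [:- 1, cnj x:]) = (\<Prod>x\<in>B. lead_coeff [:- 1, cnj x:])"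
    by (rule lead_coeff_prod)
  also have "\<dots> = (\<Prod>x\<in>B. cnj x)" using B0 by (intro prod.cong) auto
  finally have lB: "lead_coeff (\<Prod>x\<in>B. [:- 1, cnj x:]) = (\<Prod>x\<in>B. cnj x)" .
  have dB: "degree (\<Prod>x\<in>B. [:- 1, cnj x:]) = card B"
    using B0 by (subst degree_prod_sum_eq) auto
  have lg: "lead_coeff g = 1" unfolding g_def lead_coeff_prod by simp
  have "g \<noteq> 0" using lg by auto
  moreover have "(\<Prod>x\<in>B. [:- 1, cnj x:]) \<noteq> 0" using finB by simp
  ultimately have dq: "degree q = card A"
    using cards dB dg unfolding q_def by (subst degree_mult_eq) auto
  have "coeff q (card A) = (\<Prod>x\<in>B. cnj x)"
    unfolding dq[symmetric] unfolding q_def lead_coeff_mult lB lg by simp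
  then have lq: "cmod (coeff q (card A)) = (\<Prod>x\<in>B. cmod x)" by (simp add: prod_norm[symmetric])
  have "(\<Prod>x\<in>A. max 1 (cmod x)) = (\<Prod>x\<in>B. max 1 (cmod x))"
    using fin by (intro prod.mono_neutral_right) (auto simp: B_def)
  also have "\<dots> = (\<Prod>x\<in>B. cmod x)" by (intro prod.cong) (auto simp: B_def)
  finally have "(\<Prod>x\<in>A. max 1 (cmod x))\<^sup>2 = (cmod (coeff q (card A)))\<^sup>2" using lq by simp
  also have "\<dots> \<le> coeff_norm2 q (card A)"
    unfolding coeff_norm2_def by (rule member_le_sum) auto
  also have "\<dots> = coeff_norm2 ((\<Prod>x\<in>B. [:- x, 1:]) * g) (card A)"
    using coeff_norm2_prod_swap[OF finB(1), of g "card (A - B)"] dg cards by (simp add: q_def)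
  also have "(\<Prod>x\<in>B. [:- x, 1:]) * g = (\<Prod>x\<in>A. [:- x, 1:])"
    unfolding g_def using prod.subset_diff[OF finB(2) fin, of "\<lambda>x. [:- x, 1:]"] by (simp only: mult.commute)
  finally show ?thesis .
qed

lemma cmod_of_rat: "cmod (of_rat q) = \<bar>real_of_rat q\<bar>"
  by (cases q) (simp add: of_rat_rat norm_divide)

lemma coeff_le_poly_height: "\<bar>coeff p i\<bar> \<le> poly_height p"
proof (cases "i \<le> degree p")
  case True
  then show ?thesis unfolding poly_height_def by (intro Max_ge) auto
next
  case False
  then have "coeff p i = 0" by (simp add: coeff_eq_0)
  moreover have "\<bar>coeff p 0\<bar> \<le> poly_height p" unfolding poly_height_def by (intro Max_ge) auto
  ultimately show ?thesis by (metis abs_ge_zero abs_zero order_trans)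
qed

lemma poly_height_ge_1:
  assumes "algebraic_int \<alpha>"
  shows "real_of_rat (poly_height (rat_min_poly \<alpha>)) \<ge> 1"
proof -
  have "1 \<le> poly_height (rat_min_poly \<alpha>)"
    using coeff_le_poly_height[of "rat_min_poly \<alpha>" "degree (rat_min_poly \<alpha>)"] rat_min_poly(1)[OF assms]
    by simp
  then show ?thesis by (metis of_rat_1 of_rat_less_eq)
qed

lemma log_mahler_measure_le:
  assumes ai: "algebraic_int \<alpha>"
  shows "(\<Sum>x\<in>conjugates \<alpha>. ln (max 1 (cmod x))) \<le>
    ln (real (alg_degree \<alpha>) + 1) + ln (real_of_rat (poly_height (rat_min_poly \<alpha>)))"
proof -
  let ?A = "conjugates \<alpha>" and ?H = "real_of_rat (poly_height (rat_min_poly \<alpha>))"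
  let ?d = "alg_degree \<alpha>" and ?M = "\<Prod>x\<in>conjugates \<alpha>. max 1 (cmod x)"
  have finA: "finite ?A" and cardA: "card ?A = ?d" using card_conjugates[OF ai] by auto
  have H1: "?H \<ge> 1" by (rule poly_height_ge_1[OF ai])
  have "cmod (coeff (\<Prod>x\<in>?A. [:- x, 1:]) i) \<le> ?H" for i
  proof -
    have "coeff (\<Prod>x\<in>?A. [:- x, 1:]) i = of_rat (coeff (rat_min_poly \<alpha>) i)"
      by (simp add: coeff_map_poly flip: min_poly_factorization[OF ai])
    then have "cmod (coeff (\<Prod>x\<in>?A. [:- x, 1:]) i) = real_of_rat \<bar>coeff (rat_min_poly \<alpha>) i\<bar>"
      by (simp add: cmod_of_rat abs_of_rat)
    also have "\<dots> \<le> ?H" unfolding of_rat_less_eq by (rule coeff_le_poly_height)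
    finally show ?thesis .
  qed
  then have "coeff_norm2 (\<Prod>x\<in>?A. [:- x, 1:]) ?d \<le> (\<Sum>i\<le>?d. ?H\<^sup>2)"
    unfolding coeff_norm2_def by (intro sum_mono power_mono) auto
  also have "\<dots> = (real ?d + 1) * ?H\<^sup>2" by simp
  also have "\<dots> \<le> (real ?d + 1)\<^sup>2 * ?H\<^sup>2"
    by (intro mult_right_mono) (auto simp: power2_eq_square)
  finally have "?M\<^sup>2 \<le> ((real ?d + 1) * ?H)\<^sup>2"
    using landau_inequality[OF finA] unfolding cardA power_mult_distrib by linarith
  then have le: "?M \<le> (real ?d + 1) * ?H"
    by (rule power2_le_imp_le) (use H1 in auto)
  have "?M \<ge> 1" by (intro prod_ge_1) auto
  have "(\<Sum>x\<in>?A. ln (max 1 (cmod x))) = ln ?M"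
    using finA by (subst ln_prod) (auto simp: max_def intro: less_le_trans[OF zero_less_one])
  also have "\<dots> \<le> ln ((real ?d + 1) * ?H)"
    using le \<open>?M \<ge> 1\<close> H1 by (subst ln_le_cancel_iff) auto
  also have "\<dots> = ln (real ?d + 1) + ln ?H"
    using H1 by (intro ln_mult_pos) auto
  finally show ?thesis .
qed

section \<open>From the exponents to a gap in the moduli\<close>

text \<open>Summation by parts, in the form of an induction that lowers the bound \<open>z\<close> to the next value of
  \<open>y\<close>.\<close>

lemma abel_nonneg:
  fixes b y :: "nat \<Rightarrow> real"
  assumes "\<And>i. i \<le> m \<Longrightarrow> (\<Sum>j<i. b j) \<ge> 0"
    and "\<And>i j. i \<le> j \<Longrightarrow> j < m \<Longrightarrow> y j \<le> y i" and "\<And>i. i < m \<Longrightarrow> z \<le> y i"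
  shows "z * (\<Sum>j<m. b j) \<le> (\<Sum>j<m. b j * y j)"
  using assms
proof (induction m arbitrary: z)
  case (Suc m)
  have "y m * (\<Sum>j<m. b j) \<le> (\<Sum>j<m. b j * y j)"
    by (rule Suc.IH) (use Suc.prems in auto)
  then have "y m * (\<Sum>j<Suc m. b j) \<le> (\<Sum>j<Suc m. b j * y j)"
    by (simp add: algebra_simps)
  moreover have "z * (\<Sum>j<Suc m. b j) \<le> y m * (\<Sum>j<Suc m. b j)"
    using Suc.prems(1)[of "Suc m"] Suc.prems(3)[of m] by (intro mult_right_mono) auto
  ultimately show ?case by linarith
qed simp

text \<open>By hypothesis the partial sums of the weights, up to index \<open>k\<close>, dominate those of the constant
  weight \<open>W / d\<close>, where \<open>W\<close> is the total weight. So for non-increasing \<open>x\<close> the weighted sum is at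
  least the one with weight \<open>W / d\<close> on \<open>d\<close> indices, with \<open>x k\<close> standing in for every \<open>x i\<close> with \<open>i
  \<ge> k\<close>; and this substitution increases the sum of the \<open>x i\<close> by at least \<open>x k - x (d - 1)\<close>.\<close>

lemma weighted_log_sum_lower_bound:
  fixes w x :: "nat \<Rightarrow> real"
  assumes "0 < k" "k < d"
    and ps: "\<And>m. 1 \<le> m \<Longrightarrow> m \<le> k \<Longrightarrow> real m * (\<Sum>i\<le>k. w i) \<le> real d * (\<Sum>i<m. w i)"
    and w1: "(\<Sum>i\<le>k. w i) \<ge> 1"
    and dec: "\<And>i j. i \<le> j \<Longrightarrow> j < d \<Longrightarrow> x j \<le> x i"
    and nn: "(\<Sum>i<d. x i) \<ge> 0"
  shows "((\<Sum>i<d. x i) + (x k - x (d - 1))) / real d \<le> (\<Sum>i\<le>k. w i * x i)"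
proof -
  define W where "W = (\<Sum>i\<le>k. w i)"
  define b where "b i = w i - W / real d" for i
  have d0: "real d > 0" using assms(2) by simp
  have "(\<Sum>j<m. b j) \<ge> 0" if "m \<le> k" for m
  proof (cases "m = 0")
    case False
    then have "real m * W / real d \<le> (\<Sum>j<m. w j)"
      using ps[of m] that d0 by (simp add: W_def divide_le_eq mult.commute)
    then show ?thesis by (simp add: b_def sum_subtractf)
  qed simp
  then have "0 * (\<Sum>j<k. b j) \<le> (\<Sum>j<k. b j * (x j - x k))"
    using dec assms(2) by (intro abel_nonneg) auto
  then have "0 \<le> (\<Sum>j<k. w j * (x j - x k)) - (\<Sum>j<k. W / real d * (x j - x k))"
    by (simp add: b_def left_diff_distrib sum_subtractf)
  also have "(\<Sum>j<k. w j * (x j - x k)) = (\<Sum>j\<le>k. w j * (x j - x k))"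
    by (simp add: lessThan_Suc_atMost[symmetric] del: lessThan_Suc_atMost)
  also have "\<dots> = (\<Sum>j\<le>k. w j * x j) - W * x k"
    by (simp add: right_diff_distrib sum_subtractf W_def sum_distrib_right)
  also have "(\<Sum>j<k. W / real d * (x j - x k)) = W / real d * ((\<Sum>j<k. x j) - real k * x k)"
    by (simp only: sum_distrib_left[symmetric] sum_subtractf) simp
  finally have L: "W * x k + W / real d * ((\<Sum>j<k. x j) - real k * x k) \<le> (\<Sum>j\<le>k. w j * x j)"
    by linarith
  have "W * x k + W / real d * ((\<Sum>j<k. x j) - real k * x k) =
      W / real d * ((\<Sum>j<k. x j) + (real d - real k) * x k)"
    using d0 by (simp add: field_simps)
  moreover have "(\<Sum>i<d. x i) + (x k - x (d - 1)) \<le> (\<Sum>j<k. x j) + (real d - real k) * x k"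
  proof -
    have un: "{..<d} = {..<k} \<union> {k..<d - 1} \<union> {d - 1}" using assms by auto
    have "(\<Sum>i<d. x i) = (\<Sum>i<k. x i) + (\<Sum>i\<in>{k..<d - 1}. x i) + x (d - 1)"
      unfolding un using assms(2) by (subst sum.union_disjoint, auto)+
    moreover have "(\<Sum>i\<in>{k..<d - 1}. x i) \<le> (\<Sum>i\<in>{k..<d - 1}. x k)"
      using dec by (intro sum_mono) auto
    moreover have "(\<Sum>i\<in>{k..<d - 1}. x k) = (real d - 1 - real k) * x k"
      using assms(2) by (simp add: of_nat_diff)
    ultimately show ?thesis by (simp add: algebra_simps)
  qed
  moreover have "x (d - 1) \<le> x k" using assms(2) by (intro dec) auto
  ultimately have "1 / real d * ((\<Sum>i<d. x i) + (x k - x (d - 1))) \<le>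
      W * x k + W / real d * ((\<Sum>j<k. x j) - real k * x k)"
    using w1 nn d0 by (simp only: W_def) (intro mult_mono divide_right_mono, auto)
  then show ?thesis using L by simp
qed

section \<open>The gap in the moduli of the conjugates of a unit\<close>

lemma card_distinct_tuples_le:
  assumes "finite A"
  shows "card (distinct_tuples A t) \<le> card A ^ t"
proof -
  have "distinct_tuples A t \<subseteq> {xs. set xs \<subseteq> A \<and> length xs = t}" by (auto simp: distinct_tuples_def)
  then have "card (distinct_tuples A t) \<le> card {xs. set xs \<subseteq> A \<and> length xs = t}"
    using assms by (intro card_mono finite_lists_length_eq)
  then show ?thesis by (simp add: card_lists_length_eq assms)
qed

text \<open>\<open>separation_of_monomials\<close> for monomials of total degree 4, solved for \<open>\<delta>\<close>. Here \<open>\<Phi> \<alpha>\<close> is the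
  logarithm of the Mahler measure. The factor \<open>exp (- 2 * \<Phi> \<alpha> / d)\<close> in the size of the differences
  is what improves the exponent \<open>E\<close> to \<open>E - 2 / d\<close>.\<close>

lemma log_gap_from_tuples:
  fixes \<delta> E :: real and s :: nat
  defines "\<Phi> \<equiv> \<lambda>\<alpha>. \<Sum>x\<in>conjugates \<alpha>. ln (max 1 (cmod x))"
  assumes ai: "algebraic_int \<alpha>" and len: "length fs = length es" "length es \<le> 4"
    and total: "sum_list es + sum_list fs = 4"
    and S: "S \<subseteq> distinct_tuples (conjugates \<alpha>) (length es)" "\<And>xs. xs \<in> S \<Longrightarrow> monomial_at es xs \<noteq> monomial_at fs xs"
      "\<And>xs. xs \<in> S \<Longrightarrow> cmod (monomial_at es xs - monomial_at fs xs) \<le>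
          4 * \<delta> * exp (- 2 * \<Phi> \<alpha> / real (alg_degree \<alpha>))"
    and \<delta>: "0 \<le> \<delta>" "\<delta> \<le> 1 / 8" and s: "0 < s" "s \<le> card S"
    and E: "4 * real (card (distinct_tuples (conjugates \<alpha>) (length es))) / (real (alg_degree \<alpha>) * real s) \<le> E"
  shows "0 < \<delta> \<and>
    - ln 4 - real (alg_degree \<alpha> ^ 4) * ln 2 - (E - 2 / real (alg_degree \<alpha>)) * \<Phi> \<alpha> \<le> ln \<delta>"
proof -
  let ?d = "alg_degree \<alpha>" and ?D = "distinct_tuples (conjugates \<alpha>) (length es)"
  let ?N = "card ?D" and ?\<Phi> = "\<Phi> \<alpha>"
  define \<epsilon> where "\<epsilon> = 4 * \<delta> * exp (- 2 * ?\<Phi> / real ?d)"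
  have finA: "finite (conjugates \<alpha>)" and cardA: "card (conjugates \<alpha>) = ?d"
    using card_conjugates[OF ai] by auto
  have d0: "?d > 0"
    using finA self_in_conjugates[OF ai] unfolding cardA[symmetric] by (auto simp: card_gt_0_iff)
  have \<Phi>0: "?\<Phi> \<ge> 0" unfolding \<Phi>_def by (intro sum_nonneg) simp
  have e1: "exp (- 2 * ?\<Phi> / real ?d) \<le> 1" using \<Phi>0 d0 by simp
  have "\<epsilon> \<le> 4 * \<delta> * 1" unfolding \<epsilon>_def using \<delta> e1 by (intro mult_left_mono) auto
  then have \<epsilon>1: "0 \<le> \<epsilon>" "\<epsilon> \<le> 1" using \<delta> by (auto simp: \<epsilon>_def)
  let ?K = "2 ^ ?N * exp (real ?N / real ?d * real (sum_list es + sum_list fs) * ?\<Phi>)"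
  have "1 \<le> \<epsilon> ^ card S * ?K"
    unfolding \<Phi>_def by (rule separation_of_monomials[OF ai len(1)]) (use S in \<open>auto simp: \<epsilon>_def\<close>)
  also have "\<dots> \<le> \<epsilon> ^ s * ?K"
    using \<epsilon>1 s by (intro mult_right_mono power_decreasing) auto
  finally have one: "1 \<le> \<epsilon> ^ s * ?K" .
  have "\<epsilon> \<noteq> 0"
  proof
    assume "\<epsilon> = 0"
    with one s show False by (simp add: zero_power)
  qed
  then have \<epsilon>pos: "\<epsilon> > 0" using \<epsilon>1 by simp
  then have \<delta>pos: "\<delta> > 0" using \<delta> by (auto simp: \<epsilon>_def zero_less_mult_iff)
  have "0 \<le> ln (\<epsilon> ^ s * ?K)" using one by simp
  also have "\<dots> = ln (\<epsilon> ^ s) + ln ?K" using \<epsilon>pos by (intro ln_mult_pos) auto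
  also have "ln ?K = ln (2 ^ ?N) + ln (exp (real ?N / real ?d * real (sum_list es + sum_list fs) * ?\<Phi>))"
    by (intro ln_mult_pos) auto
  also have "ln (\<epsilon> ^ s) = real s * ln \<epsilon>" using \<epsilon>pos by (simp add: ln_realpow)
  also have "ln (2 ^ ?N :: real) = real ?N * ln 2" by (simp add: ln_realpow)
  finally have "0 \<le> real s * ln \<epsilon> + (real ?N * ln 2 + real ?N / real ?d * 4 * ?\<Phi>)"
    using total by simp
  then have "- (real ?N * ln 2) - 4 * real ?N / real ?d * ?\<Phi> \<le> real s * ln \<epsilon>" by simp
  then have "(- (real ?N * ln 2) - 4 * real ?N / real ?d * ?\<Phi>) / real s \<le> ln \<epsilon>"
    using s by (simp add: divide_le_eq mult.commute)
  moreover have "(- (real ?N * ln 2) - 4 * real ?N / real ?d * ?\<Phi>) / real s =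
      - (real ?N * ln 2 / real s) - 4 * real ?N / (real ?d * real s) * ?\<Phi>"
    using s d0 by (simp add: field_simps)
  moreover have "4 * real ?N / (real ?d * real s) * ?\<Phi> \<le> E * ?\<Phi>"
    using E \<Phi>0 by (intro mult_right_mono)
  moreover have "real ?N * ln 2 / real s \<le> real (?d ^ 4) * ln 2"
  proof -
    have "?N \<le> ?d ^ length es" using card_distinct_tuples_le[OF finA] cardA by simp
    also have "\<dots> \<le> ?d ^ 4" using len d0 by (intro power_increasing) auto
    finally have N: "real ?N \<le> real (?d ^ 4)" by (simp only: of_nat_le_iff)
    have "real ?N * ln 2 / real s \<le> real ?N * ln 2 / 1"
      using s by (intro divide_left_mono) auto
    also have "\<dots> \<le> real (?d ^ 4) * ln 2" using N by (simp add: mult_right_mono)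
    finally show ?thesis .
  qed
  ultimately have "- (real (?d ^ 4) * ln 2) - E * ?\<Phi> \<le> ln \<epsilon>" by linarith
  also have "ln \<epsilon> = ln 4 + ln \<delta> - 2 * ?\<Phi> / real ?d"
    unfolding \<epsilon>_def using \<delta>pos by (simp add: ln_mult_pos)
  finally have "- ln 4 - real (?d ^ 4) * ln 2 - (E * ?\<Phi> - 2 * ?\<Phi> / real ?d) \<le> ln \<delta>" by linarith
  moreover have "E * ?\<Phi> - 2 * ?\<Phi> / real ?d = (E - 2 / real ?d) * ?\<Phi>" by (simp add: algebra_simps)
  ultimately show ?thesis using \<delta>pos by simp
qed

lemma card_distinct_tuples_values:
  assumes "finite A" "card A = d"
  shows "real (card (distinct_tuples A 2)) = real d * (real d - 1)"
    "real (card (distinct_tuples A 3)) = real d * (real d - 1) * (real d - 2)"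
    "real (card (distinct_tuples A 4)) = real d * (real d - 1) * (real d - 2) * (real d - 3)"
proof -
  have 1: "real (card (distinct_tuples A 1)) = real d" using card_distinct_tuples_Suc[OF assms(1), of 0] assms(2) by simp
  show 2: "real (card (distinct_tuples A 2)) = real d * (real d - 1)"
    using card_distinct_tuples_Suc[OF assms(1), of 1] 1 assms(2) by (simp add: numeral_2_eq_2 mult.commute)
  show 3: "real (card (distinct_tuples A 3)) = real d * (real d - 1) * (real d - 2)"
    using card_distinct_tuples_Suc[OF assms(1), of 2] 2 assms(2) by (simp add: numeral_3_eq_3 numeral_2_eq_2 mult.commute)
  show "real (card (distinct_tuples A 4)) = real d * (real d - 1) * (real d - 2) * (real d - 3)"
    using card_distinct_tuples_Suc[OF assms(1), of 3] 3 assms(2) by (simp add: eval_nat_numeral mult.commute)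
qed

text \<open>Complex conjugation exchanges the members in the upper and in the lower half plane.\<close>

lemma even_card_if_no_real:
  assumes fin: "finite (X :: complex set)" and cl: "\<And>x. x \<in> X \<Longrightarrow> cnj x \<in> X"
    and nr: "\<And>x. x \<in> X \<Longrightarrow> cnj x \<noteq> x"
  shows "even (card X)"
proof -
  let ?U = "{x\<in>X. Im x > 0}" and ?L = "{x\<in>X. Im x < 0}"
  have "Im x \<noteq> 0" if "x \<in> X" for x using nr[OF that] by (auto simp: complex_eq_iff)
  then have X: "X = ?U \<union> ?L" by force
  have "?L = cnj ` ?U"
  proof (intro equalityI subsetI)
    fix x assume "x \<in> ?L"
    then have "cnj x \<in> ?U" using cl by simp
    then show "x \<in> cnj ` ?U" by (intro image_eqI[of _ _ "cnj x"]) simp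
  qed (use cl in auto)
  then have "card ?L = card ?U" using card_image[of cnj ?U] by (simp add: inj_on_def)
  moreover have "card X = card ?U + card ?L"
    by (subst X, rule card_Un_disjoint) (use fin in auto)
  ultimately show ?thesis by simp
qed

lemma min_modulus_le_1:
  assumes fin: "finite A" and pr: "(\<Prod>x\<in>A. cmod x) = 1"
    and w: "w \<in> A" "\<And>x. x \<in> A \<Longrightarrow> cmod w \<le> cmod x"
  shows "cmod w \<le> 1"
proof (rule ccontr)
  assume "\<not> cmod w \<le> 1"
  then have "cmod x > 1" if "x \<in> A" for x using w(2)[OF that] by linarith
  then have "1 < (\<Prod>x\<in>A. cmod x)"
    using fin w(1) by (intro less_1_prod) auto
  then show False using pr by simp
qed

text \<open>As the logarithms of the moduli sum to 0, the logarithm of the Mahler measure is also the sum of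
  the negative parts, each of which is at most \<open>- ln (cmod w)\<close>.\<close>

lemma min_modulus_le_mahler:
  assumes fin: "finite A" and nz: "\<And>x. x \<in> A \<Longrightarrow> x \<noteq> 0"
    and pr: "(\<Prod>x\<in>A. cmod x) = 1" and w: "w \<in> A" "\<And>x. x \<in> A \<Longrightarrow> cmod w \<le> cmod x"
  shows "(cmod w)\<^sup>2 \<le> exp (- 2 * (\<Sum>x\<in>A. ln (max 1 (cmod x))) / real (card A))"
proof -
  define \<Phi> where "\<Phi> = (\<Sum>x\<in>A. ln (max 1 (cmod x)))"
  have c0: "card A > 0" using fin w by (auto simp: card_gt_0_iff)
  have w0: "cmod w > 0" using nz[OF w(1)] by simp
  have "cmod w \<le> 1" by (rule min_modulus_le_1[OF fin pr w])
  then have lw: "ln (cmod w) \<le> 0" using w0 by simp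
  have "(\<Sum>x\<in>A. ln (cmod x)) = ln (\<Prod>x\<in>A. cmod x)"
    using nz fin by (subst ln_prod) auto
  then have s0: "(\<Sum>x\<in>A. ln (cmod x)) = 0" using pr by simp
  have "ln (max 1 (cmod x)) \<le> ln (cmod x) - ln (cmod w)" if "x \<in> A" for x
  proof (cases "cmod x \<ge> 1")
    case True
    then show ?thesis using lw by (simp add: max_def)
  next
    case False
    have "ln (cmod w) \<le> ln (cmod x)" using w(2)[OF that] w0 nz[OF that] by simp
    then show ?thesis using False by (simp add: max_def)
  qed
  then have "\<Phi> \<le> (\<Sum>x\<in>A. ln (cmod x) - ln (cmod w))" unfolding \<Phi>_def by (rule sum_mono)
  also have "\<dots> = - real (card A) * ln (cmod w)" by (simp add: sum_subtractf s0)
  finally have upper: "\<Phi> \<le> - real (card A) * ln (cmod w)" .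
  have "2 * l * c \<le> - 2 * F" if "F \<le> - c * l" for F c l :: real
    using that by (simp add: mult.commute)
  from this[OF upper] have "2 * ln (cmod w) * real (card A) \<le> - 2 * \<Phi>" .
  then have "2 * ln (cmod w) \<le> - 2 * \<Phi> / real (card A)"
    using c0 by (simp only: pos_le_divide_eq of_nat_0_less_iff)
  then have "exp (2 * ln (cmod w)) \<le> exp (- 2 * \<Phi> / real (card A))" by simp
  moreover have "exp (2 * ln (cmod w)) = (cmod w)\<^sup>2"
    using w0 exp_of_nat_mult[of 2 "ln (cmod w)"] by simp
  ultimately show ?thesis by (simp only: \<Phi>_def)
qed

lemma mu_pos: "d > 3 * k \<Longrightarrow> mu k d \<ge> 1"
proof -
  assume "d > 3 * k"
  then have "real d / 3 > real k" by simp
  then have "\<lceil>real d / 3\<rceil> - int k > 0" by linarith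
  then have "of_int (\<lceil>real d / 3\<rceil> - int k) / (2::real) > 0" by (simp only: zero_less_divide_iff of_int_0_less_iff) simp
  then show ?thesis unfolding mu_def by linarith
qed

text \<open>The difference is at least \<open>\<lceil>d / 3\<rceil> - k\<close>, and \<open>2 * mu k d\<close> is the least even number that is. It
  is applied to the sizes \<open>S\<close> of a set of nonreal conjugates and \<open>T\<close> of its part on a circle; both
  are even as these sets are closed under complex conjugation.\<close>

lemma two_mu_le:
  assumes T: "3 * T \<le> 2 * d" and S: "d \<le> S + k" and ev: "even S" "even T" and "T \<le> S"
  shows "2 * mu k d \<le> int S - int T"
proof -
  have "real d / 3 \<le> of_int (int d - int T)" using T by simp
  then have q: "\<lceil>real d / 3\<rceil> \<le> int d - int T" by (simp only: ceiling_le_iff)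
  have "even (int S - int T)" using ev by simp
  then obtain j where j: "int S - int T = 2 * j" by (elim evenE)
  have "of_int (\<lceil>real d / 3\<rceil> - int k) \<le> (of_int (2 * j) :: real)"
    unfolding of_int_le_iff using q S j by linarith
  then have "of_int (\<lceil>real d / 3\<rceil> - int k) / (2::real) \<le> of_int j" by simp
  then have "mu k d \<le> j" unfolding mu_def by (simp only: ceiling_le_iff)
  then show ?thesis using j by simp
qed

lemma exp_minus_one_le: "0 \<le> x \<Longrightarrow> x \<le> 1 \<Longrightarrow> exp x - 1 \<le> 2 * (x::real)"
proof -
  assume x: "0 \<le> x" "x \<le> 1"
  have "x\<^sup>2 \<le> x" using mult_left_le[OF x(2,1)] by (simp add: power2_eq_square)
  then show ?thesis using exp_bound[OF x] by linarith
qed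

text \<open>The set \<open>S\<close> of the conjugates of modulus at most \<open>cmod (a k)\<close> has more than \<open>2 * d / 3\<close>
  elements, and their moduli differ at most by the factor \<open>exp \<delta>\<close>. So for \<open>x\<close>, \<open>y\<close> in \<open>S\<close> the
  difference \<open>x * cnj x - y * cnj y\<close> is of size \<open>\<delta>\<close>, relative to the square of the smallest
  modulus, and it is a difference of monomials in the conjugates. No circle contains more than \<open>2
  * d / 3\<close> of the conjugates in \<open>S\<close>: otherwise the largest modulus would exceed the smallest,
  which is at most 1, at most by the factor \<open>exp (2 * \<delta>)\<close>, against the lower bound \<open>1 + \<theta>\<close>. So
  many of these differences are nonzero, and \<open>separation_of_monomials\<close> bounds \<open>\<delta>\<close> from below.

  If \<open>S\<close> contains a real number \<open>x\<close>, a single \<open>y\<close> of a different modulus yields the tuples for the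
  first term in \<open>calE\<close>: of length 2 or 3, according to whether \<open>y\<close> is real, and two of them by
  symmetry. Otherwise there are at least \<open>8 * mu k d\<close> tuples of length 4, which yields the second
  term.\<close>

lemma unit_gap:
  fixes \<alpha> :: complex and a :: "nat \<Rightarrow> complex" and k d :: nat and \<theta> :: real
  defines "\<delta> \<equiv> ln (cmod (a k)) - ln (cmod (a (d - 1)))"
    and "\<Phi> \<equiv> \<Sum>x\<in>conjugates \<alpha>. ln (max 1 (cmod x))"
  assumes ai: "algebraic_int \<alpha>" and deg: "alg_degree \<alpha> = d" and k: "0 < k" "d > 3 * k"
    and lab: "conj_labelling \<alpha> a" and unit: "(\<Prod>x\<in>conjugates \<alpha>. cmod x) = 1"
    and \<theta>: "\<theta> > 0" "\<exists>x\<in>conjugates \<alpha>. cmod x \<ge> 1 + \<theta>"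
    and small: "\<delta> \<le> 1 / 8" "3 * \<delta> < ln (1 + \<theta>)"
  shows "0 < \<delta> \<and> - ln 4 - real (d ^ 4) * ln 2 - (calE k d - 2 / real d) * \<Phi> \<le> ln \<delta>"
proof -
  let ?A = "conjugates \<alpha>"
  have d4: "d \<ge> 4" using k by simp
  have kd: "k \<le> d - 1" "k < d" using k by auto
  have finA: "finite ?A" and cardA: "card ?A = d" using card_conjugates[OF ai] deg by auto
  have A0: "x \<noteq> 0" if "x \<in> ?A" for x using zero_notin_conjugates[OF ai] deg d4 that by auto
  have bij: "bij_betw a {..<d} ?A" and mono: "\<And>i j. i \<le> j \<Longrightarrow> j < d \<Longrightarrow> cmod (a j) \<le> cmod (a i)"
    using lab unfolding conj_labelling_def deg by auto
  have aA: "a i \<in> ?A" if "i < d" for i using bij that by (auto simp: bij_betw_def)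
  have img: "\<exists>i<d. x = a i" if "x \<in> ?A" for x using bij that by (auto simp: bij_betw_def)
  define w where "w = a (d - 1)"
  define u where "u = a 0"
  have wA: "w \<in> ?A" and uA: "u \<in> ?A" using aA d4 by (auto simp: w_def u_def)
  have wmin: "cmod w \<le> cmod x" if x: "x \<in> ?A" for x
  proof -
    obtain i where "i < d" "x = a i" using img[OF x] by blast
    then show ?thesis using mono[of i "d - 1"] by (simp add: w_def)
  qed
  have umax: "cmod x \<le> cmod u" if "x \<in> ?A" for x
    using img[OF that] mono unfolding u_def by auto
  have w0: "cmod w > 0" and ak0: "cmod (a k) > 0" using A0 wA aA kd by auto
  have u1: "cmod u \<ge> 1 + \<theta>" using \<theta> umax by force
  have \<delta>0: "\<delta> \<ge> 0" unfolding \<delta>_def using wmin[OF aA[OF kd(2)]] w0 ak0 by (simp add: w_def)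
  define \<rho> where "\<rho> = (cmod w)\<^sup>2"
  have \<rho>: "\<rho> \<le> exp (- 2 * \<Phi> / real d)"
    using min_modulus_le_mahler[OF finA A0 unit wA wmin] by (simp add: \<rho>_def \<Phi>_def cardA)
  have "\<rho> \<ge> 0" by (simp add: \<rho>_def)
  have ak: "cmod (a k) = cmod w * exp \<delta>"
    using w0 ak0 by (simp add: \<delta>_def exp_diff w_def)
  \<comment> \<open>not just the conjugates labelled \<open>k, \<dots>, d - 1\<close>: a complex pair may be split by the labelling\<close>
  define S where "S = {x\<in>?A. cmod x \<le> cmod (a k)}"
  have finS: "finite S" and SA: "S \<subseteq> ?A" using finA by (auto simp: S_def)
  have cnjS: "cnj x \<in> S" if "x \<in> S" for x using that cnj_conjugate by (auto simp: S_def)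
  have "a ` {k..<d} \<subseteq> S" using aA mono by (auto simp: S_def)
  then have "card (a ` {k..<d}) \<le> card S" using finS by (intro card_mono)
  moreover have "inj_on a {k..<d}" using bij unfolding bij_betw_def by (rule inj_on_subset[OF conjunct1]) auto
  ultimately have cardS: "d \<le> card S + k" by (simp add: card_image)
  have wS: "w \<in> S" using wA wmin[OF aA[OF kd(2)]] by (simp add: S_def)
  have sq: "\<rho> \<le> (cmod x)\<^sup>2" "(cmod x)\<^sup>2 \<le> \<rho> * exp (2 * \<delta>)" if "x \<in> S" for x
  proof -
    show "\<rho> \<le> (cmod x)\<^sup>2" unfolding \<rho>_def using wmin[of x] that SA by (intro power_mono) auto
    have "(cmod x)\<^sup>2 \<le> (cmod w * exp \<delta>)\<^sup>2" using that ak by (intro power_mono) (auto simp: S_def)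
    also have "\<dots> = \<rho> * exp (2 * \<delta>)"
      using exp_of_nat_mult[of 2 \<delta>] by (simp add: \<rho>_def power_mult_distrib)
    finally show "(cmod x)\<^sup>2 \<le> \<rho> * exp (2 * \<delta>)" .
  qed
  have close: "cmod (of_real ((cmod x)\<^sup>2) - of_real ((cmod y)\<^sup>2)) \<le> 4 * \<delta> * exp (- 2 * \<Phi> / real d)"
    if "x \<in> S" "y \<in> S" for x y
  proof -
    have "cmod (of_real ((cmod x)\<^sup>2) - of_real ((cmod y)\<^sup>2)) = \<bar>(cmod x)\<^sup>2 - (cmod y)\<^sup>2\<bar>"
      by (simp only: of_real_diff[symmetric] norm_of_real)
    also have "\<dots> \<le> \<rho> * exp (2 * \<delta>) - \<rho>" using sq[OF that(1)] sq[OF that(2)] by linarith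
    also have "\<dots> = \<rho> * (exp (2 * \<delta>) - 1)" by (simp add: algebra_simps)
    also have "\<dots> \<le> \<rho> * (2 * (2 * \<delta>))"
      using \<delta>0 small \<open>\<rho> \<ge> 0\<close> by (intro mult_left_mono exp_minus_one_le) auto
    also have "\<dots> \<le> exp (- 2 * \<Phi> / real d) * (2 * (2 * \<delta>))" using \<rho> \<delta>0 by (intro mult_right_mono) auto
    finally show ?thesis by (simp add: mult_ac)
  qed
  \<comment> \<open>a circle with too many conjugates forces the largest modulus close to 1\<close>
  have not_many: "3 * card {y\<in>?A. cmod y = cmod x} \<le> 2 * d" if "x \<in> S" for x
  proof (rule ccontr)
    assume "\<not> ?thesis"
    then have "cmod u * cmod w = (cmod x)\<^sup>2"
      using cmod_extremes_if_many_equal_moduli[OF ai, of "cmod x" u w] deg d4 uA umax wA wmin by simp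
    also have "\<dots> \<le> \<rho> * exp (2 * \<delta>)" by (rule sq(2)[OF that])
    also have "\<dots> = (cmod w * exp (2 * \<delta>)) * cmod w" by (simp add: \<rho>_def power2_eq_square)
    finally have "cmod u \<le> cmod w * exp (2 * \<delta>)" using w0 by (simp add: mult_le_cancel_right)
    moreover have "cmod w \<le> 1" by (rule min_modulus_le_1[OF finA unit wA wmin])
    then have "cmod w * exp (2 * \<delta>) \<le> 1 * exp (2 * \<delta>)" by (intro mult_right_mono) auto
    ultimately have "1 + \<theta> \<le> exp (2 * \<delta>)" using u1 by linarith
    then have "ln (1 + \<theta>) \<le> ln (exp (2 * \<delta>))" using \<theta>(1) by (subst ln_le_cancel_iff) auto
    then have "ln (1 + \<theta>) \<le> 2 * \<delta>" by simp
    then show False using small \<delta>0 by linarith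
  qed
  have S_big: "3 * card S > 2 * d" using cardS k by linarith
  have other: "\<exists>y\<in>S. cmod y \<noteq> cmod x" if "x \<in> S" for x
  proof (rule ccontr)
    assume "\<not> ?thesis"
    then have "S \<subseteq> {y\<in>?A. cmod y = cmod x}" using SA by auto
    then have "card S \<le> card {y\<in>?A. cmod y = cmod x}" using finA by (intro card_mono) auto
    then show False using not_many[OF that] S_big by linarith
  qed
  have mu1: "mu k d \<ge> 1" using mu_pos k by simp
  have E1: "2 * (real d - 1) * (real d - 2) \<le> calE k d"
    and E2: "(real d - 1) * (real d - 2) * (real d - 3) / (2 * of_int (mu k d)) \<le> calE k d"
    unfolding calE_def by auto
  have dt: "xs \<in> distinct_tuples ?A (length xs)" if "distinct xs" "set xs \<subseteq> ?A" for xs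
    using that by (simp add: distinct_tuples_def)
  note gap = log_gap_from_tuples[OF ai, unfolded deg, folded \<Phi>_def, where \<delta> = \<delta> and E = "calE k d",
      OF _ _ _ _ _ _ \<delta>0 small(1)]
  have nsq: "z * cnj z = of_real ((cmod z)\<^sup>2)" for z by (simp add: complex_norm_square[symmetric])
  show ?thesis
  proof (cases "\<exists>x\<in>S. cnj x = x")
    case True
    then obtain x where x: "x \<in> S" "cnj x = x" by blast
    obtain y where y: "y \<in> S" "cmod y \<noteq> cmod x" using other[OF x(1)] by blast
    have xx: "x ^ 2 = of_real ((cmod x)\<^sup>2)" using nsq[of x] x(2) by (simp add: power2_eq_square)
    have ne: "of_real ((cmod x)\<^sup>2) \<noteq> (of_real ((cmod y)\<^sup>2) :: complex)"
      using y(2) by (simp only: of_real_eq_iff) (simp add: power2_eq_iff_nonneg)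
    have xyA: "x \<in> ?A" "y \<in> ?A" "cnj y \<in> ?A" using x y cnjS SA by auto
    show ?thesis
    proof (cases "cnj y = y")
      case True
      have yy: "y ^ 2 = of_real ((cmod y)\<^sup>2)" using nsq[of y] True by (simp add: power2_eq_square)
      have "x \<noteq> y" using y by auto
      show ?thesis
      proof (rule gap[where es = "[2, 0]" and fs = "[0, 2]" and S = "{[x, y], [y, x]}" and s = 2])
        show "2 \<le> card {[x, y], [y, x]}" using \<open>x \<noteq> y\<close> by simp
        show "{[x, y], [y, x]} \<subseteq> distinct_tuples ?A (length [2, 0])"
          using \<open>x \<noteq> y\<close> xyA by (auto simp: distinct_tuples_def)
        show "monomial_at [2, 0] zs \<noteq> monomial_at [0, 2] zs" if "zs \<in> {[x, y], [y, x]}" for zs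
          using that ne by (auto simp: xx yy simp del: of_real_power)
        show "cmod (monomial_at [2, 0] zs - monomial_at [0, 2] zs) \<le> 4 * \<delta> * exp (- 2 * \<Phi> / real d)"
          if "zs \<in> {[x, y], [y, x]}" for zs
          using that close[OF x(1) y(1)] close[OF y(1) x(1)] by (auto simp: xx yy simp del: of_real_power)
        have "4 * real (card (distinct_tuples ?A 2)) / (real d * real 2) = 2 * (real d - 1) * 1"
          using card_distinct_tuples_values(1)[OF finA cardA] d4 by simp
        also have "\<dots> \<le> 2 * (real d - 1) * (real d - 2)" using d4 by (intro mult_left_mono) auto
        finally show "4 * real (card (distinct_tuples ?A (length [2, 0]))) / (real d * real 2) \<le> calE k d"
          using E1 by (simp add: eval_nat_numeral)
      qed auto
    next
      case False
      have dist: "x \<noteq> y" "x \<noteq> cnj y" "y \<noteq> cnj y" using y False by (auto simp: complex_mod_cnj)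
      have yy: "y * cnj y = of_real ((cmod y)\<^sup>2)" by (rule nsq)
      let ?S = "{[x, y, cnj y], [x, cnj y, y]}"
      show ?thesis
      proof (rule gap[where es = "[2, 0, 0]" and fs = "[0, 1, 1]" and S = ?S and s = 2])
        show "2 \<le> card ?S" using dist by simp
        show "?S \<subseteq> distinct_tuples ?A (length [2, 0, 0])"
          using dist xyA by (auto simp: distinct_tuples_def)
        have yy': "cnj y * y = of_real ((cmod y)\<^sup>2)" using yy by (simp only: mult.commute)
        show "monomial_at [2, 0, 0] zs \<noteq> monomial_at [0, 1, 1] zs" if "zs \<in> ?S" for zs
          using that ne by (auto simp: xx yy yy' simp del: of_real_power)
        show "cmod (monomial_at [2, 0, 0] zs - monomial_at [0, 1, 1] zs) \<le> 4 * \<delta> * exp (- 2 * \<Phi> / real d)"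
          if "zs \<in> ?S" for zs
          using that close[OF x(1) y(1)] by (auto simp: xx yy yy' simp del: of_real_power)
        have "4 * real (card (distinct_tuples ?A 3)) / (real d * real 2) = 2 * (real d - 1) * (real d - 2)"
          using card_distinct_tuples_values(2)[OF finA cardA] d4 by simp
        then show "4 * real (card (distinct_tuples ?A (length [2, 0, 0]))) / (real d * real 2) \<le> calE k d"
          using E1 by (simp add: eval_nat_numeral)
      qed auto
    qed
  next
    case False
    define P where "P = (SIGMA x:S. {y\<in>S. cmod y \<noteq> cmod x})"
    define f :: "complex \<times> complex \<Rightarrow> complex list" where
      "f p = [fst p, cnj (fst p), snd p, cnj (snd p)]" for p
    have evS: "even (card S)" using False by (intro even_card_if_no_real finS cnjS) auto
    have "card S \<ge> 3" using S_big d4 by linarith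
    then have S4: "card S \<ge> 4" using evS by presburger
    have fibre: "2 * mu k d \<le> int (card {y\<in>S. cmod y \<noteq> cmod x})" if "x \<in> S" for x
    proof -
      let ?T = "{y\<in>S. cmod y = cmod x}"
      have evT: "even (card ?T)" using False finS cnjS by (intro even_card_if_no_real) auto
      have "card ?T \<le> card {y\<in>?A. cmod y = cmod x}" using finA SA by (intro card_mono) auto
      then have T: "3 * card ?T \<le> 2 * d" using not_many[OF that] by linarith
      have TS: "card ?T \<le> card S" using finS by (intro card_mono) auto
      have "{y\<in>S. cmod y \<noteq> cmod x} = S - ?T" by auto
      then have "int (card {y\<in>S. cmod y \<noteq> cmod x}) = int (card S) - int (card ?T)"
        using finS TS by (simp add: card_Diff_subset of_nat_diff)
      then show ?thesis using two_mu_le[OF T cardS evS evT TS] by simp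
    qed
    \<comment> \<open>at least 4 choices of \<open>x\<close>, each with at least \<open>2 * mu k d\<close> choices of \<open>y\<close>\<close>
    have cardP: "8 * nat (mu k d) \<le> card P"
    proof -
      have "4 * (2 * mu k d) \<le> int (card S) * (2 * mu k d)" using S4 mu1 by (intro mult_right_mono) auto
      also have "\<dots> = (\<Sum>x\<in>S. 2 * mu k d)" by simp
      also have "\<dots> \<le> (\<Sum>x\<in>S. int (card {y\<in>S. cmod y \<noteq> cmod x}))" by (intro sum_mono fibre)
      also have "\<dots> = int (card P)" unfolding P_def using finS by (simp add: card_SigmaI)
      finally show ?thesis using mu1 by linarith
    qed
    have P: "fst p \<in> S" "snd p \<in> S" "cmod (fst p) \<noteq> cmod (snd p)" if "p \<in> P" for p
      using that by (auto simp: P_def)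
    have inj: "inj_on f P" by (intro inj_onI) (auto simp: f_def prod_eq_iff)
    show ?thesis
    proof (rule gap[where es = "[1, 1, 0, 0]" and fs = "[0, 0, 1, 1]" and S = "f ` P" and s = "8 * nat (mu k d)"])
      show "8 * nat (mu k d) \<le> card (f ` P)" using cardP by (simp add: card_image[OF inj])
      show "0 < 8 * nat (mu k d)" using mu1 by simp
      show "f ` P \<subseteq> distinct_tuples ?A (length [1, 1, 0, 0])"
      proof
        fix zs assume "zs \<in> f ` P"
        then obtain p where p: "p \<in> P" "zs = f p" by blast
        have "fst p \<noteq> cnj (fst p)" "snd p \<noteq> cnj (snd p)" using False P(1,2)[OF p(1)] by force+
        moreover have "fst p \<noteq> snd p" "fst p \<noteq> cnj (snd p)" "cnj (fst p) \<noteq> snd p" "cnj (fst p) \<noteq> cnj (snd p)"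
          using P(3)[OF p(1)] by (auto dest: arg_cong[of _ _ cmod])
        moreover have "fst p \<in> ?A" "snd p \<in> ?A" "cnj (fst p) \<in> ?A" "cnj (snd p) \<in> ?A"
          using P(1,2)[OF p(1)] cnjS SA by auto
        ultimately show "zs \<in> distinct_tuples ?A (length [1, 1, 0, 0])"
          unfolding p(2) f_def distinct_tuples_def by (simp add: eq_commute)
      qed
      have m: "monomial_at [1, 1, 0, 0] (f p) = of_real ((cmod (fst p))\<^sup>2)"
        "monomial_at [0, 0, 1, 1] (f p) = of_real ((cmod (snd p))\<^sup>2)" for p
        unfolding f_def by (simp_all add: nsq del: of_real_power)
      show "monomial_at [1, 1, 0, 0] zs \<noteq> monomial_at [0, 0, 1, 1] zs" if zs: "zs \<in> f ` P" for zs
      proof -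
        obtain p where p: "p \<in> P" "zs = f p" using zs by blast
        show ?thesis unfolding p(2) m of_real_eq_iff using P(3)[OF p(1)]
          by (simp add: power2_eq_iff_nonneg)
      qed
      show "cmod (monomial_at [1, 1, 0, 0] zs - monomial_at [0, 0, 1, 1] zs) \<le> 4 * \<delta> * exp (- 2 * \<Phi> / real d)"
        if zs: "zs \<in> f ` P" for zs
      proof -
        obtain p where p: "p \<in> P" "zs = f p" using zs by blast
        show ?thesis unfolding p(2) m by (rule close[OF P(1,2)[OF p(1)]])
      qed
      have "real (8 * nat (mu k d)) = 8 * of_int (mu k d)" using mu1 by simp
      then have "4 * real (card (distinct_tuples ?A 4)) / (real d * real (8 * nat (mu k d))) =
          (real d - 1) * (real d - 2) * (real d - 3) / (2 * of_int (mu k d))"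
        unfolding card_distinct_tuples_values(3)[OF finA cardA] using d4 mu1 by (simp add: field_simps)
      then show "4 * real (card (distinct_tuples ?A (length [1, 1, 0, 0::nat]))) / (real d * real (8 * nat (mu k d))) \<le> calE k d"
        using E2 by (simp add: eval_nat_numeral)
    qed auto
  qed
qed

section \<open>The lower bound for the product\<close>

lemma calE_bounds:
  assumes "0 < k" "d > 3 * k"
  shows "1 \<le> calE k d" "calE k d \<le> 2 * real d ^ 3"
proof -
  have d4: "real d \<ge> 4" using assms by simp
  have "2 * 1 * 1 \<le> 2 * (real d - 1) * (real d - 2)" using d4 by (intro mult_mono) auto
  then show "1 \<le> calE k d" unfolding calE_def by linarith
  have "2 * (real d - 1) * (real d - 2) \<le> 2 * real d * (real d * real d)"
  proof (rule mult_mono)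
    have "real d * 1 \<le> real d * real d" using d4 by (intro mult_left_mono) auto
    then show "real d - 2 \<le> real d * real d" by simp
  qed (use d4 in auto)
  then have 1: "2 * (real d - 1) * (real d - 2) \<le> 2 * real d ^ 3" by (simp add: power3_eq_cube)
  have mu: "real_of_int (mu k d) \<ge> 1" using mu_pos[OF assms(2)] by simp
  have "(real d - 1) * (real d - 2) * (real d - 3) \<le> real d * real d * real d"
    using d4 by (intro mult_mono) auto
  then have "(real d - 1) * (real d - 2) * (real d - 3) / (2 * of_int (mu k d)) \<le> real d * real d * real d / 1"
    using mu d4 by (intro frac_le) auto
  also have "\<dots> \<le> 2 * real d ^ 3" using d4 by (simp add: power3_eq_cube)
  finally show "calE k d \<le> 2 * real d ^ 3" unfolding calE_def using 1 by simp
qed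

text \<open>The logarithm of the product is at least \<open>(ln n + \<delta>) / d\<close>, where \<open>n\<close> is the absolute norm and
  \<open>\<delta>\<close> the gap between the logarithms of \<open>cmod (a k)\<close> and \<open>cmod (a (d - 1))\<close>. The number \<open>\<kappa>\<close> is at
  most \<open>ln 2\<close> to serve the case \<open>n \<ge> 2\<close>, at most the thresholds of \<open>unit_gap\<close> to serve units with
  a larger gap, and at most \<open>exp (- K)\<close> to serve units with a smaller gap. In the last case \<open>K\<close>
  collects the constants from \<open>unit_gap\<close> and from the comparison of the Mahler measure with the
  height.\<close>

lemma log_product_lower_bound:
  fixes \<theta> K \<kappa> :: real and d k :: nat
  assumes d4: "d \<ge> 4" and \<theta>: "\<theta> > 0"
    and K: "K = ln 4 + real (d ^ 4) * ln 2 + 2 * real d ^ 3 * ln (real d + 1)"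
    and \<kappa>: "\<kappa> > 0" "\<kappa> \<le> ln 2" "\<kappa> \<le> 1 / 8" "\<kappa> \<le> ln (1 + \<theta>) / 3" "\<kappa> \<le> exp (- K)"
    and k: "0 < k" "d > 3 * k" and c: "c \<in> E_set k d"
    and ai: "algebraic_int \<alpha>" and deg: "alg_degree \<alpha> = d" and lab: "conj_labelling \<alpha> a"
    and house: "\<exists>x\<in>conjugates \<alpha>. cmod x \<ge> 1 + \<theta>"
  shows "1 + \<kappa> / real d * real_of_rat (poly_height (rat_min_poly \<alpha>))
      powr (- calE k d + 1 / (real k * (real d - 1))) \<le>
    cmod (a 0) * (\<Prod>i=1..k. cmod (a i) powr c i)"
proof -
  let ?A = "conjugates \<alpha>"
  define H where "H = real_of_rat (poly_height (rat_min_poly \<alpha>))"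
  define E where "E = calE k d"
  define h where "h = H powr (- E + 1 / (real k * (real d - 1)))"
  define w where "w i = (if i = 0 then 1 else c i)" for i
  define x where "x i = ln (cmod (a i))" for i
  have H1: "H \<ge> 1" unfolding H_def by (rule poly_height_ge_1[OF ai])
  have kd: "k < d" "0 < d" using k by auto
  have E1: "1 \<le> E" "E \<le> 2 * real d ^ 3" unfolding E_def using calE_bounds[OF k] by auto
  have finA: "finite ?A" and cardA: "card ?A = d" using card_conjugates[OF ai] deg by auto
  have A0: "y \<noteq> 0" if "y \<in> ?A" for y using zero_notin_conjugates[OF ai] deg d4 that by auto
  have bij: "bij_betw a {..<d} ?A" and mono: "\<And>i j. i \<le> j \<Longrightarrow> j < d \<Longrightarrow> cmod (a j) \<le> cmod (a i)"
    using lab unfolding conj_labelling_def deg by auto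
  have a0: "a i \<noteq> 0" if "i < d" for i using bij that A0 by (auto simp: bij_betw_def)
  obtain n where n: "n \<ge> 1" "(\<Prod>y\<in>?A. cmod y) = real n"
    by (rule cmod_prod_conjugates[OF ai]) (use deg d4 in auto)
  have "(\<Sum>i<d. x i) = ln (\<Prod>i<d. cmod (a i))" unfolding x_def using a0 by (subst ln_prod) auto
  also have "(\<Prod>i<d. cmod (a i)) = real n" using prod.reindex_bij_betw[OF bij, of cmod] n(2) by simp
  finally have sx: "(\<Sum>i<d. x i) = ln (real n)" .
  have dec: "x j \<le> x i" if "i \<le> j" "j < d" for i j
    using mono[OF that] a0[of i] a0[of j] that by (simp add: x_def)
  have wn: "w i \<ge> 0" if "i \<le> k" for i
    using c that by (auto simp: w_def E_set_def PiE_def Pi_def)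
  have w0: "w 0 = 1" by (simp add: w_def)
  have "w 0 \<le> (\<Sum>i\<le>k. w i)" using wn by (intro member_le_sum) auto
  then have W: "(\<Sum>i\<le>k. w i) \<ge> 1" using w0 by simp
  have ps: "real m * (\<Sum>i\<le>k. w i) \<le> real d * (\<Sum>i<m. w i)" if "1 \<le> m" "m \<le> k" for m
    unfolding w_def by (rule E_set_partial_sums[OF c that kd(1)])
  have "(\<Sum>i<d. x i) \<ge> 0" unfolding sx using n(1) by simp
  from weighted_log_sum_lower_bound[OF k(1) kd(1) ps W dec this]
  have L: "(ln (real n) + (x k - x (d - 1))) / real d \<le> (\<Sum>i\<le>k. w i * x i)" unfolding sx .
  define \<delta> where "\<delta> = x k - x (d - 1)"
  have \<delta>0: "\<delta> \<ge> 0" unfolding \<delta>_def using dec[of k "d - 1"] kd by simp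
  \<comment> \<open>the exponent gained from the smallest modulus is at least the claimed one\<close>
  have ex: "- E + 1 / (real k * (real d - 1)) \<le> - (E - 2 / real d)"
  proof -
    have "real d * 1 \<le> 2 * (real d - 1) * real k" using d4 k by (intro mult_mono) auto
    then have "1 / (real k * (real d - 1)) \<le> 2 / real d"
      using d4 k by (simp add: field_simps)
    then show ?thesis by simp
  qed
  have E2: "0 \<le> E - 2 / real d" "E - 2 / real d \<le> 2 * real d ^ 3"
  proof -
    have "2 / real d \<le> 1" using d4 by simp
    then show "0 \<le> E - 2 / real d" using E1 by linarith
    have "0 \<le> 2 / real d" by simp
    then show "E - 2 / real d \<le> 2 * real d ^ 3" using E1 by linarith
  qed
  have h_le: "h \<le> H powr (- (E - 2 / real d))"
    unfolding h_def by (rule powr_mono[OF ex H1])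
  also have "\<dots> \<le> H powr 0" using E2 H1 by (intro powr_mono) auto
  finally have h1: "h \<le> 1" using H1 by simp
  have h0: "h \<ge> 0" by (simp add: h_def)
  have \<kappa>h: "\<kappa> * h \<le> \<kappa>" using h1 h0 \<kappa>(1) by (simp add: mult_left_le)
  have key: "\<kappa> * h \<le> ln (real n) + \<delta>"
  proof (cases "n \<ge> 2")
    case True
    then have "ln 2 \<le> ln (real n)" by simp
    then show ?thesis using \<kappa>h \<kappa>(2) \<delta>0 by linarith
  next
    case False
    then have n1: "n = 1" using n(1) by simp
    show ?thesis
    proof (cases "\<delta> \<le> 1 / 8 \<and> 3 * \<delta> < ln (1 + \<theta>)")
      case False
      then have "\<kappa> \<le> \<delta>" using \<kappa> by auto
      then show ?thesis using \<kappa>h n1 by simp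
    next
      case True
      define \<Phi> where "\<Phi> = (\<Sum>y\<in>?A. ln (max 1 (cmod y)))"
      have unit: "(\<Prod>y\<in>?A. cmod y) = 1" using n(2) n1 by simp
      have g: "0 < \<delta>" "- ln 4 - real (d ^ 4) * ln 2 - (E - 2 / real d) * \<Phi> \<le> ln \<delta>"
        using unit_gap[OF ai deg k lab unit \<theta> house] True
        unfolding E_def \<Phi>_def \<delta>_def x_def by blast+
      have "(E - 2 / real d) * \<Phi> \<le> (E - 2 / real d) * (ln (real d + 1) + ln H)"
        using log_mahler_measure_le[OF ai] E2(1) unfolding \<Phi>_def H_def deg by (intro mult_left_mono)
      also have "\<dots> = (E - 2 / real d) * ln (real d + 1) + (E - 2 / real d) * ln H"
        by (rule distrib_left)
      also have "(E - 2 / real d) * ln (real d + 1) \<le> 2 * real d ^ 3 * ln (real d + 1)"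
        using E2(2) by (intro mult_right_mono) auto
      finally have "(E - 2 / real d) * \<Phi> \<le>
          2 * real d ^ 3 * ln (real d + 1) + (E - 2 / real d) * ln H" by simp
      then have "- K + - ((E - 2 / real d) * ln H) \<le> ln \<delta>" using g(2) unfolding K by linarith
      then have "- K + - (E - 2 / real d) * ln H \<le> ln \<delta>" by (simp only: mult_minus_left)
      then have "exp (- K + - (E - 2 / real d) * ln H) \<le> exp (ln \<delta>)" by (simp only: exp_le_cancel_iff)
      then have "exp (- K) * H powr (- (E - 2 / real d)) \<le> \<delta>"
        unfolding exp_add exp_ln[OF g(1)] powr_def using H1 by simp
      moreover have "\<kappa> * h \<le> exp (- K) * H powr (- (E - 2 / real d))"
        using \<kappa>(5) h_le h0 by (intro mult_mono) auto
      ultimately show ?thesis using n1 by simp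
    qed
  qed
  have "\<kappa> / real d * h = \<kappa> * h / real d" by simp
  also have "\<dots> \<le> (ln (real n) + \<delta>) / real d" using key by (intro divide_right_mono) auto
  also have "\<dots> \<le> (\<Sum>i\<le>k. w i * x i)" using L by (simp only: \<delta>_def)
  finally have fin: "\<kappa> / real d * h \<le> (\<Sum>i\<le>k. w i * x i)" .
  have "1 + \<kappa> / real d * h \<le> 1 + (\<Sum>i\<le>k. w i * x i)" using fin by simp
  also have "\<dots> \<le> exp (\<Sum>i\<le>k. w i * x i)" by (rule exp_ge_add_one_self)
  also have "\<dots> = cmod (a 0) * (\<Prod>i=1..k. cmod (a i) powr c i)"
    unfolding w_def x_def using kd by (intro prod_powr_eq_exp[symmetric] a0) auto
  finally show ?thesis unfolding h_def H_def E_def .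
qed

theorem theorem1p6:
  fixes d :: nat
  assumes "d > 0"
  shows "\<exists>C::real. C > 0 \<and>
    (\<forall>k::nat. k > 0 \<and> d > 3 * k \<longrightarrow>
      (\<forall>\<alpha>::complex. \<forall>a::nat \<Rightarrow> complex. \<forall>c \<in> E_set k d.
         algebraic_int \<alpha> \<and> alg_degree \<alpha> = d \<and> \<not> (\<exists>n>0. \<alpha> ^ n = 1) \<and> conj_labelling \<alpha> a \<longrightarrow>
           cmod (a 0) * (\<Prod>i=1..k. cmod (a i) powr c i)
             > 1 + C * real_of_rat (poly_height (rat_min_poly \<alpha>))
                         powr (- calE k d + 1 / (real k * (real d - 1)))))"
proof (cases "d \<ge> 4")
  case False
  then show ?thesis by (intro exI[of _ 1]) auto
next
  case d4: True
  obtain \<theta> :: real where \<theta>: "\<theta> > 0"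
    "\<And>\<alpha>. algebraic_int \<alpha> \<Longrightarrow> alg_degree \<alpha> = d \<Longrightarrow> \<not> (\<exists>n>0. \<alpha> ^ n = 1) \<Longrightarrow>
       \<exists>x\<in>conjugates \<alpha>. cmod x \<ge> 1 + \<theta>"
    by (rule house_gap[of d]) (use d4 in simp, rule that, assumption+)
  define K where "K = ln 4 + real (d ^ 4) * ln 2 + 2 * real d ^ 3 * ln (real d + 1)"
  have half_less: "q / 2 < q" if "q > 0" for q :: real using that by simp
  define \<kappa> where "\<kappa> = min (min (ln 2) (1 / 8)) (min (ln (1 + \<theta>) / 3) (exp (- K)))"
  have \<kappa>: "\<kappa> > 0" "\<kappa> \<le> ln 2" "\<kappa> \<le> 1 / 8" "\<kappa> \<le> ln (1 + \<theta>) / 3" "\<kappa> \<le> exp (- K)"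
    using \<theta>(1) by (auto simp: \<kappa>_def)
  \<comment> \<open>halved for the strict inequality\<close>
  define C where "C = \<kappa> / real d / 2"
  have pos: "\<kappa> / real d > 0" using \<kappa>(1) d4 by simp
  have C: "C > 0" unfolding C_def by (rule half_gt_zero[OF pos])
  have C_less: "C < \<kappa> / real d" unfolding C_def using half_less[OF pos] .
  show ?thesis
  proof (intro exI[of _ C] conjI allI ballI impI, rule C)
    fix k :: nat and \<alpha> :: complex and a :: "nat \<Rightarrow> complex" and c :: "nat \<Rightarrow> real"
    assume k: "0 < k \<and> 3 * k < d" and c: "c \<in> E_set k d"
      and \<alpha>: "algebraic_int \<alpha> \<and> alg_degree \<alpha> = d \<and> \<not> (\<exists>n>0. \<alpha> ^ n = 1) \<and> conj_labelling \<alpha> a"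
    let ?H = "real_of_rat (poly_height (rat_min_poly \<alpha>))"
    let ?h = "?H powr (- calE k d + 1 / (real k * (real d - 1)))"
    have "?H \<ge> 1" using poly_height_ge_1 \<alpha> by blast
    then have "?h > 0" by simp
    then have "1 + C * ?h < 1 + \<kappa> / real d * ?h" by (intro add_strict_left_mono mult_strict_right_mono C_less)
    also have "\<dots> \<le> cmod (a 0) * (\<Prod>i=1..k. cmod (a i) powr c i)"
      using \<alpha> k by (intro log_product_lower_bound[OF d4 \<theta>(1) K_def \<kappa> _ _ c] \<theta>(2)) auto
    finally show "1 + C * ?h < cmod (a 0) * (\<Prod>i=1..k. cmod (a i) powr c i)" .
  qed
qed

end
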